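(* Let $\mathsf{k}$ be a field. For all integers $r,d$ with $1\le r\le d$, there exists a finite simple graph $G$ such that, with $S=\mathsf{k}[V(G)]$, $\operatorname{reg}(S/I(G))=r$ and $\dim(S/I(G))=d$.
   Context: For a finite simple graph $G$ with vertex set $V(G)$ and edge set $E(G)$, the vertices are regarded as variables, $S=\mathsf{k}[V(G)]$ is the standard graded polynomial ring, and the edge ideal is $I(G)=(xy:\{x,y\}\in E(G))\subseteq S$. The (Castelnuovo-Mumford) regularity is $\operatorname{reg}(S/I)=\max\{j:\operatorname{Tor}_i^S(S/I,\mathsf{k})_{i+j}\neq0\text{ for some }i\ge0\}$, and $\dim$ denotes Krull dimension. *)

theory Defs
  imports
    "HOL-Library.Poly_Mapping"
    "HOL-Library.Extended_Real"
    "HOL-Algebra.QuotRing"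
    "HOL-Algebra.Elementary_Groups"
    "Jordan_Normal_Form.Matrix"
    "Graph_Theory.Pair_Digraph"
begin

section \<open>The polynomial ring on a set of variables\<close>

text \<open>A monomial is an exponent vector of finite support, a polynomial is a finitely supported
  family of coefficients indexed by monomials; addition and multiplication (convolution) are the
  type class operations.\<close>

type_synonym ('v, 'k) mpoly = "('v \<Rightarrow>\<^sub>0 nat) \<Rightarrow>\<^sub>0 'k"

definition mvar :: "'v \<Rightarrow> ('v, 'k::field) mpoly"
  where "mvar x = Poly_Mapping.single (Poly_Mapping.single x 1) 1"

definition poly_ring :: "'v set \<Rightarrow> ('v, 'k::field) mpoly ring"
  where "poly_ring V =
    \<lparr>carrier = {p. \<forall>m \<in> Poly_Mapping.keys p. Poly_Mapping.keys m \<subseteq> V},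
     monoid.mult = (*), one = 1, zero = 0, add = (+)\<rparr>"

definition mon_degree :: "('v \<Rightarrow>\<^sub>0 nat) \<Rightarrow> nat"
  where "mon_degree m = (\<Sum>x \<in> Poly_Mapping.keys m. Poly_Mapping.lookup m x)"

text \<open>Membership in the graded piece of degree \<open>n\<close> for the standard grading; in particular, only
  the zero polynomial is homogeneous of negative degree.\<close>

definition homogeneous :: "int \<Rightarrow> ('v, 'k::field) mpoly \<Rightarrow> bool"
  where "homogeneous n p \<longleftrightarrow> (\<forall>m \<in> Poly_Mapping.keys p. int (mon_degree m) = n)"


section \<open>Edge ideals\<close>

text \<open>A finite simple graph is a \<^locale>\<open>pair_graph\<close>: a finite, symmetric, loopfree set of arcs. The
  edge \<open>{x, y}\<close> is present as both arcs \<open>(x, y)\<close> and \<open>(y, x)\<close>, which give the same generator.\<close>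

definition edge_ideal :: "'v pair_pre_digraph \<Rightarrow> ('v, 'k::field) mpoly set"
  where "edge_ideal G =
    genideal (poly_ring (pverts G)) {mvar x * mvar y | x y. (x, y) \<in> parcs G}"


section \<open>Krull dimension\<close>

text \<open>The supremum is \<open>-\<infinity>\<close> for the zero ring, which has no prime ideals.\<close>

definition krull_dim :: "('a, 'b) ring_scheme \<Rightarrow> ereal"
  where "krull_dim R = Sup {ereal (real n) | n.
    \<exists>P. (\<forall>i\<le>n. primeideal (P i) R) \<and> (\<forall>i<n. P i \<subset> P (Suc i))}"


section \<open>Graded free resolutions\<close>

text \<open>The data of a complex \<open>\<dots> \<rightarrow> F\<^sub>1 \<rightarrow> F\<^sub>0 \<rightarrow> S/I\<close> of graded free modules of finite rank:
  \<^item> \<open>shifts F i\<close> lists the degrees \<open>a\<close> of the basis elements of \<open>F\<^sub>i\<close>, i.e. \<open>F\<^sub>i\<close> is the direct sum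
    of the modules \<open>S(-a)\<close>;
  \<^item> \<open>bdry F i\<close> is the matrix of the map from \<open>F\<^bsub>i+1\<^esub>\<close> to \<open>F\<^sub>i\<close>;
  \<^item> \<open>aug F\<close> lists representatives in \<open>S\<close> of the images in \<open>S/I\<close> of the basis elements of \<open>F\<^sub>0\<close>.\<close>

record (overloaded) ('v, 'k) free_complex =
  shifts :: "nat \<Rightarrow> int list"
  bdry :: "nat \<Rightarrow> ('v, 'k) mpoly mat"
  aug :: "('v, 'k) mpoly vec"

definition rk :: "('v, 'k) free_complex \<Rightarrow> nat \<Rightarrow> nat"
  where "rk F i = length (shifts F i)"

definition free_module :: "'v set \<Rightarrow> nat \<Rightarrow> ('v, 'k::field) mpoly vec set"
  where "free_module V n = {v \<in> carrier_vec n. \<forall>a<n. v $ a \<in> carrier (poly_ring V)}"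

text \<open>The entries lie in \<open>S\<close> and have the degrees that make all maps homogeneous of degree \<open>0\<close>.\<close>

definition graded_free_complex :: "'v set \<Rightarrow> ('v, 'k::field) free_complex \<Rightarrow> bool"
  where "graded_free_complex V F \<longleftrightarrow>
    aug F \<in> free_module V (rk F 0) \<and>
    (\<forall>b < rk F 0. homogeneous (shifts F 0 ! b) (aug F $ b)) \<and>
    (\<forall>i. bdry F i \<in> carrier_mat (rk F i) (rk F (Suc i)) \<and>
      (\<forall>a < rk F i. \<forall>b < rk F (Suc i).
        bdry F i $$ (a, b) \<in> carrier (poly_ring V) \<and>
        homogeneous (shifts F (Suc i) ! b - shifts F i ! a) (bdry F i $$ (a, b))))"

text \<open>The three exactness conditions are at \<open>S/I\<close>, at \<open>F\<^sub>0\<close> and at \<open>F\<^bsub>i+1\<^esub>\<close>.\<close>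

definition graded_free_resolution ::
    "'v set \<Rightarrow> ('v, 'k::field) mpoly set \<Rightarrow> ('v, 'k) free_complex \<Rightarrow> bool"
  where "graded_free_resolution V I F \<longleftrightarrow>
    graded_free_complex V F \<and>
    (\<forall>s \<in> carrier (poly_ring V). \<exists>v \<in> free_module V (rk F 0). s - aug F \<bullet> v \<in> I) \<and>
    {v \<in> free_module V (rk F 0). aug F \<bullet> v \<in> I} =
      (\<lambda>w. bdry F 0 *\<^sub>v w) ` free_module V (rk F (Suc 0)) \<and>
    (\<forall>i. {v \<in> free_module V (rk F (Suc i)). bdry F i *\<^sub>v v = 0\<^sub>v (rk F i)} =
      (\<lambda>w. bdry F (Suc i) *\<^sub>v w) ` free_module V (rk F (Suc (Suc i))))"


section \<open>Tor and regularity\<close>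

text \<open>The complex \<open>F \<otimes>\<^sub>S k\<close>, where \<open>k\<close> is the quotient of \<open>S\<close> by the ideal of all variables, so that
  the class of a polynomial in \<open>k\<close> is its constant coefficient. The term in homological degree \<open>i\<close>
  is \<open>k\<^sup>n\<close> with \<open>n = rk F i\<close>; its part of internal degree \<open>j\<close> is spanned by the basis elements of
  degree \<open>j\<close>.\<close>

definition tensor_bdry :: "('v, 'k::field) free_complex \<Rightarrow> nat \<Rightarrow> 'k mat"
  where "tensor_bdry F i = map_mat (\<lambda>p. Poly_Mapping.lookup p 0) (bdry F i)"

definition tensor_strand :: "('v, 'k::field) free_complex \<Rightarrow> nat \<Rightarrow> int \<Rightarrow> 'k vec set"
  where "tensor_strand F i j =
    {v \<in> carrier_vec (rk F i). \<forall>a < rk F i. v $ a \<noteq> 0 \<longrightarrow> shifts F i ! a = j}"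

fun tensor_cycles :: "('v, 'k::field) free_complex \<Rightarrow> nat \<Rightarrow> int \<Rightarrow> 'k vec set" where
  "tensor_cycles F 0 j = tensor_strand F 0 j"
| "tensor_cycles F (Suc i) j =
    {v \<in> tensor_strand F (Suc i) j. tensor_bdry F i *\<^sub>v v = 0\<^sub>v (rk F i)}"

definition tensor_boundaries :: "('v, 'k::field) free_complex \<Rightarrow> nat \<Rightarrow> int \<Rightarrow> 'k vec set"
  where "tensor_boundaries F i j = (\<lambda>w. tensor_bdry F i *\<^sub>v w) ` tensor_strand F (Suc i) j"

definition tensor_homology ::
    "('v, 'k::field) free_complex \<Rightarrow> nat \<Rightarrow> int \<Rightarrow> 'k vec set monoid"
  where "tensor_homology F i j =
    (monoid_vec TYPE('k) (rk F i))\<lparr>carrier := tensor_cycles F i j\<rparr> Mod tensor_boundaries F i j"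

text \<open>The additive group of the part of degree \<open>j\<close> of \<open>Tor\<^sub>i(S/I, k)\<close>, for \<open>S\<close> the polynomial ring
  on a finite set \<open>V\<close> of variables and \<open>I\<close> a homogeneous ideal. A resolution by modules of finite
  rank exists since \<open>S\<close> is Noetherian, and the result does not depend on it up to isomorphism.\<close>

definition tor :: "'v set \<Rightarrow> ('v, 'k::field) mpoly set \<Rightarrow> nat \<Rightarrow> int \<Rightarrow> 'k vec set monoid"
  where "tor V I i j = tensor_homology (SOME F. graded_free_resolution V I F) i j"

text \<open>The regularity of \<open>S/I\<close>, for a proper homogeneous ideal \<open>I\<close> and a finite set \<open>V\<close>.\<close>

definition regularity :: "'v set \<Rightarrow> ('v, 'k::field) mpoly set \<Rightarrow> int"
  where "regularity V I = Max {j. \<exists>i. \<not> trivial_group (tor V I i (int i + j))}"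

end

theory Submission
  imports Defs
begin

text \<open>Take \<open>r\<close> disjoint edges \<open>{i, d + i}\<close> together with \<open>d - r\<close> isolated vertices. The generators of
  the edge ideal form a regular sequence of \<open>r\<close> quadrics, so iterating the mapping cone gives a
  minimal resolution whose \<open>i\<close>-th term is generated in degree \<open>2 i\<close> and is nonzero exactly for
  \<open>i \<le> r\<close>; by comparison of resolutions every resolution computes the same Tor, and the
  regularity is \<open>r\<close>. A prime ideal containing the edge ideal contains a vertex of each edge, so modulo
  the smallest member of a chain of primes everything is a polynomial in \<open>d\<close> variables. A longer
  chain is impossible because more than \<open>d\<close> such polynomials are algebraically dependent, whereas
  elements witnessing the strict inclusions of a chain never are; ideals generated by
  variables give a chain of length \<open>d\<close>.\<close>

section \<open>Polynomials and the standard grading\<close>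

text \<open>\<open>tor\<close> evaluates a resolution picked by \<open>SOME\<close>, so nothing can
  be computed from it directly: each fact is proved for an arbitrary graded free resolution and
  transferred from an explicit one. Since \<open>regularity\<close> asks only which Tor groups
  vanish, it suffices to transfer triviality, that is, the inclusion of cycles in boundaries,
  instead of building isomorphisms of homology. An edge disjoint from all earlier ones is a
  nonzerodivisor modulo their ideal, which is exactly what keeps the cone exact. Each cone raises
  the homological degree by one and the internal degree by two, so the term in homological degree i
  contributes 2 i - i = i to the regularity. The number d arises as the size of the largest
  independent sets: one endpoint of each edge and all isolated vertices. The ideals constructed here
  are monomial and are described by the supports of their monomials, so that membership,
  cancellation and primality become statements about sets of variables. Algebraic dependence is
  obtained by counting monomials in a box.\<close>

lemma mem_poly_ring: "p \<in> carrier (poly_ring V) \<longleftrightarrow> (\<forall>m \<in> Poly_Mapping.keys p. Poly_Mapping.keys m \<subseteq> V)"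
  by (simp add: poly_ring_def)

lemma poly_ring_simps [simp]:
  "monoid.mult (poly_ring V) = (*)" "one (poly_ring V) = 1"
  "zero (poly_ring V) = 0" "add (poly_ring V) = (+)"
  by (simp_all add: poly_ring_def)

lemma keys_add_nat: "Poly_Mapping.keys (m + n) = Poly_Mapping.keys m \<union> Poly_Mapping.keys n"
  for m n :: "'v \<Rightarrow>\<^sub>0 nat"
  by (auto simp: in_keys_iff lookup_add)

lemma keys_multE:
  assumes "k \<in> Poly_Mapping.keys (p * q)"
  obtains m n where "k = m + n" "m \<in> Poly_Mapping.keys p" "n \<in> Poly_Mapping.keys q"
  using keys_mult[of p q] assms by blast

lemma keys_uminus: "Poly_Mapping.keys (- p) = Poly_Mapping.keys p" for p :: "'a \<Rightarrow>\<^sub>0 'b::ab_group_add"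
  by (auto simp: in_keys_iff)

lemma poly_ring_zero: "0 \<in> carrier (poly_ring V)"
  and poly_ring_one: "1 \<in> carrier (poly_ring V)"
  by (auto simp: mem_poly_ring)

lemma poly_ring_add: "p \<in> carrier (poly_ring V) \<Longrightarrow> q \<in> carrier (poly_ring V) \<Longrightarrow> p + q \<in> carrier (poly_ring V)"
  using keys_add[of p q] by (auto simp: mem_poly_ring)

lemma poly_ring_uminus: "p \<in> carrier (poly_ring V) \<Longrightarrow> - p \<in> carrier (poly_ring V)"
  by (simp add: mem_poly_ring keys_uminus)

lemma poly_ring_minus: "p \<in> carrier (poly_ring V) \<Longrightarrow> q \<in> carrier (poly_ring V) \<Longrightarrow> p - q \<in> carrier (poly_ring V)"
  using poly_ring_add[OF _ poly_ring_uminus, of p V q] by simp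

lemma poly_ring_mult:
  "p \<in> carrier (poly_ring V) \<Longrightarrow> q \<in> carrier (poly_ring V) \<Longrightarrow> p * q \<in> carrier (poly_ring V)"
  unfolding mem_poly_ring by (fastforce simp: keys_add_nat elim!: keys_multE)

lemma poly_ring_sum:
  "(\<And>a. a \<in> A \<Longrightarrow> f a \<in> carrier (poly_ring V)) \<Longrightarrow> sum f A \<in> carrier (poly_ring V)"
  by (induction A rule: infinite_finite_induct) (auto intro: poly_ring_zero poly_ring_add)

lemma poly_ring_power: "p \<in> carrier (poly_ring V) \<Longrightarrow> p ^ n \<in> carrier (poly_ring V)"
  by (induction n) (auto intro: poly_ring_one poly_ring_mult)

lemma poly_ring_prod:
  "(\<And>a. a \<in> A \<Longrightarrow> f a \<in> carrier (poly_ring V)) \<Longrightarrow> prod f A \<in> carrier (poly_ring V)"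
  by (induction A rule: infinite_finite_induct) (auto intro: poly_ring_one poly_ring_mult)

lemma poly_ring_single: "Poly_Mapping.keys m \<subseteq> V \<Longrightarrow> Poly_Mapping.single m c \<in> carrier (poly_ring V)"
  by (simp add: mem_poly_ring)

lemma poly_ring_mvar: "x \<in> V \<Longrightarrow> mvar x \<in> carrier (poly_ring V)"
  unfolding mvar_def by (rule poly_ring_single) simp

lemmas poly_ring_closed = poly_ring_zero poly_ring_one poly_ring_add poly_ring_uminus
  poly_ring_minus poly_ring_mult poly_ring_sum poly_ring_power poly_ring_prod

lemma cring_poly_ring: "cring (poly_ring V)"
proof (rule cringI)
  show "abelian_group (poly_ring V)"
    by (rule abelian_groupI)
      (auto intro: poly_ring_closed exI[of _ "- _"] simp: ac_simps intro!: bexI[of _ "- _"])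
  show "Group.comm_monoid (poly_ring V)"
    by (rule comm_monoidI) (auto intro: poly_ring_closed simp: ac_simps)
qed (auto simp: algebra_simps)

section \<open>Projection onto the monomials with a given property\<close>

text \<open>One operation with many uses: homogeneous components, the constant term, splitting
  modulo an edge ideal, restriction to fewer variables, and setting variables to zero.\<close>

definition mon_filter :: "('m \<Rightarrow> bool) \<Rightarrow> ('m \<Rightarrow>\<^sub>0 'k::zero) \<Rightarrow> ('m \<Rightarrow>\<^sub>0 'k)"
  where "mon_filter P p = Poly_Mapping.mapp (\<lambda>m c. c when P m) p"

lemma lookup_mon_filter: "Poly_Mapping.lookup (mon_filter P p) m = (Poly_Mapping.lookup p m when P m)"
  by (auto simp: mon_filter_def lookup_mapp when_def in_keys_iff)

lemma keys_mon_filter: "Poly_Mapping.keys (mon_filter P p) = {m \<in> Poly_Mapping.keys p. P m}"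
  by (auto simp: in_keys_iff lookup_mon_filter when_def split: if_splits)

lemma mon_filter_add: "mon_filter P (p + q) = mon_filter P p + mon_filter P q"
  for p q :: "'m \<Rightarrow>\<^sub>0 'k::monoid_add"
  by (rule poly_mapping_eqI) (simp add: lookup_mon_filter lookup_add when_def)

lemma mon_filter_minus: "mon_filter P (p - q) = mon_filter P p - mon_filter P q"
  for p q :: "'m \<Rightarrow>\<^sub>0 'k::ab_group_add"
  by (rule poly_mapping_eqI) (simp add: lookup_mon_filter lookup_minus when_def)

lemma mon_filter_zero [simp]: "mon_filter P 0 = 0"
  by (rule poly_mapping_eqI) (simp add: lookup_mon_filter)

lemma mon_filter_sum: "mon_filter P (sum f A) = (\<Sum>a\<in>A. mon_filter P (f a))"
  for f :: "_ \<Rightarrow> 'm \<Rightarrow>\<^sub>0 'k::comm_monoid_add"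
  by (induction A rule: infinite_finite_induct) (simp_all add: mon_filter_add)

lemma mon_filter_id: "(\<And>m. m \<in> Poly_Mapping.keys p \<Longrightarrow> P m) \<Longrightarrow> mon_filter P p = p"
  by (rule poly_mapping_eqI) (auto simp: lookup_mon_filter when_def in_keys_iff)

lemma mon_filter_eq_0: "(\<And>m. m \<in> Poly_Mapping.keys p \<Longrightarrow> \<not> P m) \<Longrightarrow> mon_filter P p = 0"
  by (rule poly_mapping_eqI) (auto simp: lookup_mon_filter when_def in_keys_iff)

lemma mon_filter_split: "p = mon_filter P p + mon_filter (\<lambda>m. \<not> P m) p"
  for p :: "'m \<Rightarrow>\<^sub>0 'k::monoid_add"
  by (rule poly_mapping_eqI) (auto simp: lookup_mon_filter lookup_add when_def)

text \<open>Every key of a product is a sum of keys. So \<open>c\<close> carries the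
  \<open>P\<close> part of \<open>p\<close> to monomials satisfying \<open>Q\<close> and the rest to
  monomials violating it; cancellation only removes keys and does no harm.\<close>

lemma mon_filter_mult:
  fixes c p :: "'m::monoid_add \<Rightarrow>\<^sub>0 'k::semiring_0"
  assumes "\<And>m n. m \<in> Poly_Mapping.keys c \<Longrightarrow> n \<in> Poly_Mapping.keys p \<Longrightarrow> Q (m + n) \<longleftrightarrow> P n"
  shows "mon_filter Q (c * p) = c * mon_filter P p"
proof -
  have "c * p = c * mon_filter P p + c * mon_filter (\<lambda>m. \<not> P m) p"
    using mon_filter_split[of p P] by (metis distrib_left)
  moreover have "mon_filter Q (c * mon_filter P p) = c * mon_filter P p"
    by (rule mon_filter_id) (auto elim!: keys_multE simp: keys_mon_filter assms)
  moreover have "mon_filter Q (c * mon_filter (\<lambda>m. \<not> P m) p) = 0"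
    by (rule mon_filter_eq_0) (auto elim!: keys_multE simp: keys_mon_filter assms)
  ultimately show ?thesis by (simp add: mon_filter_add)
qed

text \<open>The monomials violating \<open>P\<close> span an ideal and those satisfying it a
  subring, so the projection is a quotient map. It is used to show that constant coefficients are
  multiplicative and that ideals generated by variables are prime.\<close>

lemma mon_filter_mult_hom:
  fixes p q :: "'m::comm_monoid_add \<Rightarrow>\<^sub>0 'k::comm_semiring_0"
  assumes "\<And>m n. P (m + n) \<longleftrightarrow> P m \<and> P n"
  shows "mon_filter P (p * q) = mon_filter P p * mon_filter P q"
proof -
  have "p * q = mon_filter P p * q + mon_filter (\<lambda>m. \<not> P m) p * q"
    using mon_filter_split[of p P] by (metis distrib_right)
  moreover have "mon_filter P (mon_filter P p * q) = mon_filter P p * mon_filter P q"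
    by (rule mon_filter_mult) (auto simp: keys_mon_filter assms)
  moreover have "mon_filter P (mon_filter (\<lambda>m. \<not> P m) p * q) = 0"
    by (rule mon_filter_eq_0) (auto elim!: keys_multE simp: keys_mon_filter assms)
  ultimately show ?thesis by (simp add: mon_filter_add)
qed

lemma poly_ring_mon_filter: "p \<in> carrier (poly_ring V) \<Longrightarrow> mon_filter P p \<in> carrier (poly_ring V)"
  by (auto simp: mem_poly_ring keys_mon_filter)

lemma poly_eq_sum_single:
  "p = (\<Sum>m\<in>Poly_Mapping.keys p. Poly_Mapping.single m (Poly_Mapping.lookup p m))"
  by (rule poly_mapping_eqI)
    (auto simp: lookup_sum lookup_single when_def in_keys_iff sum.delta)

section \<open>Degrees and homogeneous components\<close>

lemma mon_degree_add: "mon_degree (m + n) = mon_degree m + mon_degree n"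
proof -
  let ?K = "Poly_Mapping.keys m \<union> Poly_Mapping.keys n"
  have "mon_degree k = (\<Sum>x\<in>?K. Poly_Mapping.lookup k x)" if "Poly_Mapping.keys k \<subseteq> ?K" for k
    unfolding mon_degree_def using that by (intro sum.mono_neutral_left) (auto simp: in_keys_iff)
  then show ?thesis by (simp add: keys_add_nat lookup_add sum.distrib)
qed

lemma homogeneous_zero: "homogeneous n 0"
  by (simp add: homogeneous_def)

lemma homogeneous_one: "homogeneous 0 1"
  by (simp add: homogeneous_def mon_degree_def)

lemma homogeneous_add: "homogeneous n p \<Longrightarrow> homogeneous n q \<Longrightarrow> homogeneous n (p + q)"
  using keys_add[of p q] by (auto simp: homogeneous_def)

lemma homogeneous_uminus: "homogeneous n p \<Longrightarrow> homogeneous n (- p)"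
  by (auto simp: homogeneous_def keys_uminus)

lemma homogeneous_minus: "homogeneous n p \<Longrightarrow> homogeneous n q \<Longrightarrow> homogeneous n (p - q)"
  using homogeneous_add[OF _ homogeneous_uminus, of n p q] by simp

lemma homogeneous_mult: "homogeneous a p \<Longrightarrow> homogeneous b q \<Longrightarrow> n = a + b \<Longrightarrow> homogeneous n (p * q)"
  by (auto simp: homogeneous_def mon_degree_add elim!: keys_multE)

lemma homogeneous_sum: "(\<And>a. a \<in> A \<Longrightarrow> homogeneous n (f a)) \<Longrightarrow> homogeneous n (sum f A)"
  by (induction A rule: infinite_finite_induct) (auto intro: homogeneous_zero homogeneous_add)

lemma homogeneous_mvar_mult: "homogeneous 2 (mvar x * mvar y)"
  by (rule homogeneous_mult[of 1 _ 1]) (auto simp: mvar_def homogeneous_def mon_degree_def)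

abbreviation hom_part :: "int \<Rightarrow> ('v, 'k::field) mpoly \<Rightarrow> ('v, 'k) mpoly"
  where "hom_part n \<equiv> mon_filter (\<lambda>m. int (mon_degree m) = n)"

lemma homogeneous_hom_part: "homogeneous n (hom_part n p)"
  by (simp add: homogeneous_def keys_mon_filter)

lemma hom_part_id: "homogeneous n p \<Longrightarrow> hom_part n p = p"
  by (rule mon_filter_id) (simp add: homogeneous_def)

lemma hom_part_mult: "homogeneous a c \<Longrightarrow> hom_part (a + n) (c * p) = c * hom_part n p"
  by (rule mon_filter_mult) (auto simp: homogeneous_def mon_degree_add)

section \<open>The constant coefficient as a ring homomorphism to the field\<close>

abbreviation const_coeff :: "('v, 'k::field) mpoly \<Rightarrow> 'k"
  where "const_coeff p \<equiv> Poly_Mapping.lookup p 0"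

lemma single_0_const_coeff: "mon_filter (\<lambda>m. m = 0) p = Poly_Mapping.single 0 (const_coeff p)"
  by (rule poly_mapping_eqI) (auto simp: lookup_mon_filter lookup_single when_def)

lemma const_coeff_mult: "const_coeff (p * q) = const_coeff p * const_coeff q"
proof -
  have "mon_filter (\<lambda>m. m = 0) (p * q) = mon_filter (\<lambda>m. m = 0) p * mon_filter (\<lambda>m. m = 0) q"
    by (rule mon_filter_mult_hom) (metis Un_empty keys_add_nat keys_eq_empty)
  then have "const_coeff (mon_filter (\<lambda>m. m = 0) (p * q))
      = const_coeff (mon_filter (\<lambda>m. m = 0) p * mon_filter (\<lambda>m. m = 0) q)"
    by simp
  then show ?thesis by (simp add: single_0_const_coeff mult_single)
qed

interpretation const_coeff: comm_ring_hom const_coeff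
  by unfold_locales (simp_all add: lookup_add const_coeff_mult)

section \<open>Comparison of graded free resolutions\<close>

text \<open>A degree-preserving map between graded free modules, with the columns indexing the
  source. It refers only to lists of shifts, so that boundary maps, chain maps and homotopies are
  all treated alike.\<close>

definition graded_mat :: "'v set \<Rightarrow> int list \<Rightarrow> int list \<Rightarrow> ('v, 'k::field) mpoly mat \<Rightarrow> bool"
  where "graded_mat V as bs A \<longleftrightarrow> A \<in> carrier_mat (length as) (length bs) \<and>
    (\<forall>a < length as. \<forall>b < length bs.
      A $$ (a, b) \<in> carrier (poly_ring V) \<and> homogeneous (bs ! b - as ! a) (A $$ (a, b)))"

lemma graded_matD:
  assumes "graded_mat V as bs A"
  shows "A \<in> carrier_mat (length as) (length bs)" "dim_row A = length as" "dim_col A = length bs"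
    "\<And>a b. a < length as \<Longrightarrow> b < length bs \<Longrightarrow> A $$ (a, b) \<in> carrier (poly_ring V)"
    "\<And>a b. a < length as \<Longrightarrow> b < length bs \<Longrightarrow> homogeneous (bs ! b - as ! a) (A $$ (a, b))"
proof -
  show A: "A \<in> carrier_mat (length as) (length bs)"
    and "\<And>a b. a < length as \<Longrightarrow> b < length bs \<Longrightarrow> A $$ (a, b) \<in> carrier (poly_ring V)"
    and "\<And>a b. a < length as \<Longrightarrow> b < length bs \<Longrightarrow> homogeneous (bs ! b - as ! a) (A $$ (a, b))"
    using assms unfolding graded_mat_def by blast+
  show "dim_row A = length as" "dim_col A = length bs"
    using A by (rule carrier_matD)+
qed

lemma graded_mat_one: "graded_mat V as as (1\<^sub>m (length as))"
  by (auto simp: graded_mat_def poly_ring_one poly_ring_zero homogeneous_one homogeneous_zero)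

lemma graded_mat_minus:
  "graded_mat V as bs A \<Longrightarrow> graded_mat V as bs B \<Longrightarrow> graded_mat V as bs (A - B)"
  by (auto simp: graded_mat_def poly_ring_minus homogeneous_minus)

lemma graded_mat_uminus: "graded_mat V as bs A \<Longrightarrow> graded_mat V as bs (- A)"
  by (auto simp: graded_mat_def poly_ring_uminus homogeneous_uminus)

lemma graded_mat_mult:
  assumes A: "graded_mat V as bs A" and B: "graded_mat V bs cs B"
  shows "graded_mat V as cs (A * B)"
  unfolding graded_mat_def
proof (intro conjI allI impI)
  note dims = graded_matD(1-3)[OF A] graded_matD(1-3)[OF B]
  show "A * B \<in> carrier_mat (length as) (length cs)" using dims by auto
  fix a c assume ac: "a < length as" "c < length cs"
  have eq: "(A * B) $$ (a, c) = (\<Sum>b = 0..<length bs. A $$ (a, b) * B $$ (b, c))"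
    using ac dims by (simp add: scalar_prod_def)
  show "(A * B) $$ (a, c) \<in> carrier (poly_ring V)"
    unfolding eq using ac graded_matD(4)[OF A] graded_matD(4)[OF B]
    by (auto intro!: poly_ring_sum poly_ring_mult)
  show "homogeneous (cs ! c - as ! a) ((A * B) $$ (a, c))"
    unfolding eq
  proof (rule homogeneous_sum)
    fix b assume "b \<in> {0..<length bs}"
    then have "homogeneous (bs ! b - as ! a) (A $$ (a, b))" "homogeneous (cs ! c - bs ! b) (B $$ (b, c))"
      using ac graded_matD(5)[OF A] graded_matD(5)[OF B] by auto
    then show "homogeneous (cs ! c - as ! a) (A $$ (a, b) * B $$ (b, c))"
      by (rule homogeneous_mult) simp
  qed
qed

section \<open>Free modules and homogeneous lifting\<close>

lemma free_moduleD:
  assumes "v \<in> free_module V n"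
  shows "v \<in> carrier_vec n" "dim_vec v = n" "\<And>a. a < n \<Longrightarrow> v $ a \<in> carrier (poly_ring V)"
  using assms by (auto simp: free_module_def)

lemma free_module_add: "v \<in> free_module V n \<Longrightarrow> w \<in> free_module V n \<Longrightarrow> v + w \<in> free_module V n"
  by (auto simp: free_module_def poly_ring_zero poly_ring_add poly_ring_minus poly_ring_uminus poly_ring_mult)

lemma free_module_minus: "v \<in> free_module V n \<Longrightarrow> w \<in> free_module V n \<Longrightarrow> v - w \<in> free_module V n"
  by (auto simp: free_module_def poly_ring_zero poly_ring_add poly_ring_minus poly_ring_uminus poly_ring_mult)

lemma free_module_uminus: "v \<in> free_module V n \<Longrightarrow> - v \<in> free_module V n"
  by (auto simp: free_module_def poly_ring_zero poly_ring_add poly_ring_minus poly_ring_uminus poly_ring_mult)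

lemma free_module_smult:
  "c \<in> carrier (poly_ring V) \<Longrightarrow> v \<in> free_module V n \<Longrightarrow> c \<cdot>\<^sub>v v \<in> free_module V n"
  by (auto simp: free_module_def poly_ring_zero poly_ring_add poly_ring_minus poly_ring_uminus poly_ring_mult)

lemma free_module_unit_vec: "unit_vec n i \<in> free_module V n"
  by (auto simp: free_module_def unit_vec_def poly_ring_zero poly_ring_one)

lemma mat_mult_unit_vec:
  fixes A :: "'a::semiring_1 mat"
  shows "A \<in> carrier_mat n m \<Longrightarrow> b < m \<Longrightarrow> A *\<^sub>v unit_vec m b = col A b"
  by (intro eq_vecI) auto

lemma free_module_append:
  "v \<in> free_module V n \<Longrightarrow> w \<in> free_module V m \<Longrightarrow> v @\<^sub>v w \<in> free_module V (n + m)"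
  by (auto simp: free_module_def)

lemma free_module_appendE:
  assumes "u \<in> free_module V (n + m)"
  obtains v w where "u = v @\<^sub>v w" "v \<in> free_module V n" "w \<in> free_module V m"
proof
  show "u = vec_first u n @\<^sub>v vec_last u m"
    using assms by (simp add: free_module_def)
  show "vec_first u n \<in> free_module V n" "vec_last u m \<in> free_module V m"
    using assms by (auto simp: free_module_def vec_first_def vec_last_def)
qed

lemma free_module_mat_vec:
  assumes "A \<in> carrier_mat n m" "v \<in> free_module V m"
    and "\<And>a b. a < n \<Longrightarrow> b < m \<Longrightarrow> A $$ (a, b) \<in> carrier (poly_ring V)"
  shows "A *\<^sub>v v \<in> free_module V n"
  using assms by (auto simp: free_module_def scalar_prod_def intro!: poly_ring_sum poly_ring_mult)

lemma free_module_graded_mat: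
  "graded_mat V as bs A \<Longrightarrow> v \<in> free_module V (length bs) \<Longrightarrow> A *\<^sub>v v \<in> free_module V (length as)"
  by (rule free_module_mat_vec) (auto dest: graded_matD)

lemma free_module_col: "graded_mat V as bs A \<Longrightarrow> b < length bs \<Longrightarrow> col A b \<in> free_module V (length as)"
  by (auto simp: free_module_def graded_matD)

lemma scalar_prod_poly_ring:
  "v \<in> free_module V n \<Longrightarrow> w \<in> free_module V n \<Longrightarrow> v \<bullet> w \<in> carrier (poly_ring V)"
  by (auto simp: free_module_def scalar_prod_def intro!: poly_ring_sum poly_ring_mult)

text \<open>Taking homogeneous components in the appropriate degrees turns an arbitrary preimage under a
  graded matrix into a homogeneous one.\<close>

lemma graded_lift_vec:
  assumes A: "graded_mat V as bs A" and w: "w \<in> free_module V (length bs)"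
    and hom: "\<And>a. a < length as \<Longrightarrow> homogeneous (c - as ! a) ((A *\<^sub>v w) $ a)"
  obtains u where "u \<in> free_module V (length bs)" "A *\<^sub>v u = A *\<^sub>v w"
    "\<And>b. b < length bs \<Longrightarrow> homogeneous (c - bs ! b) (u $ b)"
proof
  let ?u = "vec (length bs) (\<lambda>b. hom_part (c - bs ! b) (w $ b))"
  note dims = graded_matD(1-3)[OF A]
  show "?u \<in> free_module V (length bs)"
    using w by (auto simp: free_module_def poly_ring_mon_filter)
  show "\<And>b. b < length bs \<Longrightarrow> homogeneous (c - bs ! b) (?u $ b)"
    by (simp add: homogeneous_hom_part)
  show "A *\<^sub>v ?u = A *\<^sub>v w"
  proof (rule eq_vecI)
    fix a assume "a < dim_vec (A *\<^sub>v w)"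
    then have a: "a < length as" using dims by simp
    have "(A *\<^sub>v ?u) $ a = (\<Sum>b = 0..<length bs. A $$ (a, b) * hom_part (c - bs ! b) (w $ b))"
      using a dims by (simp add: scalar_prod_def)
    also have "\<dots> = (\<Sum>b = 0..<length bs. hom_part (c - as ! a) (A $$ (a, b) * w $ b))"
    proof (rule sum.cong[OF refl])
      fix b assume "b \<in> {0..<length bs}"
      then show "A $$ (a, b) * hom_part (c - bs ! b) (w $ b) = hom_part (c - as ! a) (A $$ (a, b) * w $ b)"
        using hom_part_mult[OF graded_matD(5)[OF A a], of b "c - bs ! b" "w $ b"] by simp
    qed
    also have "\<dots> = hom_part (c - as ! a) ((A *\<^sub>v w) $ a)"
      using a dims free_moduleD(2)[OF w] by (simp add: scalar_prod_def mon_filter_sum)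
    also have "\<dots> = (A *\<^sub>v w) $ a"
      by (rule hom_part_id) (rule hom[OF a])
    finally show "(A *\<^sub>v ?u) $ a = (A *\<^sub>v w) $ a" .
  qed (use dims in auto)
qed

text \<open>Projectivity of graded free modules, one column at a time. Both the chain maps and the
  homotopies below are built from it.\<close>

lemma graded_lift_mat:
  assumes A: "graded_mat V as bs A" and M: "graded_mat V as cs M"
    and im: "\<And>c. c < length cs \<Longrightarrow> col M c \<in> (\<lambda>w. A *\<^sub>v w) ` free_module V (length bs)"
  obtains N where "graded_mat V bs cs N" "A * N = M"
proof -
  note dims = graded_matD(1-3)[OF A] graded_matD(1-3)[OF M]
  have "\<exists>u. u \<in> free_module V (length bs) \<and> A *\<^sub>v u = col M c \<and>
      (\<forall>b < length bs. homogeneous (cs ! c - bs ! b) (u $ b))" if c: "c < length cs" for c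
  proof -
    from im[OF c] obtain w where w: "w \<in> free_module V (length bs)" "A *\<^sub>v w = col M c" by auto
    have "homogeneous (cs ! c - as ! a) ((A *\<^sub>v w) $ a)" if "a < length as" for a
      using that c dims graded_matD(5)[OF M] unfolding w(2) by simp
    from graded_lift_vec[OF A w(1) this] w(2) show ?thesis by metis
  qed
  then obtain u where u: "\<And>c. c < length cs \<Longrightarrow> u c \<in> free_module V (length bs)"
    "\<And>c. c < length cs \<Longrightarrow> A *\<^sub>v u c = col M c"
    "\<And>b c. c < length cs \<Longrightarrow> b < length bs \<Longrightarrow> homogeneous (cs ! c - bs ! b) (u c $ b)"
    by metis
  define N where "N = mat (length bs) (length cs) (\<lambda>(b, c). u c $ b)"
  have "graded_mat V bs cs N"
    using u by (auto simp: graded_mat_def N_def free_module_def)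
  moreover have "A * N = M"
  proof (rule mat_col_eqI)
    fix c assume "c < dim_col M"
    then have c: "c < length cs" using dims by simp
    have "col N c = u c"
      using c free_moduleD(2)[OF u(1)[OF c]] by (auto simp: N_def intro!: eq_vecI)
    then show "col (A * N) c = col M c"
      using c dims u(2)[OF c] by (simp add: N_def col_mult2[of A "length as" "length bs" _ "length cs"])
  qed (use dims in \<open>auto simp: N_def\<close>)
  ultimately show ?thesis by (rule that)
qed

fun complex_cycles :: "'v set \<Rightarrow> ('v, 'k::field) mpoly set \<Rightarrow> ('v, 'k) free_complex \<Rightarrow> nat \<Rightarrow> ('v, 'k) mpoly vec set"
  where
  "complex_cycles V I F 0 = {v \<in> free_module V (rk F 0). aug F \<bullet> v \<in> I}"
| "complex_cycles V I F (Suc i) = {v \<in> free_module V (rk F (Suc i)). bdry F i *\<^sub>v v = 0\<^sub>v (rk F i)}"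

lemma graded_free_complex_alt:
  "graded_free_complex V F \<longleftrightarrow> aug F \<in> free_module V (rk F 0) \<and>
    (\<forall>b < rk F 0. homogeneous (shifts F 0 ! b) (aug F $ b)) \<and>
    (\<forall>i. graded_mat V (shifts F i) (shifts F (Suc i)) (bdry F i))"
  by (simp add: graded_free_complex_def graded_mat_def rk_def)

lemma graded_free_resolution_alt:
  "graded_free_resolution V I F \<longleftrightarrow> graded_free_complex V F \<and>
    (\<forall>s \<in> carrier (poly_ring V). \<exists>v \<in> free_module V (rk F 0). s - aug F \<bullet> v \<in> I) \<and>
    (\<forall>i. complex_cycles V I F i = (\<lambda>w. bdry F i *\<^sub>v w) ` free_module V (rk F (Suc i)))"
proof -
  have all: "(\<forall>i. P i) \<longleftrightarrow> P 0 \<and> (\<forall>i. P (Suc i))" for P :: "nat \<Rightarrow> bool"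
    by (metis not0_implies_Suc)
  show ?thesis
    unfolding graded_free_resolution_def
    by (subst all[of "\<lambda>i. complex_cycles V I F i = (\<lambda>w. bdry F i *\<^sub>v w) ` free_module V (rk F (Suc i))"]) simp
qed

lemma graded_free_resolutionD:
  assumes "graded_free_resolution V I F"
  shows "aug F \<in> free_module V (rk F 0)"
    "\<And>b. b < rk F 0 \<Longrightarrow> homogeneous (shifts F 0 ! b) (aug F $ b)"
    "\<And>i. graded_mat V (shifts F i) (shifts F (Suc i)) (bdry F i)"
    "\<And>s. s \<in> carrier (poly_ring V) \<Longrightarrow> \<exists>v \<in> free_module V (rk F 0). s - aug F \<bullet> v \<in> I"
    "\<And>i. complex_cycles V I F i = (\<lambda>w. bdry F i *\<^sub>v w) ` free_module V (rk F (Suc i))"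
  using assms unfolding graded_free_resolution_alt graded_free_complex_alt by blast+

lemma bdry_carrier:
  "graded_free_resolution V I F \<Longrightarrow> bdry F i \<in> carrier_mat (rk F i) (rk F (Suc i))"
  unfolding rk_def by (rule graded_matD(1)) (rule graded_free_resolutionD(3))

lemma complex_cycles_subset: "complex_cycles V I F i \<subseteq> free_module V (rk F i)"
  by (cases i) auto

lemma bdry_in_cycles:
  "graded_free_resolution V I F \<Longrightarrow> w \<in> free_module V (rk F (Suc i)) \<Longrightarrow> bdry F i *\<^sub>v w \<in> complex_cycles V I F i"
  by (simp add: graded_free_resolutionD(5))

lemma mat_eq_0_if_cols:
  assumes "A \<in> carrier_mat n m" "\<And>b. b < m \<Longrightarrow> col A b = 0\<^sub>v n"
  shows "A = 0\<^sub>m n m"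
  using assms by (intro mat_col_eqI) auto

lemma bdry_bdry:
  assumes F: "graded_free_resolution V I F"
  shows "bdry F i * bdry F (Suc i) = 0\<^sub>m (rk F i) (rk F (Suc (Suc i)))"
proof (rule mat_eq_0_if_cols)
  show "bdry F i * bdry F (Suc i) \<in> carrier_mat (rk F i) (rk F (Suc (Suc i)))"
    using bdry_carrier[OF F] by (metis mult_carrier_mat)
  fix b assume b: "b < rk F (Suc (Suc i))"
  from bdry_in_cycles[OF F free_module_unit_vec, of "Suc i" b]
  have "bdry F i *\<^sub>v (bdry F (Suc i) *\<^sub>v unit_vec (rk F (Suc (Suc i))) b) = 0\<^sub>v (rk F i)" by simp
  then show "col (bdry F i * bdry F (Suc i)) b = 0\<^sub>v (rk F i)"
    using b bdry_carrier[OF F, of i] bdry_carrier[OF F, of "Suc i"]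
    by (simp add: col_mult2[of _ "rk F i" "rk F (Suc i)" _ "rk F (Suc (Suc i))"] mat_mult_unit_vec)
qed

section \<open>Homogeneous ideals and the comparison of resolutions\<close>

text \<open>The last clause is homogeneity: it allows a congruence modulo \<open>I\<close> to be
  replaced by its component in one degree.\<close>

definition hom_ideal :: "'v set \<Rightarrow> ('v, 'k::field) mpoly set \<Rightarrow> bool"
  where "hom_ideal V I \<longleftrightarrow> I \<subseteq> carrier (poly_ring V) \<and> 0 \<in> I \<and> (\<forall>p\<in>I. \<forall>q\<in>I. p + q \<in> I) \<and>
    (\<forall>p\<in>I. \<forall>q\<in>carrier (poly_ring V). q * p \<in> I) \<and> (\<forall>p\<in>I. \<forall>n. hom_part n p \<in> I)"

lemma hom_idealD:
  assumes "hom_ideal V I"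
  shows "I \<subseteq> carrier (poly_ring V)" "0 \<in> I" "\<And>p q. p \<in> I \<Longrightarrow> q \<in> I \<Longrightarrow> p + q \<in> I"
    "\<And>p q. p \<in> I \<Longrightarrow> q \<in> carrier (poly_ring V) \<Longrightarrow> q * p \<in> I"
    "\<And>p n. p \<in> I \<Longrightarrow> hom_part n p \<in> I"
  using assms unfolding hom_ideal_def by blast+

lemma hom_ideal_minus:
  assumes I: "hom_ideal V I" and "p \<in> I" "q \<in> I"
  shows "p - q \<in> I"
proof -
  have "- 1 * q \<in> I" by (intro hom_idealD(4)[OF I] assms poly_ring_uminus poly_ring_one)
  from hom_idealD(3)[OF I \<open>p \<in> I\<close> this] show ?thesis by simp
qed

lemma hom_ideal_sum:
  assumes I: "hom_ideal V I"
  shows "(\<And>a. a \<in> A \<Longrightarrow> f a \<in> I) \<Longrightarrow> sum f A \<in> I"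
  by (induction A rule: infinite_finite_induct) (auto intro: hom_idealD[OF I])

text \<open>\<open>A\<close> induces the identity on S/I. The two augmentations are given by
  representatives in S, hence the congruence modulo \<open>I\<close> in place of an
  equation.\<close>

definition augmented :: "'v set \<Rightarrow> ('v, 'k::field) mpoly set \<Rightarrow> ('v, 'k) free_complex \<Rightarrow> ('v, 'k) free_complex \<Rightarrow> ('v, 'k) mpoly mat \<Rightarrow> bool"
  where "augmented V I F G A \<longleftrightarrow> graded_mat V (shifts G 0) (shifts F 0) A \<and>
    (\<forall>v\<in>free_module V (rk F 0). aug G \<bullet> (A *\<^sub>v v) - aug F \<bullet> v \<in> I)"

definition chain_map :: "'v set \<Rightarrow> ('v, 'k::field) mpoly set \<Rightarrow> ('v, 'k) free_complex \<Rightarrow> ('v, 'k) free_complex \<Rightarrow> (nat \<Rightarrow> ('v, 'k) mpoly mat) \<Rightarrow> bool"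
  where "chain_map V I F G f \<longleftrightarrow> augmented V I F G (f 0) \<and>
    (\<forall>i. graded_mat V (shifts G i) (shifts F i) (f i) \<and> bdry G i * f (Suc i) = f i * bdry F i)"

text \<open>Surjectivity of the augmentation of \<open>G\<close> lifts each generator
  \<open>aug F $ b\<close> up to an element of \<open>I\<close>. As this is a congruence,
  \<open>graded_lift_mat\<close> does not apply; homogeneous components are taken by hand, and the
  error stays in \<open>I\<close> because \<open>I\<close> is homogeneous.\<close>

lemma augmented_exists:
  assumes I: "hom_ideal V I" and F: "graded_free_resolution V I F" and G: "graded_free_resolution V I G"
  shows "\<exists>A. augmented V I F G A"
proof -
  note augG = graded_free_resolutionD(1,2)[OF G]
  note augF = graded_free_resolutionD(1,2)[OF F]
  have "\<exists>u. u \<in> free_module V (rk G 0) \<and> aug F $ b - aug G \<bullet> u \<in> I \<and>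
      (\<forall>a < rk G 0. homogeneous (shifts F 0 ! b - shifts G 0 ! a) (u $ a))" if b: "b < rk F 0" for b
  proof -
    have "aug F $ b \<in> carrier (poly_ring V)"
      using augF(1) b by (rule free_moduleD(3))
    from graded_free_resolutionD(4)[OF G this] obtain v
      where v: "v \<in> free_module V (rk G 0)" "aug F $ b - aug G \<bullet> v \<in> I" by blast
    define u where "u = vec (rk G 0) (\<lambda>a. hom_part (shifts F 0 ! b - shifts G 0 ! a) (v $ a))"
    have u: "u \<in> free_module V (rk G 0)"
      using v(1) by (auto simp: u_def free_module_def poly_ring_mon_filter)
    have "aug G \<bullet> u = (\<Sum>a = 0..<rk G 0. aug G $ a * hom_part (shifts F 0 ! b - shifts G 0 ! a) (v $ a))"
      by (simp add: scalar_prod_def u_def)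
    also have "\<dots> = (\<Sum>a = 0..<rk G 0. hom_part (shifts F 0 ! b) (aug G $ a * v $ a))"
    proof (rule sum.cong[OF refl])
      fix a assume "a \<in> {0..<rk G 0}"
      then show "aug G $ a * hom_part (shifts F 0 ! b - shifts G 0 ! a) (v $ a) =
          hom_part (shifts F 0 ! b) (aug G $ a * v $ a)"
        using hom_part_mult[OF augG(2), of a "shifts F 0 ! b - shifts G 0 ! a" "v $ a"] by simp
    qed
    also have "\<dots> = hom_part (shifts F 0 ! b) (aug G \<bullet> v)"
      using free_moduleD(2)[OF v(1)] by (simp add: scalar_prod_def mon_filter_sum)
    finally have "aug F $ b - aug G \<bullet> u = hom_part (shifts F 0 ! b) (aug F $ b - aug G \<bullet> v)"
      by (simp add: mon_filter_minus hom_part_id[OF augF(2)[OF b]])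
    with hom_idealD(5)[OF I v(2)] have "aug F $ b - aug G \<bullet> u \<in> I" by simp
    moreover have "\<forall>a < rk G 0. homogeneous (shifts F 0 ! b - shifts G 0 ! a) (u $ a)"
      by (simp add: u_def homogeneous_hom_part)
    ultimately show ?thesis using u by blast
  qed
  then obtain u where u: "\<And>b. b < rk F 0 \<Longrightarrow> u b \<in> free_module V (rk G 0)"
    "\<And>b. b < rk F 0 \<Longrightarrow> aug F $ b - aug G \<bullet> u b \<in> I"
    "\<And>a b. b < rk F 0 \<Longrightarrow> a < rk G 0 \<Longrightarrow> homogeneous (shifts F 0 ! b - shifts G 0 ! a) (u b $ a)"
    by metis
  define A where "A = mat (rk G 0) (rk F 0) (\<lambda>(a, b). u b $ a)"
  have gA: "graded_mat V (shifts G 0) (shifts F 0) A"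
    using u(3) free_moduleD(3)[OF u(1)] by (auto simp: graded_mat_def A_def rk_def)
  have A: "A \<in> carrier_mat (rk G 0) (rk F 0)" by (simp add: A_def)
  have colA: "col A b = u b" if "b < rk F 0" for b
    using that free_moduleD(2)[OF u(1)[OF that]] by (auto simp: A_def intro!: eq_vecI)
  have "aug G \<bullet> (A *\<^sub>v v) - aug F \<bullet> v \<in> I" if v: "v \<in> free_module V (rk F 0)" for v
  proof -
    note dims = free_moduleD(1)[OF v] free_moduleD(1)[OF augF(1)] free_moduleD(1)[OF augG(1)]
    \<comment> \<open>Moving \<open>A\<close> across the scalar product expands everything over the
      columns of \<open>A\<close>, so the total error becomes a combination, with coefficients from
      \<open>v\<close>, of the errors at the single generators.\<close>
    have "aug G \<bullet> (A *\<^sub>v v) = (A\<^sup>T *\<^sub>v aug G) \<bullet> v"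
      using A dims by (intro transpose_vec_mult_scalar[symmetric]) auto
    also have "\<dots> = v \<bullet> (A\<^sup>T *\<^sub>v aug G)"
      using A dims by (intro comm_scalar_prod[of _ "rk F 0"]) auto
    also have "\<dots> = (\<Sum>b = 0..<rk F 0. v $ b * (u b \<bullet> aug G))"
      using A colA by (simp add: scalar_prod_def[of v])
    also have "\<dots> = (\<Sum>b = 0..<rk F 0. v $ b * (aug G \<bullet> u b))"
      using dims free_moduleD(1)[OF u(1)]
      by (intro sum.cong refl arg_cong2[of _ _ _ _ "(*)"] comm_scalar_prod[of _ "rk G 0"]) auto
    finally have "aug G \<bullet> (A *\<^sub>v v) - aug F \<bullet> v = (\<Sum>b = 0..<rk F 0. - v $ b * (aug F $ b - aug G \<bullet> u b))"
      using dims by (simp add: scalar_prod_def[of "aug F"] sum_subtractf[symmetric] algebra_simps)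
    also have "\<dots> \<in> I"
      using u(2) free_moduleD(3)[OF v]
      by (intro hom_ideal_sum[OF I] hom_idealD(4)[OF I] poly_ring_uminus) auto
    finally show ?thesis .
  qed
  with gA show ?thesis unfolding augmented_def by blast
qed

lemma augmented_cycles:
  assumes I: "hom_ideal V I" and F: "graded_free_resolution V I F"
    and "augmented V I F G A" "v \<in> complex_cycles V I F 0"
  shows "A *\<^sub>v v \<in> complex_cycles V I G 0"
proof -
  from assms have v: "v \<in> free_module V (rk F 0)" "aug F \<bullet> v \<in> I" by auto
  with assms have "aug G \<bullet> (A *\<^sub>v v) - aug F \<bullet> v \<in> I" by (auto simp: augmented_def)
  from hom_idealD(3)[OF I this v(2)] have "aug G \<bullet> (A *\<^sub>v v) \<in> I" by simp
  moreover have "A *\<^sub>v v \<in> free_module V (rk G 0)"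
    using assms v free_module_graded_mat unfolding augmented_def rk_def by blast
  ultimately show ?thesis by simp
qed

text \<open>The invariant \<open>?P\<close> includes that cycles go to cycles: then the images of
  boundaries of \<open>F\<close> are cycles of \<open>G\<close>, hence boundaries by exactness, and
  can be lifted. In degree 0 the invariant comes from the augmentation, later from the commuting
  square.\<close>

lemma chain_map_exists:
  assumes I: "hom_ideal V I" and F: "graded_free_resolution V I F" and G: "graded_free_resolution V I G"
  obtains f where "chain_map V I F G f"
proof -
  let ?P = "\<lambda>i A. graded_mat V (shifts G i) (shifts F i) A \<and> (i = 0 \<longrightarrow> augmented V I F G A) \<and>
    (\<forall>v \<in> complex_cycles V I F i. A *\<^sub>v v \<in> complex_cycles V I G i)"
  let ?Q = "\<lambda>i A B. bdry G i * B = A * bdry F i"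
  have "\<exists>f. \<forall>i. ?P i (f i) \<and> ?Q i (f i) (f (Suc i))"
  proof (rule dependent_nat_choice)
    show "\<exists>A. ?P 0 A"
      using augmented_exists[OF I F G] augmented_cycles[OF I F] by (auto simp: augmented_def)
  next
    fix A i assume A: "?P i A"
    note gF = graded_free_resolutionD(3)[OF F] and gG = graded_free_resolutionD(3)[OF G]
    have gM: "graded_mat V (shifts G i) (shifts F (Suc i)) (A * bdry F i)"
      using A gF by (blast intro: graded_mat_mult)
    have cA: "A \<in> carrier_mat (rk G i) (rk F i)"
      using A unfolding rk_def by (blast dest: graded_matD(1))
    note cF = bdry_carrier[OF F] and cG = bdry_carrier[OF G]
    have "col (A * bdry F i) c \<in> (\<lambda>w. bdry G i *\<^sub>v w) ` free_module V (length (shifts G (Suc i)))"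
      if c: "c < length (shifts F (Suc i))" for c
    proof -
      have "col (A * bdry F i) c = A *\<^sub>v (bdry F i *\<^sub>v unit_vec (rk F (Suc i)) c)"
        using c cA cF[of i] by (simp add: col_mult2[of _ "rk G i" "rk F i" _ "rk F (Suc i)"] mat_mult_unit_vec rk_def)
      also have "\<dots> \<in> complex_cycles V I G i" using A bdry_in_cycles[OF F free_module_unit_vec] by blast
      finally show ?thesis using graded_free_resolutionD(5)[OF G, of i] unfolding rk_def by simp
    qed
    from graded_lift_mat[OF gG gM this] obtain B
      where B: "graded_mat V (shifts G (Suc i)) (shifts F (Suc i)) B" "bdry G i * B = A * bdry F i" by blast
    have cB: "B \<in> carrier_mat (rk G (Suc i)) (rk F (Suc i))"
      using B(1) unfolding rk_def by (rule graded_matD(1))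
    have "B *\<^sub>v v \<in> complex_cycles V I G (Suc i)" if v: "v \<in> complex_cycles V I F (Suc i)" for v
    proof -
      from v have v': "v \<in> free_module V (rk F (Suc i))" "bdry F i *\<^sub>v v = 0\<^sub>v (rk F i)" by auto
      note cv = free_moduleD(1)[OF v'(1)]
      have "bdry G i *\<^sub>v (B *\<^sub>v v) = (bdry G i * B) *\<^sub>v v"
        using assoc_mult_mat_vec[OF cG cB cv] by simp
      also have "\<dots> = A *\<^sub>v (bdry F i *\<^sub>v v)"
        unfolding B(2) by (rule assoc_mult_mat_vec[OF cA cF cv])
      also have "\<dots> = 0\<^sub>v (rk G i)" using cA v'(2) by auto
      finally show ?thesis using free_module_graded_mat[OF B(1)] v'(1) by (simp add: rk_def)
    qed
    with B show "\<exists>B. ?P (Suc i) B \<and> ?Q i A B" by blast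
  qed
  then obtain f where "\<forall>i. ?P i (f i) \<and> ?Q i (f i) (f (Suc i))" by blast
  then have "chain_map V I F G f" unfolding chain_map_def by blast
  then show ?thesis by (rule that)
qed

lemma chain_mapD:
  assumes "chain_map V I F G f"
  shows "augmented V I F G (f 0)" "\<And>i. graded_mat V (shifts G i) (shifts F i) (f i)"
    "\<And>i. bdry G i * f (Suc i) = f i * bdry F i"
    "\<And>i. f i \<in> carrier_mat (rk G i) (rk F i)"
  using assms graded_matD(1) unfolding chain_map_def rk_def by blast+

lemma chain_map_comp:
  assumes I: "hom_ideal V I" and F: "graded_free_resolution V I F" and G: "graded_free_resolution V I G"
    and H: "graded_free_resolution V I H"
    and f: "chain_map V I F G f" and g: "chain_map V I G H g"
  shows "chain_map V I F H (\<lambda>i. g i * f i)"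
proof -
  note cf = chain_mapD(4)[OF f] and cg = chain_mapD(4)[OF g]
  note cF = bdry_carrier[OF F] and cG = bdry_carrier[OF G] and cH = bdry_carrier[OF H]
  have gr: "graded_mat V (shifts H i) (shifts F i) (g i * f i)" for i
    using chain_mapD(2)[OF f] chain_mapD(2)[OF g] by (blast intro: graded_mat_mult)
  have "bdry H i * (g (Suc i) * f (Suc i)) = g i * f i * bdry F i" for i
  proof -
    have "bdry H i * (g (Suc i) * f (Suc i)) = bdry H i * g (Suc i) * f (Suc i)"
      by (rule assoc_mult_mat[OF cH cg cf, symmetric])
    also have "\<dots> = g i * (bdry G i * f (Suc i))"
      unfolding chain_mapD(3)[OF g] by (rule assoc_mult_mat[OF cg cG cf])
    also have "\<dots> = g i * f i * bdry F i"
      unfolding chain_mapD(3)[OF f] by (rule assoc_mult_mat[OF cg cf cF, symmetric])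
    finally show ?thesis .
  qed
  moreover have "aug H \<bullet> (g 0 * f 0 *\<^sub>v v) - aug F \<bullet> v \<in> I" if v: "v \<in> free_module V (rk F 0)" for v
  proof -
    have fv: "f 0 *\<^sub>v v \<in> free_module V (rk G 0)"
      using free_module_graded_mat[OF chain_mapD(2)[OF f]] v unfolding rk_def by blast
    have "aug H \<bullet> (g 0 *\<^sub>v (f 0 *\<^sub>v v)) - aug G \<bullet> (f 0 *\<^sub>v v) \<in> I"
      using chain_mapD(1)[OF g] fv unfolding augmented_def by blast
    moreover have "aug G \<bullet> (f 0 *\<^sub>v v) - aug F \<bullet> v \<in> I"
      using chain_mapD(1)[OF f] v unfolding augmented_def by blast
    ultimately have "aug H \<bullet> (g 0 *\<^sub>v (f 0 *\<^sub>v v)) - aug F \<bullet> v \<in> I"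
      using hom_idealD(3)[OF I] by fastforce
    then show ?thesis using assoc_mult_mat_vec[OF cg cf free_moduleD(1)[OF v]] by simp
  qed
  ultimately show ?thesis using gr unfolding chain_map_def augmented_def by blast
qed

section \<open>Homotopies\<close>

text \<open>Both products equal each other by commutation with \<open>D\<close>: the matrix to be
  lifted next consists of cycles exactly because the defect left by \<open>S\<close> is killed by
  \<open>D\<close>.\<close>

lemma homotopy_step:
  fixes H :: "'a::ring_1 mat"
  assumes D: "D \<in> carrier_mat n m" and H: "H \<in> carrier_mat n n" and H': "H' \<in> carrier_mat m m"
    and S: "S \<in> carrier_mat m n" and comm: "D * H' = H * D" and S0: "(H - 1\<^sub>m n - D * S) * D = 0\<^sub>m n m"
  shows "D * (H' - 1\<^sub>m m - S * D) = 0\<^sub>m n m"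
proof -
  have "D * (H' - 1\<^sub>m m - S * D) = D * H' - D - D * (S * D)"
    using D H' S by (simp add: mult_minus_distrib_mat[of _ n m _ m] minus_carrier_mat)
  also have "\<dots> = H * D - D - D * S * D"
    using D S comm by (simp add: assoc_mult_mat[of _ n m _ n])
  also have "\<dots> = (H - 1\<^sub>m n - D * S) * D"
    using D H S by (simp add: minus_mult_distrib_mat[of _ n n _ _ m] minus_carrier_mat)
  finally show ?thesis using S0 by simp
qed

text \<open>A chain endomorphism over the identity of S/I is homotopic to the identity. The
  invariant says that the defect of \<open>S\<close> composed with the boundary vanishes; in this
  form it mentions a single index of the homotopy, so the next map can be chosen from the current
  one alone.\<close>

lemma homotopy_exists:
  assumes I: "hom_ideal V I" and F: "graded_free_resolution V I F" and h: "chain_map V I F F h"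
  obtains s where "\<And>i. graded_mat V (shifts F (Suc i)) (shifts F i) (s i)"
    "bdry F 0 * s 0 = h 0 - 1\<^sub>m (rk F 0)"
    "\<And>i. bdry F (Suc i) * s (Suc i) = h (Suc i) - 1\<^sub>m (rk F (Suc i)) - s i * bdry F i"
proof -
  let ?one = "\<lambda>i. 1\<^sub>m (rk F i)"
  let ?P = "\<lambda>i S. graded_mat V (shifts F (Suc i)) (shifts F i) S \<and>
    (h i - ?one i - bdry F i * S) * bdry F i = 0\<^sub>m (rk F i) (rk F (Suc i)) \<and>
    (i = 0 \<longrightarrow> bdry F 0 * S = h 0 - ?one 0)"
  let ?Q = "\<lambda>i S S'. bdry F (Suc i) * S' = h (Suc i) - ?one (Suc i) - S * bdry F i"
  note ch = chain_mapD(4)[OF h] and cF = bdry_carrier[OF F]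
  note gh = chain_mapD(2)[OF h] and gF = graded_free_resolutionD(3)[OF F]
  have g1: "graded_mat V (shifts F i) (shifts F i) (?one i)" for i
    unfolding rk_def by (rule graded_mat_one)
  have "\<exists>s. \<forall>i. ?P i (s i) \<and> ?Q i (s i) (s (Suc i))"
  proof (rule dependent_nat_choice)
    let ?M = "h 0 - ?one 0"
    have gM: "graded_mat V (shifts F 0) (shifts F 0) ?M" by (intro graded_mat_minus gh g1)
    have "col ?M c \<in> (\<lambda>w. bdry F 0 *\<^sub>v w) ` free_module V (length (shifts F (Suc 0)))"
      if c: "c < length (shifts F 0)" for c
    proof -
      let ?e = "unit_vec (rk F 0) c :: ('a, 'b) mpoly vec"
      have e: "?e \<in> free_module V (rk F 0)" by (rule free_module_unit_vec)
      have "col ?M c = ?M *\<^sub>v ?e"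
        using c ch[of 0] by (intro mat_mult_unit_vec[symmetric, of _ "rk F 0"]) (auto simp: rk_def)
      also have "\<dots> = h 0 *\<^sub>v ?e - ?e"
        using ch[of 0] by (simp add: minus_mult_distrib_mat_vec[of _ "rk F 0" "rk F 0"])
      finally have col: "col ?M c = h 0 *\<^sub>v ?e - ?e" .
      have he: "h 0 *\<^sub>v ?e \<in> free_module V (rk F 0)"
        using free_module_graded_mat[OF gh[of 0]] e unfolding rk_def by blast
      have "aug F \<bullet> (h 0 *\<^sub>v ?e - ?e) = aug F \<bullet> (h 0 *\<^sub>v ?e) - aug F \<bullet> ?e"
        using free_moduleD(1)[OF graded_free_resolutionD(1)[OF F]] free_moduleD(1)[OF he]
        by (intro scalar_prod_minus_distrib[of _ "rk F 0"]) auto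
      also have "\<dots> \<in> I" using chain_mapD(1)[OF h] e unfolding augmented_def by blast
      finally have "col ?M c \<in> complex_cycles V I F 0"
        unfolding col using he e by (simp add: free_module_minus)
      then show ?thesis unfolding graded_free_resolutionD(5)[OF F] rk_def .
    qed
    from graded_lift_mat[OF gF gM this] obtain S
      where S: "graded_mat V (shifts F (Suc 0)) (shifts F 0) S" "bdry F 0 * S = ?M" by blast
    have "?M - ?M = 0\<^sub>m (rk F 0) (rk F 0)" using ch[of 0] by (intro minus_r_inv_mat) auto
    with S cF[of 0] have "?P 0 S" by simp
    then show "\<exists>S. ?P 0 S" by blast
  next
    fix S i assume S: "?P i S"
    let ?M = "h (Suc i) - ?one (Suc i) - S * bdry F i"
    have gM: "graded_mat V (shifts F (Suc i)) (shifts F (Suc i)) ?M"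
      using S by (intro graded_mat_minus graded_mat_mult[OF _ gF] gh g1) auto
    have cS: "S \<in> carrier_mat (rk F (Suc i)) (rk F i)"
      using S graded_matD(1) unfolding rk_def by blast
    have cM: "?M \<in> carrier_mat (rk F (Suc i)) (rk F (Suc i))"
      using gM graded_matD(1) unfolding rk_def by blast
    have zero: "bdry F i * ?M = 0\<^sub>m (rk F i) (rk F (Suc i))"
      using S by (intro homotopy_step[OF cF ch ch cS chain_mapD(3)[OF h]]) blast
    have "col ?M c \<in> (\<lambda>w. bdry F (Suc i) *\<^sub>v w) ` free_module V (length (shifts F (Suc (Suc i))))"
      if c: "c < length (shifts F (Suc i))" for c
    proof -
      have "bdry F i *\<^sub>v col ?M c = col (bdry F i * ?M) c"
        using c by (intro col_mult2[OF cF cM, symmetric]) (simp add: rk_def)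
      also have "\<dots> = 0\<^sub>v (rk F i)" unfolding zero using c by (simp add: rk_def)
      finally have "col ?M c \<in> complex_cycles V I F (Suc i)"
        using free_module_col[OF gM c] by (simp add: rk_def)
      then show ?thesis unfolding graded_free_resolutionD(5)[OF F] rk_def .
    qed
    from graded_lift_mat[OF gF gM this] obtain T
      where T: "graded_mat V (shifts F (Suc (Suc i))) (shifts F (Suc i)) T" "bdry F (Suc i) * T = ?M" by blast
    have cT: "T \<in> carrier_mat (rk F (Suc (Suc i))) (rk F (Suc i))"
      using T graded_matD(1) unfolding rk_def by blast
    let ?N = "h (Suc i) - ?one (Suc i)"
    \<comment> \<open>By the choice of \<open>T\<close> the new defect factors through
      \<open>bdry F i\<close>, so composing with the next boundary gives zero.\<close>
    have "?N - bdry F (Suc i) * T = S * bdry F i"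
      unfolding T(2) using ch[of "Suc i"] cS cF[of i] by (intro eq_matI) auto
    then have "(?N - bdry F (Suc i) * T) * bdry F (Suc i) = S * (bdry F i * bdry F (Suc i))"
      using assoc_mult_mat[OF cS cF cF] by simp
    also have "\<dots> = 0\<^sub>m (rk F (Suc i)) (rk F (Suc (Suc i)))"
      unfolding bdry_bdry[OF F] using cS by (rule right_mult_zero_mat)
    finally show "\<exists>S'. ?P (Suc i) S' \<and> ?Q i S S'" using T by blast
  qed
  then obtain s where "\<forall>i. ?P i (s i) \<and> ?Q i (s i) (s (Suc i))" by blast
  then show ?thesis by (intro that[of s]) auto
qed

section \<open>Reduction modulo the variables\<close>

abbreviation const_mat :: "('v, 'k::field) mpoly mat \<Rightarrow> 'k mat"
  where "const_mat \<equiv> map_mat const_coeff"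

lemma tensor_bdry_alt: "tensor_bdry F i = const_mat (bdry F i)"
  by (simp add: tensor_bdry_def)

lemma const_mat_mult:
  "A \<in> carrier_mat n m \<Longrightarrow> B \<in> carrier_mat m l \<Longrightarrow> const_mat (A * B) = const_mat A * const_mat B"
  by (rule const_coeff.mat_hom_mult)

lemma const_mat_minus:
  "A \<in> carrier_mat n m \<Longrightarrow> B \<in> carrier_mat n m \<Longrightarrow> const_mat (A - B) = const_mat A - const_mat B"
  by (intro eq_matI) (auto simp: lookup_minus)

lemma const_mat_one: "const_mat (1\<^sub>m n) = 1\<^sub>m n"
  by (intro eq_matI) (auto simp: lookup_one)

lemma const_coeff_homogeneous: "homogeneous n p \<Longrightarrow> const_coeff p \<noteq> 0 \<Longrightarrow> n = 0"
  by (force simp: homogeneous_def in_keys_iff mon_degree_def)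

lemma tensor_strandD:
  assumes "v \<in> tensor_strand F i j"
  shows "v \<in> carrier_vec (rk F i)" "\<And>a. a < rk F i \<Longrightarrow> v $ a \<noteq> 0 \<Longrightarrow> shifts F i ! a = j"
  using assms by (auto simp: tensor_strand_def)

text \<open>The entry at \<open>(a, b)\<close> is homogeneous of degree equal to the difference of
  the two shifts, so its constant term can survive only between generators of equal degree.\<close>

lemma const_mat_strand:
  assumes A: "graded_mat V (shifts G l) (shifts F i) A" and v: "v \<in> tensor_strand F i j"
  shows "const_mat A *\<^sub>v v \<in> tensor_strand G l j"
  unfolding tensor_strand_def
proof (intro CollectI conjI allI impI)
  note dims = graded_matD(1-3)[OF A] tensor_strandD(1)[OF v]
  show "const_mat A *\<^sub>v v \<in> carrier_vec (rk G l)"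
    using dims by (auto simp: rk_def)
  fix a assume a: "a < rk G l" and ne: "(const_mat A *\<^sub>v v) $ a \<noteq> 0"
  have "(const_mat A *\<^sub>v v) $ a = (\<Sum>b = 0..<rk F i. const_coeff (A $$ (a, b)) * v $ b)"
    using a dims by (simp add: scalar_prod_def rk_def)
  with ne obtain b where b: "b < rk F i" "const_coeff (A $$ (a, b)) * v $ b \<noteq> 0"
    by (metis (no_types, lifting) sum.neutral atLeastLessThan_iff)
  then have "shifts F i ! b - shifts G l ! a = 0"
    using a by (intro const_coeff_homogeneous[OF graded_matD(5)[OF A]]) (auto simp: rk_def)
  with tensor_strandD(2)[OF v b(1)] b(2) show "shifts G l ! a = j" by auto
qed

lemma tensor_cycles_subset: "tensor_cycles F i j \<subseteq> tensor_strand F i j"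
  by (cases i) auto

lemma tensor_cyclesI:
  assumes "v \<in> tensor_strand F i j" "\<And>l. i = Suc l \<Longrightarrow> tensor_bdry F l *\<^sub>v v = 0\<^sub>v (rk F l)"
  shows "v \<in> tensor_cycles F i j"
  using assms by (cases i) auto

text \<open>After reduction, \<open>h i - 1\<close> is the sum of boundary after homotopy and
  homotopy after boundary; the second summand vanishes on a cycle, and in degree 0 it is
  absent.\<close>

lemma tensor_homotopy:
  assumes I: "hom_ideal V I" and F: "graded_free_resolution V I F" and h: "chain_map V I F F h"
    and v: "v \<in> tensor_cycles F i j"
  obtains w where "w \<in> tensor_strand F (Suc i) j" "const_mat (h i) *\<^sub>v v - v = tensor_bdry F i *\<^sub>v w"
proof -
  from homotopy_exists[OF I F h] obtain s where
    s: "\<And>i. graded_mat V (shifts F (Suc i)) (shifts F i) (s i)"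
      "bdry F 0 * s 0 = h 0 - 1\<^sub>m (rk F 0)"
      "\<And>i. bdry F (Suc i) * s (Suc i) = h (Suc i) - 1\<^sub>m (rk F (Suc i)) - s i * bdry F i" by blast
  have cs: "s i \<in> carrier_mat (rk F (Suc i)) (rk F i)" for i
    using s(1) graded_matD(1) unfolding rk_def by blast
  note cF = bdry_carrier[OF F] and ch = chain_mapD(4)[OF h]
  have strand: "v \<in> tensor_strand F i j" using v tensor_cycles_subset by blast
  note cv = tensor_strandD(1)[OF strand]
  show ?thesis
  proof
    show "const_mat (s i) *\<^sub>v v \<in> tensor_strand F (Suc i) j"
      by (rule const_mat_strand[OF s(1) strand])
    have "tensor_bdry F i *\<^sub>v (const_mat (s i) *\<^sub>v v) = const_mat (bdry F i * s i) *\<^sub>v v"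
      using cF[of i] cs[of i] cv
      by (simp add: tensor_bdry_alt const_mat_mult assoc_mult_mat_vec[of _ "rk F i" "rk F (Suc i)" _ "rk F i"])
    also have "\<dots> = const_mat (h i) *\<^sub>v v - v"
    proof (cases i)
      case 0
      then show ?thesis using s(2) ch[of 0] cv
        by (simp add: const_mat_minus[of _ "rk F 0" "rk F 0"] const_mat_one
            minus_mult_distrib_mat_vec[of _ "rk F 0" "rk F 0"])
    next
      case (Suc l)
      have "const_mat (s l * bdry F l) *\<^sub>v v = const_mat (s l) *\<^sub>v (tensor_bdry F l *\<^sub>v v)"
        using cF[of l] cs[of l] cv Suc
        by (simp add: tensor_bdry_alt const_mat_mult assoc_mult_mat_vec[of _ "rk F (Suc l)" "rk F l" _ "rk F (Suc l)"])
      also have "\<dots> = 0\<^sub>v (rk F (Suc l))" using v Suc cs[of l] by auto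
      finally have z: "const_mat (s l * bdry F l) *\<^sub>v v = 0\<^sub>v (rk F (Suc l))" .
      have sb: "s l * bdry F l \<in> carrier_mat (rk F (Suc l)) (rk F (Suc l))"
        using cs cF by (rule mult_carrier_mat)
      show ?thesis using s(3)[of l] ch[of "Suc l"] cv Suc sb z
        by (simp add: const_mat_minus[of _ "rk F (Suc l)" "rk F (Suc l)"] const_mat_one minus_carrier_mat
            minus_mult_distrib_mat_vec[of _ "rk F (Suc l)" "rk F (Suc l)"])
    qed
    finally show "const_mat (h i) *\<^sub>v v - v = tensor_bdry F i *\<^sub>v (const_mat (s i) *\<^sub>v v)" by simp
  qed
qed

lemma const_mat_chain_map:
  assumes F: "graded_free_resolution V I F" and G: "graded_free_resolution V I G"
    and f: "chain_map V I F G f" and v: "v \<in> carrier_vec (rk F (Suc i))"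
  shows "tensor_bdry G i *\<^sub>v (const_mat (f (Suc i)) *\<^sub>v v) = const_mat (f i) *\<^sub>v (tensor_bdry F i *\<^sub>v v)"
proof -
  note cf = chain_mapD(4)[OF f] and cF = bdry_carrier[OF F] and cG = bdry_carrier[OF G]
  have "tensor_bdry G i *\<^sub>v (const_mat (f (Suc i)) *\<^sub>v v) = const_mat (bdry G i * f (Suc i)) *\<^sub>v v"
    using cG[of i] cf[of "Suc i"] v
    by (simp add: tensor_bdry_alt const_mat_mult assoc_mult_mat_vec[of _ "rk G i" "rk G (Suc i)" _ "rk F (Suc i)"])
  also have "\<dots> = const_mat (f i) *\<^sub>v (tensor_bdry F i *\<^sub>v v)"
    unfolding chain_mapD(3)[OF f] using cF[of i] cf[of i] v
    by (simp add: tensor_bdry_alt const_mat_mult assoc_mult_mat_vec[of _ "rk G i" "rk F i" _ "rk F (Suc i)"])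
  finally show ?thesis .
qed

lemma tensor_boundaries_subset:
  assumes F: "graded_free_resolution V I F"
  shows "tensor_boundaries F i j \<subseteq> tensor_cycles F i j"
proof
  fix v assume "v \<in> tensor_boundaries F i j"
  then obtain w where w: "w \<in> tensor_strand F (Suc i) j" "v = tensor_bdry F i *\<^sub>v w"
    by (auto simp: tensor_boundaries_def)
  note cF = bdry_carrier[OF F]
  show "v \<in> tensor_cycles F i j"
  proof (rule tensor_cyclesI)
    show "v \<in> tensor_strand F i j"
      unfolding w tensor_bdry_alt by (rule const_mat_strand[OF graded_free_resolutionD(3)[OF F] w(1)])
    fix l assume l: "i = Suc l"
    have "tensor_bdry F l *\<^sub>v v = const_mat (bdry F l * bdry F (Suc l)) *\<^sub>v w"
      using w cF[of l] cF[of "Suc l"] l tensor_strandD(1)[OF w(1)]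
      by (simp add: tensor_bdry_alt const_mat_mult assoc_mult_mat_vec[of _ "rk F l" "rk F (Suc l)" _ "rk F (Suc (Suc l))"])
    also have "\<dots> = 0\<^sub>v (rk F l)"
      unfolding bdry_bdry[OF F] using tensor_strandD(1)[OF w(1)] l
      by (intro eq_vecI) (auto simp: scalar_prod_def)
    finally show "tensor_bdry F l *\<^sub>v v = 0\<^sub>v (rk F l)" .
  qed
qed

section \<open>Vanishing of Tor read off from a minimal resolution\<close>

lemma tensor_strand_zero: "0\<^sub>v (rk F i) \<in> tensor_strand F i j"
  by (auto simp: tensor_strand_def)

lemma tensor_strand_uminus: "v \<in> tensor_strand F i j \<Longrightarrow> - v \<in> tensor_strand F i j"
  by (auto simp: tensor_strand_def)

lemma tensor_strand_add:
  assumes "v \<in> tensor_strand F i j" "w \<in> tensor_strand F i j"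
  shows "v + w \<in> tensor_strand F i j"
  unfolding tensor_strand_def
proof (intro CollectI conjI allI impI)
  show "v + w \<in> carrier_vec (rk F i)" using assms by (auto simp: tensor_strand_def)
  fix a assume "a < rk F i" "(v + w) $ a \<noteq> 0"
  then show "shifts F i ! a = j"
    using assms by (cases "v $ a = 0") (auto simp: tensor_strand_def)
qed

lemma group_vec: "group (monoid_vec TYPE('k::ab_group_add) n)"
  by (rule comm_group.axioms(2)) (rule comm_group_vec)

lemma inv_vec:
  assumes "v \<in> carrier_vec n"
  shows "inv\<^bsub>monoid_vec TYPE('k::ab_group_add) n\<^esub> v = - (v :: 'k vec)"
  by (rule group.inv_equality[OF group_vec]) (use assms in \<open>auto simp: monoid_vec_simps\<close>)

lemma tensor_cycles_subgroup:
  assumes F: "graded_free_resolution V I F"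
  shows "subgroup (tensor_cycles F i j) (monoid_vec TYPE('k::field) (rk F i))"
proof (rule group.subgroupI[OF group_vec])
  note st = tensor_strandD(1)[OF subsetD[OF tensor_cycles_subset]]
  have cT: "tensor_bdry F i \<in> carrier_mat (rk F i) (rk F (Suc i))" for i
    using bdry_carrier[OF F] by (simp add: tensor_bdry_alt)
  show "tensor_cycles F i j \<subseteq> carrier (monoid_vec TYPE('k) (rk F i))"
    using st by (auto simp: monoid_vec_simps)
  have "0\<^sub>v (rk F i) \<in> tensor_cycles F i j"
    using cT by (intro tensor_cyclesI tensor_strand_zero) (auto intro!: eq_vecI simp: carrier_matD[OF cT])
  then show "tensor_cycles F i j \<noteq> {}" by blast
  show "inv\<^bsub>monoid_vec TYPE('k) (rk F i)\<^esub> v \<in> tensor_cycles F i j" if v: "v \<in> tensor_cycles F i j" for v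
  proof -
    have "- v \<in> tensor_cycles F i j"
    proof (rule tensor_cyclesI)
      show "- v \<in> tensor_strand F i j" using v tensor_cycles_subset tensor_strand_uminus by blast
      fix l assume l: "i = Suc l"
      have "tensor_bdry F l *\<^sub>v (- v) = - (tensor_bdry F l *\<^sub>v v)"
        using st[OF v] cT[of l] l by (intro eq_vecI) auto
      then show "tensor_bdry F l *\<^sub>v (- v) = 0\<^sub>v (rk F l)" using v l by auto
    qed
    then show ?thesis using inv_vec[OF st[OF v]] by simp
  qed
  show "v \<otimes>\<^bsub>monoid_vec TYPE('k) (rk F i)\<^esub> w \<in> tensor_cycles F i j"
    if v: "v \<in> tensor_cycles F i j" and w: "w \<in> tensor_cycles F i j" for v w
    unfolding monoid_vec_simps
  proof (rule tensor_cyclesI)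
    show "v + w \<in> tensor_strand F i j" using v w tensor_cycles_subset tensor_strand_add by blast
    fix l assume l: "i = Suc l"
    then show "tensor_bdry F l *\<^sub>v (v + w) = 0\<^sub>v (rk F l)"
      using v w l mult_add_distrib_mat_vec[OF cT[of l]] st[OF v] st[OF w] by auto
  qed
qed

lemma tensor_boundaries_subgroup:
  assumes F: "graded_free_resolution V I F"
  shows "subgroup (tensor_boundaries F i j) (monoid_vec TYPE('k::field) (rk F i))"
proof (rule group.subgroupI[OF group_vec])
  have cT: "tensor_bdry F i \<in> carrier_mat (rk F i) (rk F (Suc i))"
    using bdry_carrier[OF F] by (simp add: tensor_bdry_alt)
  have st: "v \<in> carrier_vec (rk F i)" if "v \<in> tensor_boundaries F i j" for v
    using that tensor_boundaries_subset[OF F] tensor_cycles_subset tensor_strandD(1) by blast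
  then show "tensor_boundaries F i j \<subseteq> carrier (monoid_vec TYPE('k) (rk F i))"
    by (auto simp: monoid_vec_simps)
  show "tensor_boundaries F i j \<noteq> {}"
    unfolding tensor_boundaries_def using tensor_strand_zero by blast
  show "inv\<^bsub>monoid_vec TYPE('k) (rk F i)\<^esub> v \<in> tensor_boundaries F i j"
    if v: "v \<in> tensor_boundaries F i j" for v
  proof -
    from v obtain w where w: "w \<in> tensor_strand F (Suc i) j" "v = tensor_bdry F i *\<^sub>v w"
      by (auto simp: tensor_boundaries_def)
    have "- v = tensor_bdry F i *\<^sub>v (- w)"
      using cT w tensor_strandD(1)[OF w(1)] by (intro eq_vecI) auto
    then show ?thesis
      unfolding inv_vec[OF st[OF v]] tensor_boundaries_def using tensor_strand_uminus[OF w(1)] by blast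
  qed
  show "v \<otimes>\<^bsub>monoid_vec TYPE('k) (rk F i)\<^esub> w \<in> tensor_boundaries F i j"
    if "v \<in> tensor_boundaries F i j" and "w \<in> tensor_boundaries F i j" for v w
  proof -
    from that obtain x y where x: "x \<in> tensor_strand F (Suc i) j" "v = tensor_bdry F i *\<^sub>v x"
      and y: "y \<in> tensor_strand F (Suc i) j" "w = tensor_bdry F i *\<^sub>v y"
      by (auto simp: tensor_boundaries_def)
    have "v + w = tensor_bdry F i *\<^sub>v (x + y)"
      using cT x y tensor_strandD(1)[OF x(1)] tensor_strandD(1)[OF y(1)]
      by (simp add: mult_add_distrib_mat_vec)
    then show ?thesis
      unfolding monoid_vec_simps tensor_boundaries_def using tensor_strand_add[OF x(1) y(1)] by blast
  qed
qed

text \<open>The identity of the factor group is the subgroup of boundaries itself, so triviality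
  means that the coset of every cycle equals this subgroup. From here on, Tor is handled by
  inclusions between sets of vectors.\<close>

lemma trivial_tensor_homology_iff:
  fixes F :: "('v, 'k::field) free_complex"
  assumes F: "graded_free_resolution V I F"
  shows "trivial_group (tensor_homology F i j) \<longleftrightarrow> tensor_cycles F i j \<subseteq> tensor_boundaries F i j"
proof -
  let ?M = "monoid_vec TYPE('k) (rk F i)"
  let ?Z = "?M\<lparr>carrier := tensor_cycles F i j\<rparr>"
  let ?B = "tensor_boundaries F i j"
  have Z: "group ?Z" by (rule group.subgroup_imp_group[OF group_vec tensor_cycles_subgroup[OF F]])
  have B: "subgroup ?B ?Z"
    by (rule group.subgroup_incl[OF group_vec tensor_boundaries_subgroup[OF F]
          tensor_cycles_subgroup[OF F] tensor_boundaries_subset[OF F]])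
  have "comm_group ?Z"
    using tensor_strandD(1)[OF subsetD[OF tensor_cycles_subset]]
    by (intro group.group_comm_groupI[OF Z]) (auto simp: monoid_vec_simps intro!: comm_add_vec[of _ "rk F i"])
  then have norm: "?B \<lhd> ?Z" by (rule comm_group.normal_iff_subgroup[THEN iffD2]) (rule B)
  have grp: "group (tensor_homology F i j)"
    unfolding tensor_homology_def by (rule normal.factorgroup_is_group[OF norm])
  have "trivial_group (tensor_homology F i j) \<longleftrightarrow> (\<forall>v \<in> carrier ?Z. ?B #>\<^bsub>?Z\<^esub> v = ?B)"
    using grp group.is_monoid[OF grp, THEN monoid.one_closed]
    by (auto simp: trivial_group_def tensor_homology_def FactGroup_def RCOSETS_def)
  also have "\<dots> \<longleftrightarrow> (\<forall>v \<in> carrier ?Z. v \<in> ?B)"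
    using group.coset_join1[OF Z _ _ B] group.coset_join2[OF Z _ B] subgroup.subset[OF B] by blast
  finally show ?thesis by auto
qed

lemma zero_mat_mult_vec: "v \<in> carrier_vec m \<Longrightarrow> 0\<^sub>m n m *\<^sub>v v = 0\<^sub>v n"
  for v :: "'a::semiring_0 vec"
  by (intro eq_vecI) auto

text \<open>In \<open>K\<close> every strand vector is a cycle and only zero is a boundary, so the
  right-hand side says that the homology of \<open>K\<close> vanishes. Vanishing passes in both
  directions along chain maps \<open>f\<close> and \<open>g\<close> whose composites are homotopic
  to the identity.\<close>

lemma minimal_resolution_tor:
  assumes I: "hom_ideal V I" and F: "graded_free_resolution V I F" and K: "graded_free_resolution V I K"
    and min: "\<And>i. tensor_bdry K i = 0\<^sub>m (rk K i) (rk K (Suc i))"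
  shows "trivial_group (tensor_homology F i j) \<longleftrightarrow> tensor_strand K i j \<subseteq> {0\<^sub>v (rk K i)}"
  unfolding trivial_tensor_homology_iff[OF F]
proof
  obtain f where f: "chain_map V I F K f" by (rule chain_map_exists[OF I F K])
  obtain g where g: "chain_map V I K F g" by (rule chain_map_exists[OF I K F])
  note cf = chain_mapD(4)[OF f] and cg = chain_mapD(4)[OF g]
  {
    assume sub: "tensor_cycles F i j \<subseteq> tensor_boundaries F i j"
    show "tensor_strand K i j \<subseteq> {0\<^sub>v (rk K i)}"
    proof
      fix v assume v: "v \<in> tensor_strand K i j"
      note cv = tensor_strandD(1)[OF v]
      let ?u = "const_mat (g i) *\<^sub>v v"
      have "?u \<in> tensor_cycles F i j"
      proof (rule tensor_cyclesI)
        show "?u \<in> tensor_strand F i j" by (rule const_mat_strand[OF chain_mapD(2)[OF g] v])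
        fix l assume l: "i = Suc l"
        have "tensor_bdry F l *\<^sub>v ?u = const_mat (g l) *\<^sub>v (tensor_bdry K l *\<^sub>v v)"
          using const_mat_chain_map[OF K F g] cv l by blast
        also have "\<dots> = 0\<^sub>v (rk F l)" using cv l cg[of l] by (auto simp: min zero_mat_mult_vec)
        finally show "tensor_bdry F l *\<^sub>v ?u = 0\<^sub>v (rk F l)" .
      qed
      with sub obtain w where w: "w \<in> tensor_strand F (Suc i) j" "?u = tensor_bdry F i *\<^sub>v w"
        by (auto simp: tensor_boundaries_def)
      \<comment> \<open>\<open>f\<close> carries the boundary \<open>?u\<close> to a boundary of
        \<open>K\<close>, and those are zero.\<close>
      have zero: "const_mat (f i) *\<^sub>v ?u = 0\<^sub>v (rk K i)"
      proof -
        have "const_mat (f i) *\<^sub>v ?u = tensor_bdry K i *\<^sub>v (const_mat (f (Suc i)) *\<^sub>v w)"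
          unfolding w(2) using const_mat_chain_map[OF F K f] tensor_strandD(1)[OF w(1)] by simp
        also have "\<dots> = 0\<^sub>v (rk K i)"
          unfolding min
          by (rule zero_mat_mult_vec[OF tensor_strandD(1)[OF const_mat_strand[OF chain_mapD(2)[OF f] w(1)]]])
        finally show ?thesis .
      qed
      have "v \<in> tensor_cycles K i j"
        using v cv by (intro tensor_cyclesI) (auto simp: min)
      from tensor_homotopy[OF I K chain_map_comp[OF I K F K g f] this] obtain x
        where x: "x \<in> tensor_strand K (Suc i) j" "const_mat (f i * g i) *\<^sub>v v - v = tensor_bdry K i *\<^sub>v x" .
      have "const_mat (f i * g i) *\<^sub>v v = const_mat (f i) *\<^sub>v ?u"
        using cf[of i] cg[of i] cv
        by (simp add: const_mat_mult assoc_mult_mat_vec[of _ "rk K i" "rk F i" _ "rk K i"])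
      \<comment> \<open>In \<open>K\<close> the homotopy formula has zero right-hand side, so the
        round trip is literally the identity on \<open>v\<close>; as it passes through zero,
        \<open>v\<close> vanishes.\<close>
      with zero x(2) have "0\<^sub>v (rk K i) - v = 0\<^sub>v (rk K i)"
        using zero_mat_mult_vec[OF tensor_strandD(1)[OF x(1)], of "rk K i"] by (simp add: min)
      with cv show "v \<in> {0\<^sub>v (rk K i)}" by (simp add: uminus_zero_vec_eq)
    qed
  }
  {
    assume sub: "tensor_strand K i j \<subseteq> {0\<^sub>v (rk K i)}"
    show "tensor_cycles F i j \<subseteq> tensor_boundaries F i j"
    proof
      fix v assume v: "v \<in> tensor_cycles F i j"
      then have v': "v \<in> tensor_strand F i j" using tensor_cycles_subset by blast
      note cv = tensor_strandD(1)[OF v']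
      \<comment> \<open>Here the round trip through \<open>K\<close> is zero because it passes
        through a zero strand, and the homotopy on \<open>F\<close> then exhibits \<open>- v\<close>
        as a boundary.\<close>
      have fv: "const_mat (f i) *\<^sub>v v = 0\<^sub>v (rk K i)"
        using const_mat_strand[OF chain_mapD(2)[OF f] v'] sub by blast
      from tensor_homotopy[OF I F chain_map_comp[OF I F K F f g] v] obtain w
        where w: "w \<in> tensor_strand F (Suc i) j" "const_mat (g i * f i) *\<^sub>v v - v = tensor_bdry F i *\<^sub>v w" .
      have "const_mat (g i * f i) *\<^sub>v v = const_mat (g i) *\<^sub>v (const_mat (f i) *\<^sub>v v)"
        using cf[of i] cg[of i] cv
        by (simp add: const_mat_mult assoc_mult_mat_vec[of _ "rk F i" "rk K i" _ "rk F i"])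
      also have "\<dots> = 0\<^sub>v (rk F i)" unfolding fv using cg[of i] by (intro eq_vecI) auto
      finally have "tensor_bdry F i *\<^sub>v w = - v" using w(2) cv by simp
      then have "v = - (tensor_bdry F i *\<^sub>v w)" by simp
      also have "\<dots> = tensor_bdry F i *\<^sub>v (- w)"
        using bdry_carrier[OF F, of i] tensor_strandD(1)[OF w(1)]
        by (intro eq_vecI) (auto simp: tensor_bdry_alt)
      finally show "v \<in> tensor_boundaries F i j"
        unfolding tensor_boundaries_def using tensor_strand_uminus[OF w(1)] by blast
    qed
  }
qed

section \<open>Mapping cones\<close>

text \<open>The mapping cone of multiplication by a quadric \<open>f\<close> on \<open>F\<close> has the term
  \<open>F\<^sub>i \<oplus> F\<^bsub>i-1\<^esub>(-2)\<close> in degree \<open>i\<close>; the second summand, which is zero for \<open>i = 0\<close>, is described by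
  \<open>cone_shifts\<close> and \<open>cone_bdry\<close>.\<close>

primrec cone_shifts :: "('v, 'k) free_complex \<Rightarrow> nat \<Rightarrow> int list"
  where "cone_shifts F 0 = []"
  | "cone_shifts F (Suc i) = map ((+) 2) (shifts F i)"

primrec cone_bdry :: "('v, 'k::field) free_complex \<Rightarrow> nat \<Rightarrow> ('v, 'k) mpoly mat"
  where "cone_bdry F 0 = 0\<^sub>m 0 (rk F 0)"
  | "cone_bdry F (Suc i) = - bdry F i"

text \<open>The block matrix is the map sending \<open>(a, b)\<close> to
  \<open>(bdry a + f b, - bdry b)\<close>; the sign makes the square of the differential zero. The 2
  in \<open>cone_shifts\<close> is the degree of \<open>f\<close>, and the empty lower block for
  \<open>i = 0\<close> keeps the formula uniform.\<close>

definition cone :: "('v, 'k::field) mpoly \<Rightarrow> ('v, 'k) free_complex \<Rightarrow> ('v, 'k) free_complex"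
  where "cone f F = \<lparr>shifts = (\<lambda>i. shifts F i @ cone_shifts F i),
    bdry = (\<lambda>i. four_block_mat (bdry F i) (f \<cdot>\<^sub>m 1\<^sub>m (rk F i))
      (0\<^sub>m (length (cone_shifts F i)) (rk F (Suc i))) (cone_bdry F i)),
    aug = aug F\<rparr>"

lemma cone_simps:
  "shifts (cone f F) i = shifts F i @ cone_shifts F i"
  "bdry (cone f F) i = four_block_mat (bdry F i) (f \<cdot>\<^sub>m 1\<^sub>m (rk F i))
      (0\<^sub>m (length (cone_shifts F i)) (rk F (Suc i))) (cone_bdry F i)"
  "aug (cone f F) = aug F"
  "rk (cone f F) i = rk F i + length (cone_shifts F i)"
  by (simp_all add: cone_def rk_def)

lemma length_cone_shifts_Suc: "length (cone_shifts F (Suc i)) = rk F i"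
  by (simp add: rk_def)

lemma cone_bdry_graded:
  assumes "\<And>i. graded_mat V (shifts F i) (shifts F (Suc i)) (bdry F i)"
  shows "graded_mat V (cone_shifts F i) (cone_shifts F (Suc i)) (cone_bdry F i)"
proof (cases i)
  case 0
  then show ?thesis by (simp add: graded_mat_def rk_def)
next
  case (Suc l)
  with graded_mat_uminus[OF assms[of l]] show ?thesis by (simp add: graded_mat_def)
qed

lemma cone_bdry_carrier:
  assumes "graded_free_resolution V I F"
  shows "cone_bdry F i \<in> carrier_mat (length (cone_shifts F i)) (rk F i)"
  using graded_matD(1)[OF cone_bdry_graded[OF graded_free_resolutionD(3)[OF assms], of i]]
  by (simp add: rk_def)

lemma cone_bdry_mult_vec:
  assumes F: "graded_free_resolution V I F"
    and a: "a \<in> carrier_vec (rk F (Suc i))" and b: "b \<in> carrier_vec (rk F i)"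
  shows "bdry (cone f F) i *\<^sub>v (a @\<^sub>v b) = (bdry F i *\<^sub>v a + f \<cdot>\<^sub>v b) @\<^sub>v (cone_bdry F i *\<^sub>v b)"
proof -
  note cC = cone_bdry_carrier[OF F, of i] and cF = bdry_carrier[OF F, of i]
  have "bdry (cone f F) i *\<^sub>v (a @\<^sub>v b) = (bdry F i *\<^sub>v a + (f \<cdot>\<^sub>m 1\<^sub>m (rk F i)) *\<^sub>v b) @\<^sub>v
      (0\<^sub>m (length (cone_shifts F i)) (rk F (Suc i)) *\<^sub>v a + cone_bdry F i *\<^sub>v b)"
    unfolding cone_simps by (rule four_block_mat_mult_vec[OF cF _ _ cC a b]) auto
  moreover have "(f \<cdot>\<^sub>m 1\<^sub>m (rk F i)) *\<^sub>v b = f \<cdot>\<^sub>v b"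
    using b by (intro eq_vecI) (auto simp: smult_scalar_prod_distrib[of _ "rk F i"])
  ultimately show ?thesis
    using a b cC by (simp add: zero_mat_mult_vec)
qed

lemma cone_cycles_Suc:
  assumes F: "graded_free_resolution V I F" and K: "a \<in> free_module V (rk F (Suc i))"
    "b \<in> free_module V (rk F i)"
  shows "a @\<^sub>v b \<in> complex_cycles V J (cone f F) (Suc i) \<longleftrightarrow>
    bdry F i *\<^sub>v a + f \<cdot>\<^sub>v b = 0\<^sub>v (rk F i) \<and> cone_bdry F i *\<^sub>v b = 0\<^sub>v (length (cone_shifts F i))"
proof -
  note ca = free_moduleD(1)[OF K(1)] and cb = free_moduleD(1)[OF K(2)]
  have zero: "0\<^sub>v (n + m) = 0\<^sub>v n @\<^sub>v 0\<^sub>v m" for n m by (intro eq_vecI) auto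
  have "a @\<^sub>v b \<in> free_module V (rk (cone f F) (Suc i))"
    using free_module_append[OF K] by (simp add: cone_simps rk_def)
  then have "a @\<^sub>v b \<in> complex_cycles V J (cone f F) (Suc i) \<longleftrightarrow>
      (bdry F i *\<^sub>v a + f \<cdot>\<^sub>v b) @\<^sub>v (cone_bdry F i *\<^sub>v b) = 0\<^sub>v (rk F i) @\<^sub>v 0\<^sub>v (length (cone_shifts F i))"
    by (simp add: cone_bdry_mult_vec[OF F ca cb] cone_simps(4) zero)
  also have "\<dots> \<longleftrightarrow> bdry F i *\<^sub>v a + f \<cdot>\<^sub>v b = 0\<^sub>v (rk F i) \<and> cone_bdry F i *\<^sub>v b = 0\<^sub>v (length (cone_shifts F i))"
    using bdry_carrier[OF F, of i] ca cb by (intro append_vec_eq[of _ "rk F i"]) auto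
  finally show ?thesis .
qed

lemma cone_graded:
  assumes F: "graded_free_resolution V I F" and f: "f \<in> carrier (poly_ring V)" "homogeneous 2 f"
  shows "graded_free_complex V (cone f F)"
  unfolding graded_free_complex_alt
proof (intro conjI allI impI)
  note gF = graded_free_resolutionD(3)[OF F]
  show "aug (cone f F) \<in> free_module V (rk (cone f F) 0)"
    using graded_free_resolutionD(1)[OF F] by (simp add: cone_simps)
  show "homogeneous (shifts (cone f F) 0 ! b) (aug (cone f F) $ b)" if "b < rk (cone f F) 0" for b
    using graded_free_resolutionD(2)[OF F] that by (simp add: cone_simps)
  fix i
  note gC = cone_bdry_graded[OF gF, of i]
  let ?n = "rk F i" and ?m = "rk F (Suc i)" and ?l = "length (cone_shifts F i)"
  note dims = graded_matD(1)[OF gF, of i] graded_matD(1)[OF gC]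
  have "\<And>a b. a < ?n + ?l \<Longrightarrow> b < ?m + ?n \<Longrightarrow>
      bdry (cone f F) i $$ (a, b) \<in> carrier (poly_ring V) \<and>
      homogeneous ((shifts F (Suc i) @ cone_shifts F (Suc i)) ! b - (shifts F i @ cone_shifts F i) ! a)
        (bdry (cone f F) i $$ (a, b))"
  proof -
    fix a b assume ab: "a < ?n + ?l" "b < ?m + ?n"
    have ent: "bdry (cone f F) i $$ (a, b) = (if a < ?n then if b < ?m then bdry F i $$ (a, b)
        else (f \<cdot>\<^sub>m 1\<^sub>m ?n) $$ (a, b - ?m) else if b < ?m then 0 else cone_bdry F i $$ (a - ?n, b - ?m))"
      using ab dims by (auto simp: cone_simps rk_def)
    consider (1) "a < ?n" "b < ?m" | (2) "a < ?n" "b \<ge> ?m" | (3) "a \<ge> ?n" "b < ?m" | (4) "a \<ge> ?n" "b \<ge> ?m"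
      by linarith
    then show "bdry (cone f F) i $$ (a, b) \<in> carrier (poly_ring V) \<and>
      homogeneous ((shifts F (Suc i) @ cone_shifts F (Suc i)) ! b - (shifts F i @ cone_shifts F i) ! a)
        (bdry (cone f F) i $$ (a, b))"
    proof cases
      case 1
      with graded_matD(4,5)[OF gF, of a i b] show ?thesis by (simp add: ent rk_def nth_append)
    next
      case 2
      \<comment> \<open>On the diagonal of this block the entry is \<open>f\<close>, of degree 2,
        which is the difference between the shifted and the unshifted copy of the same generator;
        off the diagonal it is zero.\<close>
      then have "b - ?m < ?n" using ab by linarith
      with 2 f show ?thesis
        by (auto simp: ent rk_def nth_append homogeneous_zero poly_ring_zero)
    next
      case 3
      then show ?thesis by (simp add: ent homogeneous_zero poly_ring_zero)
    next
      case 4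
      then have "a - ?n < ?l" "b - ?m < length (cone_shifts F (Suc i))"
        using ab by (auto simp: rk_def)
      with graded_matD(4,5)[OF gC this] 4 show ?thesis by (auto simp: ent rk_def nth_append)
    qed
  qed
  moreover have "bdry (cone f F) i \<in> carrier_mat (?n + ?l) (?m + ?n)"
    unfolding cone_simps using dims by (intro four_block_carrier_mat) (auto simp: rk_def)
  ultimately show "graded_mat V (shifts (cone f F) i) (shifts (cone f F) (Suc i)) (bdry (cone f F) i)"
    by (simp add: graded_mat_def cone_simps(1) rk_def)
qed

section \<open>Exactness of the cone\<close>

lemma mat_mult_smult_vec:
  fixes A :: "'a::comm_ring mat"
  assumes "A \<in> carrier_mat n m" "v \<in> carrier_vec m"
  shows "A *\<^sub>v (c \<cdot>\<^sub>v v) = c \<cdot>\<^sub>v (A *\<^sub>v v)"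
  using assms by (intro eq_vecI) (auto simp: scalar_prod_def sum_distrib_left ac_simps)

lemma uminus_mat_mult_uminus_vec:
  fixes A :: "'a::comm_ring mat"
  assumes "A \<in> carrier_mat n m" "v \<in> carrier_vec m"
  shows "- A *\<^sub>v - v = A *\<^sub>v v"
  using assms by (intro eq_vecI) (auto simp: scalar_prod_def sum_negf)

text \<open>Exactness may be tested on the elements of an ambient free module, where a vector can be
  split into its two cone components.\<close>

lemma eq_imageI:
  assumes "Z \<subseteq> A" "\<And>v. v \<in> A \<Longrightarrow> v \<in> Z \<longleftrightarrow> v \<in> f ` B" "\<And>w. w \<in> B \<Longrightarrow> f w \<in> A"
  shows "Z = f ` B"
  using assms by blast

text \<open>If \<open>(a, b)\<close> is a cycle, then \<open>b\<close> is a cycle of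
  \<open>F\<close>, say \<open>b = bdry c\<close>; then \<open>a + f c\<close> is a cycle as well,
  say \<open>bdry e\<close>, and \<open>(a, b)\<close> is the image of \<open>(e, - c)\<close>. The
  hypothesis on \<open>f\<close> enters for \<open>b\<close> in homological degree 0, where being a
  cycle means being mapped into \<open>I\<close>.\<close>

lemma cone_resolution:
  assumes I: "hom_ideal V I" and F: "graded_free_resolution V I F"
    and f: "f \<in> carrier (poly_ring V)" "homogeneous 2 f"
    and nzd: "\<And>q. q \<in> carrier (poly_ring V) \<Longrightarrow> f * q \<in> I \<Longrightarrow> q \<in> I"
  shows "graded_free_resolution V {p + f * q | p q. p \<in> I \<and> q \<in> carrier (poly_ring V)} (cone f F)"
    (is "graded_free_resolution V ?J ?K")
  unfolding graded_free_resolution_alt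
proof (intro conjI ballI allI)
  note augF = graded_free_resolutionD(1)[OF F]
  note exF = graded_free_resolutionD(5)[OF F]
  note cF = bdry_carrier[OF F] and gF = graded_free_resolutionD(3)[OF F]
  have dF: "bdry F i *\<^sub>v w \<in> free_module V (rk F i)" if "w \<in> free_module V (rk F (Suc i))" for i w
    using free_module_graded_mat[OF gF] that unfolding rk_def by blast
  show "graded_free_complex V ?K" by (rule cone_graded[OF F f])
  have sub: "p \<in> ?J" if "p \<in> I" for p
  proof -
    have "p = p + f * 0" by simp
    with that poly_ring_zero show ?thesis by blast
  qed
  show "\<exists>v\<in>free_module V (rk ?K 0). s - aug ?K \<bullet> v \<in> ?J" if "s \<in> carrier (poly_ring V)" for s
  proof -
    from graded_free_resolutionD(4)[OF F that] obtain v
      where v: "v \<in> free_module V (rk F 0)" "s - aug F \<bullet> v \<in> I" by blast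
    have eq: "rk ?K 0 = rk F 0" "aug ?K = aug F" by (simp_all add: cone_simps)
    show ?thesis unfolding eq by (rule bexI[OF _ v(1)]) (rule sub[OF v(2)])
  qed
  fix i
  have rk_Suc: "rk ?K (Suc i) = rk F (Suc i) + rk F i" for i
    by (simp add: cone_simps rk_def)
  show "complex_cycles V ?J ?K i = (\<lambda>w. bdry ?K i *\<^sub>v w) ` free_module V (rk ?K (Suc i))"
  proof (cases i)
    case 0
    have D0: "bdry ?K 0 *\<^sub>v (a @\<^sub>v b) = bdry F 0 *\<^sub>v a + f \<cdot>\<^sub>v b"
      if "a \<in> free_module V (rk F (Suc 0))" "b \<in> free_module V (rk F 0)" for a b
      unfolding cone_bdry_mult_vec[OF F free_moduleD(1)[OF that(1)] free_moduleD(1)[OF that(2)]]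
      using free_moduleD(1)[OF that(2)] cF[of 0] by (intro eq_vecI) auto
    have eq: "aug F \<bullet> v \<in> ?J \<longleftrightarrow> v \<in> (\<lambda>w. bdry ?K 0 *\<^sub>v w) ` free_module V (rk ?K (Suc 0))"
      if v: "v \<in> free_module V (rk F 0)" for v
    proof
      assume "aug F \<bullet> v \<in> ?J"
      then obtain p q where pq: "p \<in> I" "q \<in> carrier (poly_ring V)" "aug F \<bullet> v = p + f * q" by blast
      \<comment> \<open>Lifting \<open>q\<close> through the augmentation makes \<open>f b\<close>
        account for \<open>f * q\<close> up to \<open>I\<close>, so \<open>v - f b\<close> is a
        cycle of \<open>F\<close> and comes from some \<open>a\<close>.\<close>
      from graded_free_resolutionD(4)[OF F pq(2)] obtain b
        where b: "b \<in> free_module V (rk F 0)" "q - aug F \<bullet> b \<in> I" by blast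
      have fb: "f \<cdot>\<^sub>v b \<in> free_module V (rk F 0)" using f(1) b(1) by (rule free_module_smult)
      have "aug F \<bullet> (v - f \<cdot>\<^sub>v b) = aug F \<bullet> v - f * (aug F \<bullet> b)"
        using free_moduleD(1)[OF augF] free_moduleD(1)[OF v] free_moduleD(1)[OF b(1)]
        by (simp add: scalar_prod_minus_distrib[of _ "rk F 0"])
      also have "\<dots> = p + f * (q - aug F \<bullet> b)"
        by (simp add: pq(3) algebra_simps)
      also have "\<dots> \<in> I" by (intro hom_idealD(3)[OF I] hom_idealD(4)[OF I] pq b f)
      finally have "v - f \<cdot>\<^sub>v b \<in> complex_cycles V I F 0"
        using v fb by (simp add: free_module_minus)
      then obtain a where a: "a \<in> free_module V (rk F (Suc 0))" "v - f \<cdot>\<^sub>v b = bdry F 0 *\<^sub>v a"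
        unfolding exF by blast
      have "v = (v - f \<cdot>\<^sub>v b) + f \<cdot>\<^sub>v b"
        using free_moduleD(1)[OF v] free_moduleD(1)[OF b(1)] by (intro eq_vecI) auto
      also have "\<dots> = bdry ?K 0 *\<^sub>v (a @\<^sub>v b)" unfolding a(2) by (rule D0[OF a(1) b(1), symmetric])
      finally show "v \<in> (\<lambda>w. bdry ?K 0 *\<^sub>v w) ` free_module V (rk ?K (Suc 0))"
        using free_module_append[OF a(1) b(1)] unfolding rk_Suc by blast
    next
      assume *: "v \<in> (\<lambda>w. bdry ?K 0 *\<^sub>v w) ` free_module V (rk ?K (Suc 0))"
      obtain a b where ab: "a \<in> free_module V (rk F (Suc 0))" "b \<in> free_module V (rk F 0)"
        "v = bdry F 0 *\<^sub>v a + f \<cdot>\<^sub>v b"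
      proof -
        from * obtain w where w: "w \<in> free_module V (rk F (Suc 0) + rk F 0)" "v = bdry ?K 0 *\<^sub>v w"
          unfolding rk_Suc by blast
        from w(1) obtain a b where "w = a @\<^sub>v b" "a \<in> free_module V (rk F (Suc 0))" "b \<in> free_module V (rk F 0)"
          by (rule free_module_appendE)
        with w(2) D0 that show thesis by metis
      qed
      have "aug F \<bullet> v = aug F \<bullet> (bdry F 0 *\<^sub>v a) + f * (aug F \<bullet> b)"
        unfolding ab(3) using free_moduleD(1)[OF augF] free_moduleD(1)[OF ab(2)] free_moduleD(1)[OF dF[OF ab(1)]]
        by (simp add: scalar_prod_add_distrib[of _ "rk F 0"])
      moreover have "aug F \<bullet> (bdry F 0 *\<^sub>v a) \<in> I" using bdry_in_cycles[OF F ab(1)] by simp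
      ultimately show "aug F \<bullet> v \<in> ?J"
        using scalar_prod_poly_ring[OF augF ab(2)] by blast
    qed
    have im: "bdry ?K 0 *\<^sub>v w \<in> free_module V (rk F 0)" if w: "w \<in> free_module V (rk ?K (Suc 0))" for w
    proof -
      from w obtain a b where ab: "w = a @\<^sub>v b" "a \<in> free_module V (rk F (Suc 0))" "b \<in> free_module V (rk F 0)"
        unfolding rk_Suc by (rule free_module_appendE)
      show ?thesis unfolding ab(1) D0[OF ab(2,3)]
        by (intro free_module_add free_module_smult dF f(1) ab)
    qed
    have Z: "complex_cycles V ?J ?K 0 = {v \<in> free_module V (rk F 0). aug F \<bullet> v \<in> ?J}"
      by (simp only: complex_cycles.simps cone_simps cone_shifts.simps list.size add_0_right)
    show ?thesis unfolding 0 Z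
    proof (rule eq_imageI[OF _ _ im])
      show "v \<in> {v \<in> free_module V (rk F 0). aug F \<bullet> v \<in> ?J} \<longleftrightarrow>
          v \<in> (\<lambda>w. bdry ?K 0 *\<^sub>v w) ` free_module V (rk ?K (Suc 0))" if "v \<in> free_module V (rk F 0)" for v
        unfolding eq[OF that, symmetric] using that by (simp only: mem_Collect_eq[of v] simp_thms)
    qed (rule Collect_subset)
  next
    case (Suc l)
    have D: "bdry ?K (Suc l) *\<^sub>v (e @\<^sub>v c) = (bdry F (Suc l) *\<^sub>v e + f \<cdot>\<^sub>v c) @\<^sub>v - (bdry F l *\<^sub>v c)"
      if "e \<in> free_module V (rk F (Suc (Suc l)))" "c \<in> free_module V (rk F (Suc l))" for e c
      unfolding cone_bdry_mult_vec[OF F free_moduleD(1)[OF that(1)] free_moduleD(1)[OF that(2)]]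
      using free_moduleD(1)[OF that(2)] cF[of l] by simp
    \<comment> \<open>For positive \<open>l\<close> the second equation says this up to sign. For
      \<open>l = 0\<close> that equation is empty; the first one puts \<open>f\<close> times the
      augmentation of \<open>b\<close> in \<open>I\<close>, and \<open>f\<close> is cancelled by
      \<open>nzd\<close>.\<close>
    have cyc_b: "b \<in> complex_cycles V I F l"
      if a: "a \<in> free_module V (rk F (Suc l))" and b: "b \<in> free_module V (rk F l)"
        and 1: "bdry F l *\<^sub>v a + f \<cdot>\<^sub>v b = 0\<^sub>v (rk F l)"
        and 2: "cone_bdry F l *\<^sub>v b = 0\<^sub>v (length (cone_shifts F l))" for a b
    proof (cases l)
      case 0
      have a0: "a \<in> free_module V (rk F (Suc 0))" and b0: "b \<in> free_module V (rk F 0)"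
        and z: "bdry F 0 *\<^sub>v a + f \<cdot>\<^sub>v b = 0\<^sub>v (rk F 0)"
        using a b 1 unfolding 0 .
      note cvs = free_moduleD(1)[OF augF] free_moduleD(1)[OF b0] free_moduleD(1)[OF dF[OF a0]]
      have "aug F \<bullet> (bdry F 0 *\<^sub>v a) + f * (aug F \<bullet> b) = aug F \<bullet> (bdry F 0 *\<^sub>v a + f \<cdot>\<^sub>v b)"
        using cvs by (simp add: scalar_prod_add_distrib[of _ "rk F 0"])
      also have "\<dots> = 0" unfolding z using cvs(1) by simp
      finally have "f * (aug F \<bullet> b) = 0 - aug F \<bullet> (bdry F 0 *\<^sub>v a)"
        by (metis add_diff_cancel_left')
      moreover have "aug F \<bullet> (bdry F 0 *\<^sub>v a) \<in> I"
        using bdry_in_cycles[OF F a0] by simp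
      ultimately have "f * (aug F \<bullet> b) \<in> I"
        using hom_ideal_minus[OF I hom_idealD(2)[OF I]] by metis
      from nzd[OF scalar_prod_poly_ring[OF augF b0] this] show ?thesis
        unfolding 0 complex_cycles.simps using b0 by blast
    next
      case (Suc k)
      have "bdry F k *\<^sub>v b = - (cone_bdry F l *\<^sub>v b)"
        using free_moduleD(1)[OF b] cF[of k] Suc by simp
      then show ?thesis using b Suc 2 by (simp add: rk_def)
    qed
    have eq: "u \<in> complex_cycles V ?J ?K (Suc l) \<longleftrightarrow> u \<in> (\<lambda>w. bdry ?K (Suc l) *\<^sub>v w) ` free_module V (rk ?K (Suc (Suc l)))"
      if u: "u \<in> free_module V (rk ?K (Suc l))" for u
    proof -
      from u obtain a b where u: "u = a @\<^sub>v b" and a: "a \<in> free_module V (rk F (Suc l))"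
        and b: "b \<in> free_module V (rk F l)"
        unfolding rk_Suc by (rule free_module_appendE)
      note ca = free_moduleD(1)[OF a] and cb = free_moduleD(1)[OF b]
      show ?thesis unfolding u cone_cycles_Suc[OF F a b]
      proof
        assume *: "bdry F l *\<^sub>v a + f \<cdot>\<^sub>v b = 0\<^sub>v (rk F l) \<and> cone_bdry F l *\<^sub>v b = 0\<^sub>v (length (cone_shifts F l))"
        with cyc_b[OF a b] have "b \<in> complex_cycles V I F l" by blast
        then obtain c where c: "c \<in> free_module V (rk F (Suc l))" "b = bdry F l *\<^sub>v c"
          unfolding exF by blast
        note cc = free_moduleD(1)[OF c(1)]
        have "bdry F l *\<^sub>v (a + f \<cdot>\<^sub>v c) = bdry F l *\<^sub>v a + f \<cdot>\<^sub>v b"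
          using ca cc by (simp add: mult_add_distrib_mat_vec[OF cF[of l]] mat_mult_smult_vec[OF cF[of l]] c(2))
        with * a c(1) f(1) have "a + f \<cdot>\<^sub>v c \<in> complex_cycles V I F (Suc l)"
          by (simp add: free_module_add free_module_smult)
        then obtain e where e: "e \<in> free_module V (rk F (Suc (Suc l)))" "a + f \<cdot>\<^sub>v c = bdry F (Suc l) *\<^sub>v e"
          unfolding exF by blast
        \<comment> \<open>The sign of the second component compensates the sign of the lower block
          and also removes the correction \<open>f c\<close> from \<open>a + f c\<close>.\<close>
        have c': "- c \<in> free_module V (rk F (Suc l))" using c(1) by (rule free_module_uminus)
        have "bdry ?K (Suc l) *\<^sub>v (e @\<^sub>v - c) = a @\<^sub>v b"
        proof -
          have "bdry F (Suc l) *\<^sub>v e + f \<cdot>\<^sub>v (- c) = a"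
            unfolding e(2)[symmetric] using ca cc by (intro eq_vecI) auto
          moreover have "- (bdry F l *\<^sub>v (- c)) = b"
            unfolding c(2) using cc cF[of l] by (intro eq_vecI) auto
          ultimately show ?thesis unfolding D[OF e(1) c'] by simp
        qed
        from this[symmetric] show "a @\<^sub>v b \<in> (\<lambda>w. bdry ?K (Suc l) *\<^sub>v w) ` free_module V (rk ?K (Suc (Suc l)))"
          unfolding rk_Suc by (rule image_eqI[OF _ free_module_append[OF e(1) c']])
      next
        assume *: "a @\<^sub>v b \<in> (\<lambda>w. bdry ?K (Suc l) *\<^sub>v w) ` free_module V (rk ?K (Suc (Suc l)))"
        obtain e c where e: "e \<in> free_module V (rk F (Suc (Suc l)))"
          and c: "c \<in> free_module V (rk F (Suc l))"
          and eq: "a @\<^sub>v b = (bdry F (Suc l) *\<^sub>v e + f \<cdot>\<^sub>v c) @\<^sub>v - (bdry F l *\<^sub>v c)"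
        proof -
          from * obtain w where w: "w \<in> free_module V (rk F (Suc (Suc l)) + rk F (Suc l))" "a @\<^sub>v b = bdry ?K (Suc l) *\<^sub>v w"
            unfolding rk_Suc[of "Suc l"] by blast
          from w(1) obtain e c where "w = e @\<^sub>v c" "e \<in> free_module V (rk F (Suc (Suc l)))"
            "c \<in> free_module V (rk F (Suc l))"
            by (rule free_module_appendE)
          with w(2) show thesis by (intro that) (simp_all only: D)
        qed
        note cc = free_moduleD(1)[OF c]
        note cde = free_moduleD(1)[OF dF[OF e]] and cdc = free_moduleD(1)[OF dF[OF c]]
        from eq have a': "a = bdry F (Suc l) *\<^sub>v e + f \<cdot>\<^sub>v c" and b': "b = - (bdry F l *\<^sub>v c)"
          using append_vec_eq[of a "rk F (Suc l)" "bdry F (Suc l) *\<^sub>v e + f \<cdot>\<^sub>v c"] ca cde cc by auto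
        have "bdry F l *\<^sub>v (bdry F (Suc l) *\<^sub>v e) = 0\<^sub>v (rk F l)"
          using bdry_in_cycles[OF F e] by simp
        then have "bdry F l *\<^sub>v a = f \<cdot>\<^sub>v (bdry F l *\<^sub>v c)"
          unfolding a' using cde cc cdc
          by (simp add: mult_add_distrib_mat_vec[OF cF[of l]] mat_mult_smult_vec[OF cF[of l]])
        then have "bdry F l *\<^sub>v a + f \<cdot>\<^sub>v b = 0\<^sub>v (rk F l)"
          unfolding b' using cdc cF[of l] by (intro eq_vecI) auto
        moreover have "cone_bdry F l *\<^sub>v b = 0\<^sub>v (length (cone_shifts F l))"
        proof (cases l)
          case 0
          then show ?thesis by (intro eq_vecI) auto
        next
          case (Suc k)
          have "bdry F k *\<^sub>v (bdry F l *\<^sub>v c) = 0\<^sub>v (rk F k)"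
            using bdry_in_cycles[OF F c] Suc by simp
          moreover have "cone_bdry F l *\<^sub>v b = bdry F k *\<^sub>v (bdry F l *\<^sub>v c)"
            using uminus_mat_mult_uminus_vec[OF cF[of k], of "bdry F l *\<^sub>v c"] cdc by (simp add: b' Suc)
          ultimately show ?thesis using Suc by (simp add: rk_def)
        qed
        ultimately show "bdry F l *\<^sub>v a + f \<cdot>\<^sub>v b = 0\<^sub>v (rk F l) \<and> cone_bdry F l *\<^sub>v b = 0\<^sub>v (length (cone_shifts F l))"
          by blast
      qed
    qed
    have im: "bdry ?K (Suc l) *\<^sub>v w \<in> free_module V (rk ?K (Suc l))"
      if w: "w \<in> free_module V (rk ?K (Suc (Suc l)))" for w
    proof -
      from w obtain e c where ec: "w = e @\<^sub>v c" "e \<in> free_module V (rk F (Suc (Suc l)))"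
        "c \<in> free_module V (rk F (Suc l))"
        unfolding rk_Suc[of "Suc l"] by (rule free_module_appendE)
      show ?thesis unfolding ec(1) D[OF ec(2,3)] rk_Suc
        by (intro free_module_append free_module_uminus free_module_add free_module_smult dF f(1) ec)
    qed
    show ?thesis unfolding Suc by (rule eq_imageI[OF complex_cycles_subset eq im])
  qed
qed

text \<open>Up to sign, the nonzero entries are those of \<open>bdry F\<close> and copies of
  \<open>f\<close>, all without constant term.\<close>

lemma cone_minimal:
  assumes F: "graded_free_resolution V I F" and f: "const_coeff f = 0"
    and min: "\<And>i. tensor_bdry F i = 0\<^sub>m (rk F i) (rk F (Suc i))"
  shows "tensor_bdry (cone f F) i = 0\<^sub>m (rk (cone f F) i) (rk (cone f F) (Suc i))"
proof (rule eq_matI)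
  note cF = bdry_carrier[OF F] and cC = cone_bdry_carrier[OF F]
  have ent: "const_coeff (bdry F i $$ (a, b)) = 0" if "a < rk F i" "b < rk F (Suc i)" for i a b
    using arg_cong[OF min[of i], of "\<lambda>M. M $$ (a, b)"] that cF[of i] by (simp add: tensor_bdry_alt)
  have entC: "const_coeff (cone_bdry F i $$ (a, b)) = 0" if "a < length (cone_shifts F i)" "b < rk F i" for a b
  proof (cases i)
    case 0
    then show ?thesis using that by simp
  next
    case (Suc l)
    then show ?thesis using that ent cF[of l] by (simp add: rk_def)
  qed
  have carrier: "bdry (cone f F) i \<in> carrier_mat (rk (cone f F) i) (rk (cone f F) (Suc i))"
    unfolding cone_simps(2,4) length_cone_shifts_Suc
    using cF[of i] cC[of i] by (intro four_block_carrier_mat) auto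
  then show "dim_row (tensor_bdry (cone f F) i) = dim_row (0\<^sub>m (rk (cone f F) i) (rk (cone f F) (Suc i)))"
    "dim_col (tensor_bdry (cone f F) i) = dim_col (0\<^sub>m (rk (cone f F) i) (rk (cone f F) (Suc i)))"
    by (auto simp: tensor_bdry_alt)
  fix a b assume "a < dim_row (0\<^sub>m (rk (cone f F) i) (rk (cone f F) (Suc i)))"
    "b < dim_col (0\<^sub>m (rk (cone f F) i) (rk (cone f F) (Suc i)))"
  then have ab: "a < rk (cone f F) i" "b < rk (cone f F) (Suc i)" by auto
  have "const_coeff (bdry (cone f F) i $$ (a, b)) = 0"
    using ab cF[of i] cC[of i] ent[of a i b] entC[of "a - rk F i" "b - rk F (Suc i)"] f
    unfolding cone_simps(2,4) length_cone_shifts_Suc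
    by (auto simp: one_mat_def)
  then show "tensor_bdry (cone f F) i $$ (a, b) = 0\<^sub>m (rk (cone f F) i) (rk (cone f F) (Suc i)) $$ (a, b)"
    using ab carrier by (simp add: tensor_bdry_alt)
qed

section \<open>Disjoint edges\<close>

definition matching_graph :: "nat \<Rightarrow> nat \<Rightarrow> nat pair_pre_digraph"
  where "matching_graph d r = \<lparr>pverts = {..<d + r},
    parcs = (\<lambda>i. (i, d + i)) ` {..<r} \<union> (\<lambda>i. (d + i, i)) ` {..<r}\<rparr>"

lemma matching_graph_simps [simp]:
  "pverts (matching_graph d r) = {..<d + r}"
  "parcs (matching_graph d r) = (\<lambda>i. (i, d + i)) ` {..<r} \<union> (\<lambda>i. (d + i, i)) ` {..<r}"
  by (simp_all add: matching_graph_def)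

lemma pair_graph_matching_graph:
  assumes "1 \<le> r" "r \<le> d"
  shows "pair_graph (matching_graph d r)"
proof
  show "symmetric (with_proj (matching_graph d r))"
    by (auto simp: symmetric_def intro!: symI)
qed (use assms in auto)

definition edge_monomial :: "nat \<Rightarrow> nat \<Rightarrow> (nat \<Rightarrow>\<^sub>0 nat)"
  where "edge_monomial d i = Poly_Mapping.single i 1 + Poly_Mapping.single (d + i) 1"

definition in_edges :: "nat \<Rightarrow> nat \<Rightarrow> (nat \<Rightarrow>\<^sub>0 nat) \<Rightarrow> bool"
  where "in_edges d n m \<longleftrightarrow> (\<exists>i<n. i \<in> Poly_Mapping.keys m \<and> d + i \<in> Poly_Mapping.keys m)"

text \<open>The monomial ideal of the first \<open>n\<close> edges. The number of edges varies while
  \<open>V\<close> stays fixed, so that induction on \<open>n\<close> takes place inside one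
  polynomial ring.\<close>

definition matching_ideal :: "nat \<Rightarrow> nat set \<Rightarrow> nat \<Rightarrow> (nat, 'k::field) mpoly set"
  where "matching_ideal d V n = {p \<in> carrier (poly_ring V). \<forall>m \<in> Poly_Mapping.keys p. in_edges d n m}"

lemma in_edges_add: "in_edges d n m \<Longrightarrow> in_edges d n (m + m')"
  "in_edges d n m \<Longrightarrow> in_edges d n (m' + m)"
  by (auto simp: in_edges_def keys_add_nat)

lemma mvar_mult_mvar: "mvar i * mvar (d + i) = Poly_Mapping.single (edge_monomial d i) 1"
  by (simp add: mvar_def mult_single edge_monomial_def)

lemma keys_edge_monomial: "Poly_Mapping.keys (edge_monomial d i) = {i, d + i}"
  by (auto simp: edge_monomial_def keys_add_nat)

text \<open>Subtraction of exponents is truncated, so divisibility has to be checked. With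
  \<open>d > 0\<close> the two endpoints differ and the edge monomial has exponents at most 1, which
  is why the support of \<open>m\<close> decides.\<close>

lemma edge_monomial_dvd:
  assumes d: "d > 0" and m: "i \<in> Poly_Mapping.keys m" "d + i \<in> Poly_Mapping.keys m"
  shows "m = edge_monomial d i + (m - edge_monomial d i)"
proof (rule poly_mapping_eqI)
  fix x
  have "Poly_Mapping.lookup (edge_monomial d i) x \<le> Poly_Mapping.lookup m x"
    using assms by (auto simp: edge_monomial_def lookup_add lookup_single when_def in_keys_iff)
  then show "Poly_Mapping.lookup m x = Poly_Mapping.lookup (edge_monomial d i + (m - edge_monomial d i)) x"
    by (simp add: lookup_add lookup_minus)
qed

lemma matching_ideal_hom: "hom_ideal V (matching_ideal d V n)"
  unfolding hom_ideal_def
proof (intro conjI ballI allI)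
  fix p q :: "(nat, 'a) mpoly"
  show "p + q \<in> matching_ideal d V n" if "p \<in> matching_ideal d V n" "q \<in> matching_ideal d V n"
    using that keys_add[of p q] by (auto simp: matching_ideal_def poly_ring_add)
  show "q * p \<in> matching_ideal d V n" if "p \<in> matching_ideal d V n" "q \<in> carrier (poly_ring V)"
    using that by (auto simp: matching_ideal_def poly_ring_mult in_edges_add elim!: keys_multE)
  show "hom_part i p \<in> matching_ideal d V n" if "p \<in> matching_ideal d V n" for i
    using that by (auto simp: matching_ideal_def poly_ring_mon_filter keys_mon_filter)
qed (auto simp: matching_ideal_def poly_ring_zero)

lemma matching_ideal_mono: "n \<le> n' \<Longrightarrow> matching_ideal d V n \<subseteq> matching_ideal d V n'"
  unfolding matching_ideal_def in_edges_def by (auto dest: order.strict_trans2)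

text \<open>Multiplication by the monomial of a new edge does not change whether a monomial is divisible
  by one of the old edges, because the edges are disjoint.\<close>

lemma matching_ideal_nzd:
  fixes q :: "(nat, 'k::field) mpoly"
  assumes "n < d" and q: "q \<in> carrier (poly_ring V)"
    and prod: "mvar n * mvar (d + n) * q \<in> matching_ideal d V n"
  shows "q \<in> matching_ideal d V n"
proof -
  let ?f = "mvar n * mvar (d + n) :: (nat, 'k) mpoly"
  have "in_edges d n (edge_monomial d n + m) \<longleftrightarrow> in_edges d n m" for m
    using \<open>n < d\<close> by (auto simp: in_edges_def keys_add_nat keys_edge_monomial)
  then have "mon_filter (in_edges d n) (?f * q) = ?f * mon_filter (in_edges d n) q"
    unfolding mvar_mult_mvar by (intro mon_filter_mult) simp
  moreover have "mon_filter (in_edges d n) (?f * q) = ?f * q"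
    using prod by (intro mon_filter_id) (simp add: matching_ideal_def)
  \<comment> \<open>The polynomial ring has no zero divisors, so \<open>?f\<close> can be cancelled
    from the two expressions for the filtered product.\<close>
  moreover have "?f \<noteq> 0"
    unfolding mvar_mult_mvar by (metis keys_single keys_zero insert_not_empty one_neq_zero)
  ultimately have "mon_filter (in_edges d n) q = q"
    by simp
  then have "\<forall>m \<in> Poly_Mapping.keys q. in_edges d n m"
    using keys_mon_filter[of "in_edges d n" q] by auto
  then show ?thesis using q by (simp add: matching_ideal_def)
qed

lemma monomial_factor:
  fixes p :: "(nat, 'k::field) mpoly"
  assumes d: "d > 0" and p: "p \<in> carrier (poly_ring V)"
    and dvd: "\<And>m. m \<in> Poly_Mapping.keys p \<Longrightarrow> i \<in> Poly_Mapping.keys m \<and> d + i \<in> Poly_Mapping.keys m"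
  obtains q where "q \<in> carrier (poly_ring V)" "p = mvar i * mvar (d + i) * q"
proof
  let ?q = "\<Sum>m\<in>Poly_Mapping.keys p. Poly_Mapping.single (m - edge_monomial d i) (Poly_Mapping.lookup p m)"
  show "?q \<in> carrier (poly_ring V)"
  proof (intro poly_ring_sum poly_ring_single)
    fix m assume m: "m \<in> Poly_Mapping.keys p"
    have "Poly_Mapping.keys (m - edge_monomial d i) \<subseteq> Poly_Mapping.keys m"
      by (auto simp: in_keys_iff lookup_minus)
    then show "Poly_Mapping.keys (m - edge_monomial d i) \<subseteq> V"
      using p m by (auto simp: mem_poly_ring)
  qed
  have "p = (\<Sum>m\<in>Poly_Mapping.keys p. Poly_Mapping.single m (Poly_Mapping.lookup p m))"
    by (rule poly_eq_sum_single)
  also have "\<dots> = mvar i * mvar (d + i) * ?q"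
    unfolding mvar_mult_mvar sum_distrib_left mult_single
    using edge_monomial_dvd[OF d] dvd by (intro sum.cong refl) (metis mult_1)
  finally show "p = mvar i * mvar (d + i) * ?q" .
qed

text \<open>A monomial of the larger ideal that is divisible by no old edge must be divisible by the
  new one, so sorting the monomials gives the decomposition. The right-hand side has the shape
  produced by \<open>cone_resolution\<close>.\<close>

lemma matching_ideal_Suc:
  assumes n: "n < d" "n \<in> V" "d + n \<in> V"
  shows "matching_ideal d V (Suc n) =
    {p + mvar n * mvar (d + n) * q | p q. p \<in> matching_ideal d V n \<and> q \<in> carrier (poly_ring V)}"
    (is "_ = ?J")
proof (intro equalityI subsetI)
  fix p :: "(nat, 'a) mpoly" assume p: "p \<in> matching_ideal d V (Suc n)"
  let ?p1 = "mon_filter (in_edges d n) p" and ?p2 = "mon_filter (\<lambda>m. \<not> in_edges d n m) p"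
  have p1: "?p1 \<in> matching_ideal d V n" and p2: "?p2 \<in> carrier (poly_ring V)"
    using p by (auto simp: matching_ideal_def poly_ring_mon_filter keys_mon_filter)
  have "n \<in> Poly_Mapping.keys m \<and> d + n \<in> Poly_Mapping.keys m" if "m \<in> Poly_Mapping.keys ?p2" for m
    using that p by (auto simp: matching_ideal_def keys_mon_filter in_edges_def less_Suc_eq)
  with monomial_factor[OF _ p2] n obtain q
    where q: "q \<in> carrier (poly_ring V)" "?p2 = mvar n * mvar (d + n) * q" by (metis gr0I not_less0)
  have "p = ?p1 + mvar n * mvar (d + n) * q"
    unfolding q(2)[symmetric] by (rule mon_filter_split)
  with p1 q(1) show "p \<in> ?J" by blast
next
  fix p :: "(nat, 'a) mpoly" assume "p \<in> ?J"
  then obtain p1 q where p: "p = p1 + mvar n * mvar (d + n) * q"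
    "p1 \<in> matching_ideal d V n" "q \<in> carrier (poly_ring V)" by blast
  have "mvar n * mvar (d + n) \<in> (matching_ideal d V (Suc n) :: (nat, 'a) mpoly set)"
    using n unfolding mvar_mult_mvar matching_ideal_def
    by (auto simp: keys_edge_monomial in_edges_def intro!: poly_ring_single)
  from hom_idealD(4)[OF matching_ideal_hom this p(3)] have "mvar n * mvar (d + n) * q \<in> matching_ideal d V (Suc n)"
    by (simp add: mult.commute)
  moreover have "p1 \<in> matching_ideal d V (Suc n)"
    using p(2) matching_ideal_mono[of n "Suc n"] by auto
  ultimately show "p \<in> matching_ideal d V (Suc n)"
    unfolding p(1) by (intro hom_idealD(3)[OF matching_ideal_hom])
qed

section \<open>The iterated cone and the regularity\<close>

text \<open>This is the Koszul complex on the \<open>n\<close> edge monomials. The induction records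
  the degree of the generators and which terms are nonzero: these data decide which strands
  vanish.\<close>

lemma koszul_resolution:
  assumes "n \<le> d" and V: "{..<n} \<union> {d..<d + n} \<subseteq> V"
  shows "\<exists>K :: (nat, 'k::field) free_complex. graded_free_resolution V (matching_ideal d V n) K \<and>
    (\<forall>i. tensor_bdry K i = 0\<^sub>m (rk K i) (rk K (Suc i))) \<and>
    (\<forall>i. \<forall>a \<in> set (shifts K i). a = 2 * int i) \<and> (\<forall>i. rk K i > 0 \<longleftrightarrow> i \<le> n)"
  using assms
proof (induction n)
  case 0
  \<comment> \<open>The empty graph has zero ideal, and S is its own resolution: one generator in
    degree 0 and rank 0 afterwards.\<close>
  define K :: "(nat, 'k) free_complex" where
    "K = \<lparr>shifts = (\<lambda>i. if i = 0 then [0] else []),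
      bdry = (\<lambda>i. 0\<^sub>m (if i = 0 then 1 else 0) 0), aug = vec 1 (\<lambda>_. 1)\<rparr>"
  have K: "shifts K i = (if i = 0 then [0] else [])" "bdry K i = 0\<^sub>m (if i = 0 then 1 else 0) 0"
    "aug K = vec 1 (\<lambda>_. 1)" "rk K i = (if i = 0 then 1 else 0)" for i
    by (simp_all add: K_def rk_def)
  have I0: "matching_ideal d V 0 = ({0} :: (nat, 'k) mpoly set)"
    by (auto simp: matching_ideal_def in_edges_def poly_ring_zero)
  have aug: "aug K \<bullet> v = v $ 0" if "v \<in> carrier_vec 1" for v
    using that by (simp add: K scalar_prod_def)
  have fm0: "v \<in> free_module V 0 \<longleftrightarrow> v = 0\<^sub>v 0" for v :: "(nat, 'k) mpoly vec"
    by (auto simp: free_module_def)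
  have "graded_free_resolution V {0} K"
    unfolding graded_free_resolution_alt graded_free_complex_alt
  proof (intro conjI allI ballI impI)
    show "aug K \<in> free_module V (rk K 0)" by (auto simp: K free_module_def poly_ring_one)
    show "homogeneous (shifts K 0 ! b) (aug K $ b)" if "b < rk K 0" for b
      using that by (simp add: K homogeneous_one)
    show "graded_mat V (shifts K i) (shifts K (Suc i)) (bdry K i)" for i
      by (simp add: K graded_mat_def)
    show "\<exists>v\<in>free_module V (rk K 0). s - aug K \<bullet> v \<in> {0}" if "s \<in> carrier (poly_ring V)" for s
      using that by (intro bexI[of _ "vec 1 (\<lambda>_. s)"]) (auto simp: aug, auto simp: K free_module_def)
    show "complex_cycles V {0} K i = (\<lambda>w. bdry K i *\<^sub>v w) ` free_module V (rk K (Suc i))" for i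
    proof (cases i)
      case 0
      have "{v \<in> free_module V 1. aug K \<bullet> v \<in> {0}} = {0\<^sub>v 1}"
        by (auto simp: free_module_def aug poly_ring_zero intro!: eq_vecI)
      moreover have "(\<lambda>w. bdry K 0 *\<^sub>v w) ` free_module V 0 = {0\<^sub>v 1}"
        by (auto simp: fm0 K intro!: image_eqI[of _ _ "0\<^sub>v 0"] eq_vecI)
      ultimately show ?thesis unfolding 0 by (simp add: K(4))
    next
      case (Suc l)
      have "bdry K (Suc l) *\<^sub>v 0\<^sub>v 0 = 0\<^sub>v 0" "bdry K l *\<^sub>v 0\<^sub>v 0 = 0\<^sub>v (rk K l)"
        by (auto simp: K scalar_prod_def intro!: eq_vecI)
      moreover have "rk K (Suc j) = 0" for j by (simp add: K)
      moreover have "free_module V 0 = {0\<^sub>v 0 :: (nat, 'k) mpoly vec}" using fm0 by blast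
      ultimately show ?thesis unfolding Suc complex_cycles.simps by auto
    qed
  qed
  moreover have "\<forall>i. tensor_bdry K i = 0\<^sub>m (rk K i) (rk K (Suc i))"
    by (auto simp: tensor_bdry_alt K intro!: eq_matI)
  ultimately show ?case
    unfolding I0 by (intro exI[of _ K]) (auto simp: K)
next
  case (Suc n)
  have "n \<le> d" "{..<n} \<union> {d..<d + n} \<subseteq> V" using Suc.prems by (auto simp: subset_iff)
  from Suc.IH[OF this] obtain K :: "(nat, 'k) free_complex" where
    K: "graded_free_resolution V (matching_ideal d V n) K"
      "\<And>i. tensor_bdry K i = 0\<^sub>m (rk K i) (rk K (Suc i))"
      "\<And>i a. a \<in> set (shifts K i) \<Longrightarrow> a = 2 * int i" "\<And>i. rk K i > 0 \<longleftrightarrow> i \<le> n"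
    by blast
  let ?f = "mvar n * mvar (d + n) :: (nat, 'k) mpoly"
  have nV: "n < d" "n \<in> V" "d + n \<in> V" using Suc.prems by auto
  have "graded_free_resolution V (matching_ideal d V (Suc n)) (cone ?f K)"
    unfolding matching_ideal_Suc[OF nV]
    by (rule cone_resolution[OF matching_ideal_hom K(1) _ homogeneous_mvar_mult matching_ideal_nzd[OF nV(1)]])
      (use nV in \<open>auto intro: poly_ring_mult poly_ring_mvar\<close>)
  moreover have "const_coeff ?f = 0"
  proof -
    have "edge_monomial d n \<noteq> 0" using keys_edge_monomial[of d n] by force
    then show ?thesis unfolding mvar_mult_mvar by (simp add: lookup_single)
  qed
  then have "\<forall>i. tensor_bdry (cone ?f K) i = 0\<^sub>m (rk (cone ?f K) i) (rk (cone ?f K) (Suc i))"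
    by (intro allI cone_minimal[OF K(1) _ K(2)])
  \<comment> \<open>The generators added to term \<open>i\<close> come from term
    \<open>i - 1\<close>, and their shift by 2 restores the value \<open>2 * i\<close>.\<close>
  moreover have "\<forall>i. \<forall>a \<in> set (shifts (cone ?f K) i). a = 2 * int i"
  proof (intro allI ballI)
    fix i a assume "a \<in> set (shifts (cone ?f K) i)"
    then show "a = 2 * int i" by (cases i) (auto simp: cone_simps dest!: K(3))
  qed
  \<comment> \<open>The rank at \<open>i\<close> is the sum of the old ranks at \<open>i\<close> and
    \<open>i - 1\<close>, so the last nonzero term moves up by exactly one.\<close>
  moreover have "\<forall>i. rk (cone ?f K) i > 0 \<longleftrightarrow> i \<le> Suc n"
  proof
    fix i show "rk (cone ?f K) i > 0 \<longleftrightarrow> i \<le> Suc n"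
      using K(4)[of i] K(4)[of "i - 1"] by (cases i) (auto simp: cone_simps rk_def)
  qed
  ultimately show ?case by blast
qed

lemma regularity_matching_ideal:
  assumes "n \<le> d" and V: "{..<n} \<union> {d..<d + n} \<subseteq> V"
  shows "regularity V (matching_ideal d V n :: (nat, 'k::field) mpoly set) = int n"
proof -
  let ?I = "matching_ideal d V n :: (nat, 'k) mpoly set"
  from koszul_resolution[OF assms] obtain K :: "(nat, 'k) free_complex" where
    K: "graded_free_resolution V ?I K"
      "\<And>i. tensor_bdry K i = 0\<^sub>m (rk K i) (rk K (Suc i))"
      "\<And>i a. a \<in> set (shifts K i) \<Longrightarrow> a = 2 * int i" "\<And>i. rk K i > 0 \<longleftrightarrow> i \<le> n"
    by blast
  \<comment> \<open>The explicit resolution shows that the choice in \<open>tor\<close> is made from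
    a nonempty collection; the chosen \<open>F\<close> is then compared with
    \<open>K\<close>.\<close>
  from K(1) have F: "graded_free_resolution V ?I (SOME F. graded_free_resolution V ?I F)"
    by (rule someI)
  have nth: "shifts K i ! a = 2 * int i" if "a < rk K i" for i a
    using that K(3) by (simp add: rk_def)
  have strand: "tensor_strand K i j \<subseteq> {0\<^sub>v (rk K i)} \<longleftrightarrow> \<not> (i \<le> n \<and> j = 2 * int i)" for i j
  proof
    assume "\<not> (i \<le> n \<and> j = 2 * int i)"
    then have "v $ a = 0" if "v \<in> tensor_strand K i j" "a < rk K i" for v a
      using tensor_strandD(2)[OF that] nth[OF that(2)] K(4)[of i] that(2) by force
    then show "tensor_strand K i j \<subseteq> {0\<^sub>v (rk K i)}"
      by (auto dest: tensor_strandD(1) intro!: eq_vecI)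
  next
    assume sub: "tensor_strand K i j \<subseteq> {0\<^sub>v (rk K i)}"
    show "\<not> (i \<le> n \<and> j = 2 * int i)"
    proof
      assume ij: "i \<le> n \<and> j = 2 * int i"
      then have "unit_vec (rk K i) 0 \<in> tensor_strand K i j"
        using nth by (auto simp: tensor_strand_def)
      with sub have "unit_vec (rk K i) 0 = (0\<^sub>v (rk K i) :: 'k vec)" by blast
      then have "unit_vec (rk K i) 0 $ 0 = (0 :: 'k)" using K(4)[of i] ij by simp
      then show False using K(4)[of i] ij by simp
    qed
  qed
  \<comment> \<open>The strand at \<open>i\<close> lives in internal degree
    \<open>2 * i = i + j\<close>, hence \<open>j = i\<close>, and every \<open>i\<close> up to
    \<open>n\<close> occurs.\<close>
  have "{j. \<exists>i. \<not> trivial_group (tor V ?I i (int i + j))} = int ` {..n}"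
    unfolding tor_def minimal_resolution_tor[OF matching_ideal_hom F K(1,2)] strand by auto
  moreover have "Max (int ` {..n}) = int n"
    by (rule Max_eqI) auto
  ultimately show ?thesis by (simp add: regularity_def)
qed

section \<open>The edge ideal in terms of supports\<close>

lemma ideal_poly_ring:
  assumes "I \<subseteq> carrier (poly_ring V)" "0 \<in> I" "\<And>p q. p \<in> I \<Longrightarrow> q \<in> I \<Longrightarrow> p + q \<in> I"
    and mult: "\<And>p q. p \<in> I \<Longrightarrow> q \<in> carrier (poly_ring V) \<Longrightarrow> q * p \<in> I"
  shows "ideal I (poly_ring V)"
proof -
  interpret cring "poly_ring V" by (rule cring_poly_ring)
  have inv: "\<ominus>\<^bsub>poly_ring V\<^esub> p = - p" if "p \<in> carrier (poly_ring V)" for p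
    using that by (intro minus_equality) (auto intro: poly_ring_uminus)
  have "\<ominus>\<^bsub>poly_ring V\<^esub> p \<in> I" if "p \<in> I" for p
    using mult[OF that poly_ring_uminus[OF poly_ring_one]] inv[OF subsetD[OF assms(1) that]] by simp
  then have "subgroup I (add_monoid (poly_ring V))"
    using assms(1-3) inv by (intro add.subgroupI) (auto simp: a_inv_def[symmetric])
  then show ?thesis
    using mult by (intro idealI[OF ring_axioms]) (auto simp: mult.commute)
qed

text \<open>Peeling off the last edge with \<open>matching_ideal_Suc\<close> expresses every element
  of the monomial ideal by generators; the other inclusion is minimality of the generated
  ideal.\<close>

lemma edge_ideal_matching_graph:
  assumes "1 \<le> r" "r \<le> d"
  shows "edge_ideal (matching_graph d r) = (matching_ideal d {..<d + r} r :: (nat, 'k::field) mpoly set)"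
proof -
  let ?V = "{..<d + r}"
  let ?R = "poly_ring ?V :: (nat, 'k) mpoly ring"
  let ?S = "{mvar x * mvar y | x y. (x, y) \<in> parcs (matching_graph d r)} :: (nat, 'k) mpoly set"
  let ?I = "matching_ideal d ?V r :: (nat, 'k) mpoly set"
  interpret R: cring ?R by (rule cring_poly_ring)
  \<comment> \<open>The two arcs of an edge give the same product, so one generator per edge
    remains.\<close>
  have S: "?S = (\<lambda>i. mvar i * mvar (d + i)) ` {..<r}"
    by (force simp: mult.commute)
  have I: "ideal ?I ?R"
    by (rule ideal_poly_ring) (use hom_idealD[OF matching_ideal_hom] in blast)+
  have SI: "?S \<subseteq> ?I"
    unfolding S mvar_mult_mvar matching_ideal_def using assms
    by (auto simp: keys_edge_monomial in_edges_def intro!: poly_ring_single)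
  have SR: "?S \<subseteq> carrier ?R"
    using SI hom_idealD(1)[OF matching_ideal_hom] by (rule order_trans)
  interpret J: ideal "genideal ?R ?S" ?R by (rule R.genideal_ideal[OF SR])
  have "?I \<subseteq> genideal ?R ?S"
  proof
    fix p assume p: "p \<in> ?I"
    have "p \<in> genideal ?R ?S" if "p \<in> matching_ideal d ?V n" "n \<le> r" for n and p :: "(nat, 'k) mpoly"
      using that
    proof (induction n arbitrary: p)
      case 0
      then have "p = 0" by (auto simp: matching_ideal_def in_edges_def)
      then show ?case using J.zero_closed by simp
    next
      case (Suc n)
      then have n: "n < d" "n \<in> ?V" "d + n \<in> ?V" using assms by auto
      from Suc.prems(1) obtain a q where a: "p = a + mvar n * mvar (d + n) * q"
        "a \<in> matching_ideal d ?V n" "q \<in> carrier ?R"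
        unfolding matching_ideal_Suc[OF n] by blast
      have "mvar n * mvar (d + n) \<in> genideal ?R ?S"
        using R.genideal_self[OF SR] Suc.prems(2) unfolding S by auto
      then have "mvar n * mvar (d + n) * q \<in> genideal ?R ?S"
        using J.I_r_closed[OF _ a(3)] by simp
      moreover have "a \<in> genideal ?R ?S" using Suc a by auto
      ultimately show ?case unfolding a(1) using J.a_closed by fastforce
    qed
    from this[OF p] show "p \<in> genideal ?R ?S" by simp
  qed
  moreover have "genideal ?R ?S \<subseteq> ?I" by (rule R.genideal_minimal[OF I SI])
  ultimately show ?thesis unfolding edge_ideal_def by simp
qed

section \<open>Krull dimension\<close>

lemma primeideal_polyD:
  assumes "primeideal P (poly_ring V)"
  shows "P \<subseteq> carrier (poly_ring V)" "0 \<in> P" "\<And>p q. p \<in> P \<Longrightarrow> q \<in> P \<Longrightarrow> p + q \<in> P"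
    "\<And>p q. p \<in> P \<Longrightarrow> q \<in> carrier (poly_ring V) \<Longrightarrow> q * p \<in> P"
    "\<And>p q. p \<in> P \<Longrightarrow> q \<in> P \<Longrightarrow> p - q \<in> P"
    "1 \<notin> P"
    "\<And>p q. p \<in> carrier (poly_ring V) \<Longrightarrow> q \<in> carrier (poly_ring V) \<Longrightarrow> p * q \<in> P \<Longrightarrow> p \<in> P \<or> q \<in> P"
proof -
  interpret primeideal P "poly_ring V" by (rule assms)
  show sub: "P \<subseteq> carrier (poly_ring V)" using a_subset .
  show "0 \<in> P" using additive_subgroup.zero_closed[OF is_additive_subgroup] by simp
  show add: "p + q \<in> P" if "p \<in> P" "q \<in> P" for p q
    using additive_subgroup.a_closed[OF is_additive_subgroup that] by simp
  show mult: "q * p \<in> P" if "p \<in> P" "q \<in> carrier (poly_ring V)" for p q using I_l_closed[OF that] by simp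
  show "p - q \<in> P" if "p \<in> P" "q \<in> P" for p q
    using add[OF that(1) mult[OF that(2) poly_ring_uminus[OF poly_ring_one]]] by simp
  show "1 \<notin> P"
    using one_imp_carrier I_notcarr by auto
  show "p \<in> P \<or> q \<in> P" if "p \<in> carrier (poly_ring V)" "q \<in> carrier (poly_ring V)" "p * q \<in> P" for p q
    using I_prime[of p q] that by simp
qed

lemma primeideal_sum:
  assumes P: "primeideal P (poly_ring V)"
  shows "(\<And>a. a \<in> A \<Longrightarrow> f a \<in> P) \<Longrightarrow> sum f A \<in> P"
  by (induction A rule: infinite_finite_induct) (auto intro: primeideal_polyD(2,3)[OF P])

lemma primeideal_power_cancel:
  assumes P: "primeideal P (poly_ring V)" and x: "x \<in> carrier (poly_ring V)" "x \<notin> P"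
    and q: "q \<in> carrier (poly_ring V)" "x ^ n * q \<in> P"
  shows "q \<in> P"
  using q(2)
proof (induction n)
  case (Suc n)
  then have "x * (x ^ n * q) \<in> P" by (simp add: mult.assoc)
  with primeideal_polyD(7)[OF P x(1)] x(2) have "x ^ n * q \<in> P"
    by (metis poly_ring_mult poly_ring_power x(1) q(1))
  with Suc.IH show ?case by blast
qed simp

lemma sum_filter_split:
  "finite A \<Longrightarrow> sum f A = sum f {a \<in> A. P a} + sum f {a \<in> A. \<not> P a}"
  for f :: "'a \<Rightarrow> 'b::comm_monoid_add"
proof -
  assume "finite A"
  then have "sum f ({a \<in> A. P a} \<union> {a \<in> A. \<not> P a}) = sum f {a \<in> A. P a} + sum f {a \<in> A. \<not> P a}"
    by (intro sum.union_disjoint) auto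
  moreover have "{a \<in> A. P a} \<union> {a \<in> A. \<not> P a} = A" by blast
  ultimately show ?thesis by simp
qed

text \<open>The easy half of the Coquand-Lombardi characterisation of the Krull dimension: one divides
  out the lexicographically smallest power product, one variable at a time.\<close>

lemma chain_not_dependent:
  fixes x :: "nat \<Rightarrow> ('v, 'k::field) mpoly"
  assumes prime: "\<And>i. i \<le> l \<Longrightarrow> primeideal (Q i) (poly_ring V)"
    and chain: "\<And>i. i < l \<Longrightarrow> Q i \<subseteq> Q (Suc i)"
    and x: "\<And>i. i < l \<Longrightarrow> x i \<in> Q (Suc i)" "\<And>i. i < l \<Longrightarrow> x i \<notin> Q i"
    and E: "finite E" "E \<noteq> {}" "\<And>e. e \<in> E \<Longrightarrow> c e \<noteq> 0"
      "\<And>e e'. e \<in> E \<Longrightarrow> e' \<in> E \<Longrightarrow> (\<And>i. i < l \<Longrightarrow> e i = e' i) \<Longrightarrow> e = e'"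
  shows "(\<Sum>e\<in>E. Poly_Mapping.single 0 (c e) * (\<Prod>i\<in>{0..<l}. x i ^ e i)) \<notin> Q 0"
proof
  assume Q0: "(\<Sum>e\<in>E. Poly_Mapping.single 0 (c e) * (\<Prod>i\<in>{0..<l}. x i ^ e i)) \<in> Q 0"
  let ?C = "\<lambda>e. Poly_Mapping.single 0 (c e) :: ('v, 'k) mpoly"
  have C: "?C e \<in> carrier (poly_ring V)" for e by (rule poly_ring_single) simp
  have xV: "x i \<in> carrier (poly_ring V)" if "i < l" for i
    using x(1)[OF that] primeideal_polyD(1)[OF prime[of "Suc i"]] that by auto
  have prodV: "(\<Prod>i\<in>{k..<l}. x i ^ e i) \<in> carrier (poly_ring V)" for k e
    by (intro poly_ring_prod poly_ring_power) (auto intro: xV)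
  \<comment> \<open>Invariant: \<open>E'\<close> keeps the exponent vectors agreeing below
    \<open>k\<close>, and the powers of the first \<open>k\<close> elements have been divided out,
    with the remaining sum in \<open>Q k\<close>.\<close>
  have "k \<le> l \<Longrightarrow> \<exists>E'\<subseteq>E. E' \<noteq> {} \<and> (\<forall>e\<in>E'. \<forall>e'\<in>E'. \<forall>i<k. e i = e' i) \<and>
      (\<Sum>e\<in>E'. ?C e * (\<Prod>i\<in>{k..<l}. x i ^ e i)) \<in> Q k" for k
  proof (induction k)
    case 0
    show ?case using E(2) Q0 by (intro exI[of _ E]) auto
  next
    case (Suc k)
    then obtain E' where E': "E' \<subseteq> E" "E' \<noteq> {}" "\<forall>e\<in>E'. \<forall>e'\<in>E'. \<forall>i<k. e i = e' i"
      "(\<Sum>e\<in>E'. ?C e * (\<Prod>i\<in>{k..<l}. x i ^ e i)) \<in> Q k" by auto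
    have k: "k < l" using Suc.prems by simp
    have fin: "finite E'" using E'(1) E(1) by (rule finite_subset)
    define m where "m = Min ((\<lambda>e. e k) ` E')"
    have m_le: "m \<le> e k" if "e \<in> E'" for e unfolding m_def using fin that by simp
    have "m \<in> (\<lambda>e. e k) ` E'" unfolding m_def using fin E'(2) by (intro Min_in) auto
    then obtain e0 where e0: "e0 \<in> E'" "e0 k = m" by auto
    let ?T = "\<lambda>e. ?C e * (\<Prod>i\<in>{Suc k..<l}. x i ^ e i)"
    have TV: "?T e \<in> carrier (poly_ring V)" for e
      by (rule poly_ring_mult[OF C prodV])
    have split: "?C e * (\<Prod>i\<in>{k..<l}. x i ^ e i) = x k ^ m * (x k ^ (e k - m) * ?T e)" if "e \<in> E'" for e
    proof -
      have "x k ^ e k = x k ^ m * x k ^ (e k - m)" using m_le[OF that] by (simp flip: power_add)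
      moreover have "(\<Prod>i\<in>{k..<l}. x i ^ e i) = x k ^ e k * (\<Prod>i\<in>{Suc k..<l}. x i ^ e i)"
        by (rule prod.atLeast_Suc_lessThan[OF k])
      ultimately show ?thesis by (simp only: ac_simps)
    qed
    have eq: "(\<Sum>e\<in>E'. ?C e * (\<Prod>i\<in>{k..<l}. x i ^ e i)) = x k ^ m * (\<Sum>e\<in>E'. x k ^ (e k - m) * ?T e)"
      unfolding sum_distrib_left using split by (rule sum.cong[OF refl])
    have "x k ^ m * (\<Sum>e\<in>E'. x k ^ (e k - m) * ?T e) \<in> Q k" using E'(4) unfolding eq .
    moreover have "(\<Sum>e\<in>E'. x k ^ (e k - m) * ?T e) \<in> carrier (poly_ring V)"
      by (intro poly_ring_sum poly_ring_mult[OF poly_ring_power TV] xV k)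
    \<comment> \<open>Since \<open>x k\<close> lies outside the prime \<open>Q k\<close>, its lowest
      common power can be cancelled.\<close>
    ultimately have "(\<Sum>e\<in>E'. x k ^ (e k - m) * ?T e) \<in> Q k"
      using primeideal_power_cancel[OF prime xV x(2)] k by simp
    then have 1: "(\<Sum>e\<in>E'. x k ^ (e k - m) * ?T e) \<in> Q (Suc k)" using chain[OF k] by blast
    have PS: "primeideal (Q (Suc k)) (poly_ring V)" using prime k by simp
    \<comment> \<open>A term still containing a factor \<open>x k\<close> lies in the next prime;
      removing these terms fixes the exponent at \<open>k\<close> for the survivors.\<close>
    have 2: "(\<Sum>e\<in>{e \<in> E'. \<not> e k = m}. x k ^ (e k - m) * ?T e) \<in> Q (Suc k)"
    proof (rule primeideal_sum[OF PS])
      fix e assume "e \<in> {e \<in> E'. \<not> e k = m}"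
      then have "0 < e k - m" using m_le[of e] by auto
      then obtain j where j: "e k - m = Suc j" using gr0_implies_Suc by blast
      have "x k ^ (e k - m) * ?T e = (x k ^ j * ?T e) * x k"
        unfolding j power_Suc by (simp only: ac_simps)
      also have "\<dots> \<in> Q (Suc k)"
        by (intro primeideal_polyD(4)[OF PS] x(1) k poly_ring_mult[OF poly_ring_power TV] xV)
      finally show "x k ^ (e k - m) * ?T e \<in> Q (Suc k)" .
    qed
    have "(\<Sum>e\<in>{e \<in> E'. e k = m}. ?T e) = (\<Sum>e\<in>{e \<in> E'. e k = m}. x k ^ (e k - m) * ?T e)"
      by (rule sum.cong) auto
    also have "\<dots> = (\<Sum>e\<in>E'. x k ^ (e k - m) * ?T e) - (\<Sum>e\<in>{e \<in> E'. \<not> e k = m}. x k ^ (e k - m) * ?T e)"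
      using sum_filter_split[OF fin, of "\<lambda>e. x k ^ (e k - m) * ?T e" "\<lambda>e. e k = m"] by simp
    also have "\<dots> \<in> Q (Suc k)" by (rule primeideal_polyD(5)[OF PS 1 2])
    finally have "(\<Sum>e\<in>{e \<in> E'. e k = m}. ?T e) \<in> Q (Suc k)" .
    moreover have "\<forall>e\<in>{e \<in> E'. e k = m}. \<forall>e'\<in>{e \<in> E'. e k = m}. \<forall>i<Suc k. e i = e' i"
      using E'(3) by (auto simp: less_Suc_eq)
    ultimately show ?case
      using E'(1) e0 by (intro exI[of _ "{e \<in> E'. e k = m}"]) auto
  qed
  from this[OF order_refl] obtain E' where E': "E' \<subseteq> E" "E' \<noteq> {}" "\<forall>e\<in>E'. \<forall>e'\<in>E'. \<forall>i<l. e i = e' i"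
    "(\<Sum>e\<in>E'. ?C e * (\<Prod>i\<in>{l..<l}. x i ^ e i)) \<in> Q l" by blast
  from E'(2) obtain e where e: "e \<in> E'" by blast
  \<comment> \<open>All coordinates are now fixed, so one term is left and all its factors have been
    removed: the proper ideal \<open>Q l\<close> contains a nonzero constant.\<close>
  have "E' = {e}" using e E'(1,3) E(4) by blast
  with E'(4) have "?C e \<in> Q l" by simp
  note Pl = prime[OF order_refl]
  have "Poly_Mapping.single 0 (inverse (c e)) * ?C e \<in> Q l"
    by (rule primeideal_polyD(4)[OF Pl \<open>?C e \<in> Q l\<close>]) (rule poly_ring_single, simp)
  moreover have "c e \<noteq> 0" using E(3) e E'(1) by blast
  ultimately have "1 \<in> Q l" by (simp add: mult_single)
  then show False using primeideal_polyD(6)[OF Pl] by blast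
qed

section \<open>Algebraic dependence by counting\<close>

text \<open>Exponents are bounded separately, not in total degree, because the monomials then form a
  box whose size is immediate.\<close>

definition exponents_le :: "nat \<Rightarrow> ('v, 'k::field) mpoly \<Rightarrow> bool"
  where "exponents_le B p \<longleftrightarrow> (\<forall>m\<in>Poly_Mapping.keys p. \<forall>v. Poly_Mapping.lookup m v \<le> B)"

lemma exponents_le_mult: "exponents_le A p \<Longrightarrow> exponents_le B q \<Longrightarrow> exponents_le (A + B) (p * q)"
  by (auto simp: exponents_le_def lookup_add add_mono elim!: keys_multE)

lemma exponents_le_power:
  assumes "exponents_le B p"
  shows "exponents_le (n * B) (p ^ n)"
proof (induction n)
  case 0
  show ?case by (simp add: exponents_le_def)
next
  case (Suc n)
  from exponents_le_mult[OF assms Suc] show ?case by simp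
qed

lemma exponents_le_prod:
  "finite A \<Longrightarrow> (\<And>a. a \<in> A \<Longrightarrow> exponents_le B (f a)) \<Longrightarrow> exponents_le (card A * B) (prod f A)"
proof (induction A rule: finite_induct)
  case empty
  then show ?case by (simp add: exponents_le_def)
next
  case (insert a A)
  then have "exponents_le (B + card A * B) (f a * prod f A)" by (intro exponents_le_mult) auto
  with insert show ?case by simp
qed

lemma exponents_le_mono: "exponents_le A p \<Longrightarrow> A \<le> B \<Longrightarrow> exponents_le B p"
  by (meson exponents_le_def order_trans)

lemma exponents_le_exists: "\<exists>B. exponents_le B p"
proof -
  have "finite (\<Union>m\<in>Poly_Mapping.keys p. Poly_Mapping.lookup m ` Poly_Mapping.keys m)" by simp
  then obtain B where B: "\<And>b. b \<in> (\<Union>m\<in>Poly_Mapping.keys p. Poly_Mapping.lookup m ` Poly_Mapping.keys m) \<Longrightarrow> b \<le> B"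
    unfolding finite_nat_set_iff_bounded_le by blast
  have "Poly_Mapping.lookup m v \<le> B" if "m \<in> Poly_Mapping.keys p" for m v
  proof (cases "v \<in> Poly_Mapping.keys m")
    case True
    with that show ?thesis by (intro B) blast
  qed (simp add: in_keys_iff)
  then show ?thesis unfolding exponents_le_def by blast
qed

definition bounded_monomials :: "'v set \<Rightarrow> nat \<Rightarrow> ('v \<Rightarrow>\<^sub>0 nat) set"
  where "bounded_monomials W B = {m. Poly_Mapping.keys m \<subseteq> W \<and> (\<forall>v. Poly_Mapping.lookup m v \<le> B)}"

lemma card_bounded_monomials:
  assumes W: "finite W"
  shows "finite (bounded_monomials W B)" "card (bounded_monomials W B) \<le> Suc B ^ card W"
proof -
  \<comment> \<open>Exponents outside \<open>W\<close> are zero, so nothing is lost by restriction,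
    and extensional functions are counted by \<open>card_PiE\<close>.\<close>
  let ?f = "\<lambda>m. restrict (Poly_Mapping.lookup m) W :: _ \<Rightarrow> nat"
  have inj: "inj_on ?f (bounded_monomials W B)"
  proof (rule inj_onI)
    fix m m' assume m: "m \<in> bounded_monomials W B" "m' \<in> bounded_monomials W B" and eq: "?f m = ?f m'"
    show "m = m'"
    proof (rule poly_mapping_eqI)
      fix v show "Poly_Mapping.lookup m v = Poly_Mapping.lookup m' v"
      proof (cases "v \<in> W")
        case True
        then show ?thesis using fun_cong[OF eq, of v] by simp
      next
        case False
        then have "v \<notin> Poly_Mapping.keys m" "v \<notin> Poly_Mapping.keys m'"
          using m by (auto simp: bounded_monomials_def)
        then show ?thesis by (simp add: in_keys_iff)
      qed
    qed
  qed
  have im: "?f ` bounded_monomials W B \<subseteq> W \<rightarrow>\<^sub>E {..B}"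
    by (auto simp: bounded_monomials_def)
  have fin: "finite (W \<rightarrow>\<^sub>E {..B})" using W by (intro finite_PiE) auto
  show "finite (bounded_monomials W B)"
    using finite_subset[OF im fin] inj by (rule finite_imageD)
  have "card (bounded_monomials W B) \<le> card (W \<rightarrow>\<^sub>E {..B})"
    by (rule card_inj_on_le[OF inj im fin])
  also have "\<dots> = Suc B ^ card W" using W by (simp add: card_PiE)
  finally show "card (bounded_monomials W B) \<le> Suc B ^ card W" .
qed

text \<open>There are \<open>N ^ l\<close> power products with exponents below \<open>N\<close>,
  while the monomials occurring in them number at most a constant times \<open>N ^ card W\<close>.
  For large \<open>N\<close> the exponent \<open>l > card W\<close> wins.\<close>

lemma algebraically_dependent:
  fixes x :: "nat \<Rightarrow> ('v, 'k::field) mpoly"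
  assumes W: "finite W" "card W < l" and x: "\<And>i. i < l \<Longrightarrow> x i \<in> carrier (poly_ring W)"
  shows "\<exists>E c. finite E \<and> E \<noteq> {} \<and> E \<subseteq> {0..<l} \<rightarrow>\<^sub>E UNIV \<and> (\<forall>e\<in>E. c e \<noteq> 0) \<and>
    (\<Sum>e\<in>E. Poly_Mapping.single 0 (c e) * (\<Prod>i\<in>{0..<l}. x i ^ e i)) = 0"
proof -
  interpret vs: vector_space "\<lambda>(c::'k) (p::('v, 'k) mpoly). Poly_Mapping.single 0 c * p"
    by unfold_locales (auto simp: algebra_simps single_add mult_single mult.assoc[symmetric])
  obtain D where D: "\<And>i. i < l \<Longrightarrow> exponents_le D (x i)"
  proof -
    have "\<exists>b. \<forall>i. exponents_le (b i) (x i)" by (intro choice allI exponents_le_exists)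
    then obtain b where b: "\<And>i. exponents_le (b i) (x i)" by blast
    have "exponents_le (Max (b ` {..<l})) (x i)" if "i < l" for i
      by (rule exponents_le_mono[OF b]) (use that in simp)
    then show thesis by (rule that)
  qed
  \<comment> \<open>Since \<open>1 + l * N * D\<close> is at most \<open>(l * D + 1) * N\<close>,
    the count of monomials is at most \<open>(l * D + 1) ^ card W * N ^ card W\<close>;
    \<open>N\<close> is chosen just larger than the first factor.\<close>
  define N where "N = Suc ((l * D + 1) ^ card W)"
  define B where "B = l * (N * D)"
  define g where "g e = (\<Prod>i\<in>{0..<l}. x i ^ e i)" for e :: "nat \<Rightarrow> nat"
  \<comment> \<open>Extensional functions make an exponent vector determined by its first
    \<open>l\<close> values, as \<open>chain_not_dependent\<close> requires.\<close>
  define Ex where "Ex = {0..<l} \<rightarrow>\<^sub>E {..<N}"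
  let ?T = "(\<lambda>m. Poly_Mapping.single m (1::'k)) ` bounded_monomials W B"
  have finEx: "finite Ex" unfolding Ex_def by (intro finite_PiE) auto
  have cardEx: "card Ex = N ^ l" unfolding Ex_def by (simp add: card_PiE)
  have finT: "finite ?T" using card_bounded_monomials(1)[OF W(1)] by simp
  have "card ?T \<le> Suc B ^ card W"
    using card_bounded_monomials[OF W(1), of B] card_image_le[of "bounded_monomials W B"] by (metis order_trans)
  also have "\<dots> \<le> ((l * D + 1) * N) ^ card W"
    by (intro power_mono) (auto simp: B_def N_def algebra_simps)
  also have "\<dots> = (l * D + 1) ^ card W * N ^ card W" by (rule power_mult_distrib)
  also have "\<dots> < N * N ^ card W" by (intro mult_strict_right_mono) (auto simp: N_def)
  also have "\<dots> = N ^ Suc (card W)" by simp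
  also have "\<dots> \<le> N ^ l" using W(2) by (intro power_increasing) (auto simp: N_def)
  finally have card_lt: "card ?T < card Ex" by (simp add: cardEx)
  have span: "g e \<in> vs.span ?T" if e: "e \<in> Ex" for e
  proof -
    have gW: "g e \<in> carrier (poly_ring W)"
      unfolding g_def by (intro poly_ring_prod poly_ring_power) (auto intro: x)
    have "exponents_le (card {0..<l} * (N * D)) (g e)"
      unfolding g_def
    proof (rule exponents_le_prod)
      fix i assume i: "i \<in> {0..<l}"
      then have "e i < N" using e by (auto simp: Ex_def)
      then have "e i * D \<le> N * D" by (intro mult_right_mono) auto
      with i show "exponents_le (N * D) (x i ^ e i)"
        by (intro exponents_le_mono[OF exponents_le_power[OF D]]) auto
    qed simp
    then have keys: "Poly_Mapping.keys (g e) \<subseteq> bounded_monomials W B"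
      using gW by (auto simp: exponents_le_def bounded_monomials_def mem_poly_ring B_def)
    have "g e = (\<Sum>m\<in>Poly_Mapping.keys (g e). Poly_Mapping.single 0 (Poly_Mapping.lookup (g e) m) * Poly_Mapping.single m 1)"
      using poly_eq_sum_single[of "g e"] by (simp add: mult_single)
    also have "\<dots> \<in> vs.span ?T"
      using keys by (intro vs.span_sum vs.span_scale vs.span_base) auto
    finally show ?thesis .
  qed
  show ?thesis
  proof (cases "inj_on g Ex")
    case True
    have "vs.dependent (g ` Ex)"
    proof (rule ccontr)
      assume "\<not> vs.dependent (g ` Ex)"
      then have "card (g ` Ex) \<le> card ?T"
        using vs.independent_span_bound[OF finT] span by blast
      then show False using card_lt by (simp add: card_image[OF True])
    qed
    then obtain u where u: "\<exists>v\<in>g ` Ex. u v \<noteq> 0" "(\<Sum>v\<in>g ` Ex. Poly_Mapping.single 0 (u v) * v) = 0"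
      using vs.dependent_finite[of "g ` Ex"] finEx by auto
    let ?E = "{e \<in> Ex. u (g e) \<noteq> 0}"
    have "(\<Sum>e\<in>?E. Poly_Mapping.single 0 (u (g e)) * g e) = (\<Sum>e\<in>Ex. Poly_Mapping.single 0 (u (g e)) * g e)"
      using finEx by (intro sum.mono_neutral_left) auto
    also have "\<dots> = 0" using u(2) by (simp add: sum.reindex[OF True])
    finally have "(\<Sum>e\<in>?E. Poly_Mapping.single 0 (u (g e)) * (\<Prod>i\<in>{0..<l}. x i ^ e i)) = 0"
      by (simp add: g_def)
    moreover have "?E \<noteq> {}" using u(1) by blast
    moreover have "?E \<subseteq> {0..<l} \<rightarrow>\<^sub>E UNIV" unfolding Ex_def by (auto simp: PiE_def)
    ultimately show ?thesis using finEx by (intro exI[of _ ?E] exI[of _ "\<lambda>e. u (g e)"]) auto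
  next
    case False
    then obtain e e' where e: "e \<in> Ex" "e' \<in> Ex" "e \<noteq> e'" "g e = g e'" by (auto simp: inj_on_def)
    \<comment> \<open>Linear dependence concerns the set of values of \<open>g\<close> and says
      nothing about coinciding values; two exponent vectors with the same power product give a
      relation by themselves.\<close>
    let ?c = "\<lambda>a. if a = e then 1 else - 1 :: 'k"
    have "(\<Sum>a\<in>{e, e'}. Poly_Mapping.single 0 (?c a) * g a) = 0"
      using e by (simp add: single_uminus)
    then show ?thesis
      using e unfolding Ex_def g_def
      by (intro exI[of _ "{e, e'}"] exI[of _ ?c]) (auto simp: PiE_def)
  qed
qed

section \<open>Chains of primes in the polynomial ring\<close>

text \<open>Modulo \<open>Q 0\<close> only the variables in \<open>W\<close> survive, so elements
  witnessing strict inclusions may be taken in \<open>card W\<close> variables. More than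
  \<open>card W\<close> of them would satisfy a relation, against
  \<open>chain_not_dependent\<close>.\<close>

lemma prime_chain_length_le:
  fixes Q :: "nat \<Rightarrow> ('v, 'k::field) mpoly set"
  assumes prime: "\<And>i. i \<le> n \<Longrightarrow> primeideal (Q i) (poly_ring V)"
    and chain: "\<And>i. i < n \<Longrightarrow> Q i \<subset> Q (Suc i)"
    and W: "finite W" "W \<subseteq> V" "\<And>v. v \<in> V - W \<Longrightarrow> mvar v \<in> Q 0"
  shows "n \<le> card W"
proof (rule ccontr)
  assume n: "\<not> n \<le> card W"
  let ?\<pi> = "mon_filter (\<lambda>m. Poly_Mapping.keys m \<subseteq> W) :: ('v, 'k) mpoly \<Rightarrow> _"
  note P0 = prime[of 0, simplified]
  have Q0: "Q 0 \<subseteq> Q i" if "i \<le> n" for i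
    using that
  proof (induction i)
    case (Suc i)
    then show ?case using chain[of i] by auto
  qed simp
  \<comment> \<open>Every monomial removed by the projection contains a variable outside
    \<open>W\<close>, and that variable lies in \<open>Q 0\<close>.\<close>
  have kill: "y - ?\<pi> y \<in> Q 0" if y: "y \<in> carrier (poly_ring V)" for y
  proof -
    let ?z = "mon_filter (\<lambda>m. \<not> Poly_Mapping.keys m \<subseteq> W) y"
    have "y - ?\<pi> y = ?z"
      using mon_filter_split[of y "\<lambda>m. Poly_Mapping.keys m \<subseteq> W"] by (metis add_diff_cancel_left')
    also have "\<dots> = (\<Sum>m\<in>Poly_Mapping.keys ?z. Poly_Mapping.single m (Poly_Mapping.lookup ?z m))"
      by (rule poly_eq_sum_single)
    also have "\<dots> \<in> Q 0"
    proof (rule primeideal_sum[OF P0])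
      fix m assume "m \<in> Poly_Mapping.keys ?z"
      then have m: "m \<in> Poly_Mapping.keys y" "\<not> Poly_Mapping.keys m \<subseteq> W" by (auto simp: keys_mon_filter)
      then obtain v where v: "v \<in> Poly_Mapping.keys m" "v \<notin> W" by blast
      have mV: "Poly_Mapping.keys m \<subseteq> V" using y m by (simp add: mem_poly_ring)
      let ?m' = "m - Poly_Mapping.single v 1"
      have "m = ?m' + Poly_Mapping.single v 1"
        using v(1) by (intro poly_mapping_eqI) (auto simp: lookup_add lookup_minus lookup_single when_def in_keys_iff)
      then have "Poly_Mapping.single m (Poly_Mapping.lookup ?z m) = Poly_Mapping.single ?m' (Poly_Mapping.lookup ?z m) * mvar v"
        by (simp add: mvar_def mult_single)
      also have "\<dots> \<in> Q 0"
      proof (rule primeideal_polyD(4)[OF P0])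
        show "mvar v \<in> Q 0" using v mV W(3) by blast
        have "Poly_Mapping.keys ?m' \<subseteq> Poly_Mapping.keys m" by (auto simp: in_keys_iff lookup_minus)
        then show "Poly_Mapping.single ?m' (Poly_Mapping.lookup ?z m) \<in> carrier (poly_ring V)"
          using mV by (intro poly_ring_single) auto
      qed
      finally show "Poly_Mapping.single m (Poly_Mapping.lookup ?z m) \<in> Q 0" .
    qed
    finally show ?thesis .
  qed
  \<comment> \<open>One inclusion more than there are variables already suffices for a
    contradiction; the rest of the chain is ignored.\<close>
  define l where "l = Suc (card W)"
  have l: "l \<le> n" using n by (simp add: l_def)
  have "\<exists>y. y \<in> Q (Suc i) \<and> y \<notin> Q i" if "i < n" for i using chain[OF that] by blast
  then obtain y where y: "\<And>i. i < n \<Longrightarrow> y i \<in> Q (Suc i)" "\<And>i. i < n \<Longrightarrow> y i \<notin> Q i" by metis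
  have yV: "y i \<in> carrier (poly_ring V)" if "i < n" for i
    using y(1)[OF that] primeideal_polyD(1)[OF prime[of "Suc i"]] that by auto
  \<comment> \<open>Changing \<open>y i\<close> by an element of \<open>Q 0\<close>, which is
    contained in all \<open>Q i\<close>, affects neither membership in \<open>Q (Suc i)\<close> nor
    non-membership in \<open>Q i\<close>.\<close>
  define x where "x i = ?\<pi> (y i)" for i
  have xW: "x i \<in> carrier (poly_ring W)" for i
    by (auto simp: x_def mem_poly_ring keys_mon_filter)
  have x1: "x i \<in> Q (Suc i)" if "i < n" for i
  proof -
    have "y i - ?\<pi> (y i) \<in> Q (Suc i)" using kill[OF yV[OF that]] Q0[of "Suc i"] that by auto
    then have "y i - (y i - ?\<pi> (y i)) \<in> Q (Suc i)"
      by (rule primeideal_polyD(5)[OF prime[OF Suc_leI[OF that]] y(1)[OF that]])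
    then show ?thesis by (simp add: x_def)
  qed
  have x2: "x i \<notin> Q i" if "i < n" for i
  proof
    assume "x i \<in> Q i"
    moreover have "y i - ?\<pi> (y i) \<in> Q i" using kill[OF yV[OF that]] Q0[of i] that by auto
    ultimately have "(y i - ?\<pi> (y i)) + x i \<in> Q i"
      using that by (intro primeideal_polyD(3)[OF prime]) auto
    then show False using y(2)[OF that] by (simp add: x_def)
  qed
  from algebraically_dependent[OF W(1), of l x] xW obtain E c where
    E: "finite E" "E \<noteq> {}" "E \<subseteq> {0..<l} \<rightarrow>\<^sub>E UNIV" "\<forall>e\<in>E. c e \<noteq> 0"
      "(\<Sum>e\<in>E. Poly_Mapping.single 0 (c e) * (\<Prod>i\<in>{0..<l}. x i ^ e i)) = (0 :: ('v, 'k) mpoly)"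
    by (auto simp: l_def)
  have "(\<Sum>e\<in>E. Poly_Mapping.single 0 (c e) * (\<Prod>i\<in>{0..<l}. x i ^ e i)) \<notin> Q 0"
  proof (rule chain_not_dependent[where V = V])
    show "e = e'" if "e \<in> E" "e' \<in> E" "\<And>i. i < l \<Longrightarrow> e i = e' i" for e e'
      using that E(3) by (intro PiE_ext[of e "{0..<l}" "\<lambda>_. UNIV" e']) auto
    show "Q i \<subseteq> Q (Suc i)" if "i < l" for i using chain[of i] l that by auto
  qed (use prime x1 x2 E l in auto)
  then show False using E(5) primeideal_polyD(2)[OF P0] by simp
qed

section \<open>Prime ideals generated by variables\<close>

definition variable_ideal :: "'v set \<Rightarrow> 'v set \<Rightarrow> ('v, 'k::field) mpoly set"
  where "variable_ideal V U = {p \<in> carrier (poly_ring V). \<forall>m\<in>Poly_Mapping.keys p. Poly_Mapping.keys m \<inter> U \<noteq> {}}"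

lemma variable_ideal_mono: "U \<subseteq> U' \<Longrightarrow> variable_ideal V U \<subseteq> variable_ideal V U'"
  unfolding variable_ideal_def by blast

text \<open>The ideal is the kernel of setting the variables in \<open>U\<close> to zero, a
  multiplicative map into a ring without zero divisors.\<close>

lemma primeideal_variable_ideal:
  "primeideal (variable_ideal V U) (poly_ring V :: (nat, 'k::field) mpoly ring)"
proof (rule primeidealI)
  let ?I = "variable_ideal V U :: (nat, 'k) mpoly set"
  let ?\<pi> = "mon_filter (\<lambda>m. Poly_Mapping.keys m \<inter> U = {}) :: (nat, 'k) mpoly \<Rightarrow> _"
  show "ideal ?I (poly_ring V)"
  proof (rule ideal_poly_ring)
    show "p + q \<in> ?I" if "p \<in> ?I" "q \<in> ?I" for p q
      using that keys_add[of p q] by (auto simp: variable_ideal_def poly_ring_add)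
    show "q * p \<in> ?I" if "p \<in> ?I" "q \<in> carrier (poly_ring V)" for p q
      using that by (auto simp: variable_ideal_def poly_ring_mult keys_add_nat Int_Un_distrib2 elim!: keys_multE)
  qed (auto simp: variable_ideal_def poly_ring_zero)
  show "cring (poly_ring V :: (nat, 'k) mpoly ring)" by (rule cring_poly_ring)
  have "1 \<notin> ?I" by (simp add: variable_ideal_def)
  then show "carrier (poly_ring V) \<noteq> ?I" using poly_ring_one by blast
  have mem: "p \<in> ?I \<longleftrightarrow> ?\<pi> p = 0" if "p \<in> carrier (poly_ring V)" for p
  proof -
    have "?\<pi> p = 0 \<longleftrightarrow> Poly_Mapping.keys (?\<pi> p) = {}" by simp
    then show ?thesis using that by (auto simp: variable_ideal_def keys_mon_filter simp del: keys_eq_empty)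
  qed
  fix p q :: "(nat, 'k) mpoly"
  assume pq: "p \<in> carrier (poly_ring V)" "q \<in> carrier (poly_ring V)" "p \<otimes>\<^bsub>poly_ring V\<^esub> q \<in> ?I"
  have "?\<pi> p * ?\<pi> q = ?\<pi> (p * q)"
    by (rule mon_filter_mult_hom[symmetric]) (auto simp: keys_add_nat)
  also have "\<dots> = 0" using mem[OF poly_ring_mult[OF pq(1,2)]] pq(3) by simp
  finally show "p \<in> ?I \<or> q \<in> ?I" using mem pq(1,2) by simp
qed

section \<open>Primes of a quotient ring\<close>

lemma prime_chain_vimage:
  assumes R: "cring R" and I: "ideal I R"
    and P: "\<And>i. i \<le> n \<Longrightarrow> primeideal (P i) (R Quot I)" "\<And>i. i < n \<Longrightarrow> P i \<subset> P (Suc i)"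
  defines "Q \<equiv> \<lambda>i. {a \<in> carrier R. I +>\<^bsub>R\<^esub> a \<in> P i}"
  shows "\<And>i. i \<le> n \<Longrightarrow> primeideal (Q i) R" "\<And>i. i < n \<Longrightarrow> Q i \<subset> Q (Suc i)" "I \<subseteq> Q 0"
proof -
  interpret R: cring R by (rule R)
  interpret I: ideal I R by (rule I)
  interpret h: ring_hom_ring R "R Quot I" "(+>\<^bsub>R\<^esub>) I" by (rule I.rcos_ring_hom_ring)
  show "primeideal (Q i) R" if "i \<le> n" for i
    unfolding Q_def by (rule h.primeideal_vimage[OF R P(1)[OF that]])
  \<comment> \<open>Every element of the quotient is a coset with a representative, so a witness of
    strictness can be pulled back.\<close>
  show "Q i \<subset> Q (Suc i)" if i: "i < n" for i
  proof -
    obtain X where X: "X \<in> P (Suc i)" "X \<notin> P i" using P(2)[OF i] by blast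
    have "ideal (P (Suc i)) (R Quot I)" by (rule primeideal.axioms(1)[OF P(1)[OF Suc_leI[OF i]]])
    then have "X \<in> carrier (R Quot I)" using X(1) by (rule ideal.Icarr)
    then obtain a where a: "a \<in> carrier R" "X = I +>\<^bsub>R\<^esub> a"
      unfolding FactRing_def A_RCOSETS_def' by auto
    have "a \<in> Q (Suc i)" "a \<notin> Q i" using X a unfolding Q_def by blast+
    moreover have "Q i \<subseteq> Q (Suc i)" using P(2)[OF i] unfolding Q_def by blast
    ultimately show ?thesis by blast
  qed
  show "I \<subseteq> Q 0"
  proof
    fix a assume a: "a \<in> I"
    have "I +>\<^bsub>R\<^esub> a = I" using a by (rule I.a_rcos_const)
    also have "I = \<zero>\<^bsub>R Quot I\<^esub>" unfolding FactRing_def by simp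
    also have "\<dots> \<in> P 0"
      using P(1)[OF le0] by (intro additive_subgroup.zero_closed ideal.axioms(1) primeideal.axioms(1))
    finally show "a \<in> Q 0" using I.Icarr[OF a] unfolding Q_def by blast
  qed
qed

text \<open>As \<open>I\<close> is contained in \<open>Q\<close>, membership of a representative in
  \<open>Q\<close> depends only on its coset. Primality, and later the strictness of a chain, can
  therefore be checked on representatives.\<close>

lemma primeideal_image_quotient:
  assumes I: "ideal I R" and Q: "primeideal Q R" "I \<subseteq> Q"
  shows "primeideal ((+>\<^bsub>R\<^esub>) I ` Q) (R Quot I)"
    and "\<And>a. a \<in> carrier R \<Longrightarrow> I +>\<^bsub>R\<^esub> a \<in> (+>\<^bsub>R\<^esub>) I ` Q \<longleftrightarrow> a \<in> Q"
proof -
  interpret Q: primeideal Q R by (rule Q)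
  interpret I: ideal I R by (rule I)
  interpret h: ring_hom_ring R "R Quot I" "(+>\<^bsub>R\<^esub>) I" by (rule I.rcos_ring_hom_ring)
  show mem: "I +>\<^bsub>R\<^esub> a \<in> (+>\<^bsub>R\<^esub>) I ` Q \<longleftrightarrow> a \<in> Q" if a: "a \<in> carrier R" for a
  proof
    assume "I +>\<^bsub>R\<^esub> a \<in> (+>\<^bsub>R\<^esub>) I ` Q"
    then obtain q where q: "q \<in> Q" "I +>\<^bsub>R\<^esub> a = I +>\<^bsub>R\<^esub> q" by auto
    have "a \<in> I +>\<^bsub>R\<^esub> q" using I.a_rcos_self[OF a] q(2) by simp
    then obtain i where "i \<in> I" "a = i \<oplus>\<^bsub>R\<^esub> q" unfolding a_r_coset_def' by blast
    then show "a \<in> Q"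
      using additive_subgroup.a_closed[OF Q.is_additive_subgroup subsetD[OF Q(2)] q(1)] by simp
  qed simp
  show "primeideal ((+>\<^bsub>R\<^esub>) I ` Q) (R Quot I)"
  proof (rule primeidealI)
    show "ideal ((+>\<^bsub>R\<^esub>) I ` Q) (R Quot I)"
      by (rule Q.ring_ideal_imp_quot_ideal[OF I Q.is_ideal])
    show "cring (R Quot I)" by (rule I.quotient_is_cring[OF Q.is_cring])
    obtain a where a: "a \<in> carrier R" "a \<notin> Q" using Q.I_notcarr Q.a_subset by blast
    have "I +>\<^bsub>R\<^esub> a \<in> carrier (R Quot I)" by (rule h.hom_closed[OF a(1)])
    moreover have "I +>\<^bsub>R\<^esub> a \<notin> (+>\<^bsub>R\<^esub>) I ` Q" using mem[OF a(1)] a(2) by blast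
    ultimately show "carrier (R Quot I) \<noteq> (+>\<^bsub>R\<^esub>) I ` Q" by blast
    fix X Y assume XY: "X \<in> carrier (R Quot I)" "Y \<in> carrier (R Quot I)" "X \<otimes>\<^bsub>R Quot I\<^esub> Y \<in> (+>\<^bsub>R\<^esub>) I ` Q"
    obtain a b where ab: "a \<in> carrier R" "X = I +>\<^bsub>R\<^esub> a" "b \<in> carrier R" "Y = I +>\<^bsub>R\<^esub> b"
      using XY(1,2) unfolding FactRing_def A_RCOSETS_def' by auto
    have "I +>\<^bsub>R\<^esub> (a \<otimes>\<^bsub>R\<^esub> b) \<in> (+>\<^bsub>R\<^esub>) I ` Q"
      using XY(3) unfolding ab(2,4) h.hom_mult[OF ab(1,3)] .
    then have "a \<otimes>\<^bsub>R\<^esub> b \<in> Q" using mem[OF Q.m_closed[OF ab(1,3)]] by blast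
    then have "a \<in> Q \<or> b \<in> Q" by (rule Q.I_prime[OF ab(1,3)])
    then show "X \<in> (+>\<^bsub>R\<^esub>) I ` Q \<or> Y \<in> (+>\<^bsub>R\<^esub>) I ` Q" using ab by auto
  qed
qed

lemma krull_dim_matching_ideal:
  assumes "1 \<le> r" "r \<le> d"
  shows "krull_dim (poly_ring {..<d + r} Quot (matching_ideal d {..<d + r} r :: (nat, 'k::field) mpoly set)) = ereal (real d)"
proof -
  let ?V = "{..<d + r}"
  let ?R = "poly_ring ?V :: (nat, 'k) mpoly ring"
  let ?I = "matching_ideal d ?V r :: (nat, 'k) mpoly set"
  have R: "cring ?R" by (rule cring_poly_ring)
  have I: "ideal ?I ?R"
    by (rule ideal_poly_ring) (use hom_idealD[OF matching_ideal_hom] in blast)+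
  have upper: "n \<le> d" if P: "\<forall>i\<le>n. primeideal (P i) (?R Quot ?I)" "\<forall>i<n. P i \<subset> P (Suc i)" for n P
  proof -
    define Q where "Q i = {a \<in> carrier ?R. ?I +>\<^bsub>?R\<^esub> a \<in> P i}" for i
    have Q: "\<And>i. i \<le> n \<Longrightarrow> primeideal (Q i) ?R" "\<And>i. i < n \<Longrightarrow> Q i \<subset> Q (Suc i)" "?I \<subseteq> Q 0"
      unfolding Q_def using prime_chain_vimage[OF R I, of n P] P by blast+
    \<comment> \<open>These are the variables surviving modulo the smallest prime. By primality they
      contain at most one endpoint of each edge.\<close>
    define W where "W = {v \<in> ?V. (mvar v :: (nat, 'k) mpoly) \<notin> Q 0}"
    have "n \<le> card W"
      by (rule prime_chain_length_le[where Q = Q and V = ?V and n = n, OF Q(1) Q(2)]) (auto simp: W_def)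
    also have "card W \<le> card {..<d}"
    proof (rule card_inj_on_le)
      \<comment> \<open>Second endpoints are sent to their partners below \<open>d\<close>; a
        collision would put both ends of an edge into \<open>W\<close>.\<close>
      let ?f = "\<lambda>v. if v < d then v else v - d"
      have edge: "i \<notin> W \<or> d + i \<notin> W" if i: "i < r" for i
      proof -
        have iV: "i \<in> ?V" "d + i \<in> ?V" using i assms by auto
        have "mvar i * mvar (d + i) \<in> ?I"
          unfolding mvar_mult_mvar matching_ideal_def using i iV
          by (auto simp: keys_edge_monomial in_edges_def intro!: poly_ring_single)
        then have "(mvar i :: (nat, 'k) mpoly) \<in> Q 0 \<or> (mvar (d + i) :: (nat, 'k) mpoly) \<in> Q 0"
          using Q(3) by (intro primeideal_polyD(7)[OF Q(1)] poly_ring_mvar iV) auto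
        then show ?thesis by (auto simp: W_def)
      qed
      have neq: "v \<noteq> w - d" if "v < d" "w \<ge> d" "v \<in> W" "w \<in> W" for v w
      proof -
        have "w - d < r" using that by (auto simp: W_def)
        from edge[OF this] that show ?thesis by auto
      qed
      show "inj_on ?f W"
      proof (rule inj_onI)
        fix v w assume "v \<in> W" "w \<in> W" "?f v = ?f w"
        then show "v = w"
          using neq[of v w] neq[of w v] by (cases "v < d"; cases "w < d") auto
      qed
      show "?f ` W \<subseteq> {..<d}" using assms by (auto simp: W_def)
    qed simp
    finally show ?thesis by simp
  qed
  have lower: "\<exists>P. (\<forall>i\<le>d. primeideal (P i) (?R Quot ?I)) \<and> (\<forall>i<d. P i \<subset> P (Suc i))"
  proof -
    \<comment> \<open>The second endpoints form a vertex cover, so all these primes contain the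
      ideal. The \<open>d\<close> remaining variables are then added one at a time, giving
      \<open>d\<close> strict steps.\<close>
    define Q where "Q i = (variable_ideal ?V ({..<i} \<union> {d..<d + r}) :: (nat, 'k) mpoly set)" for i
    have prime: "primeideal (Q i) ?R" for i unfolding Q_def by (rule primeideal_variable_ideal)
    have IQ: "?I \<subseteq> Q i" for i
    proof
      fix p assume p: "p \<in> ?I"
      have "Poly_Mapping.keys m \<inter> ({..<i} \<union> {d..<d + r}) \<noteq> {}" if "m \<in> Poly_Mapping.keys p" for m
      proof -
        from p that obtain j where "j < r" "d + j \<in> Poly_Mapping.keys m"
          by (auto simp: matching_ideal_def in_edges_def)
        then have "d + j \<in> Poly_Mapping.keys m \<inter> ({..<i} \<union> {d..<d + r})" by simp
        then show ?thesis by blast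
      qed
      then show "p \<in> Q i" using p by (simp add: Q_def variable_ideal_def matching_ideal_def)
    qed
    let ?P = "\<lambda>i. (+>\<^bsub>?R\<^esub>) ?I ` Q i"
    note im = primeideal_image_quotient[OF I prime IQ]
    have "?P i \<subset> ?P (Suc i)" if i: "i < d" for i
    proof -
      have "Q i \<subseteq> Q (Suc i)" unfolding Q_def by (rule variable_ideal_mono) auto
      then have "?P i \<subseteq> ?P (Suc i)" by (rule image_mono)
      have c: "mvar i \<in> carrier ?R" using i by (intro poly_ring_mvar) simp
      have "Poly_Mapping.keys (mvar i :: (nat, 'k) mpoly) = {Poly_Mapping.single i 1}"
        by (simp add: mvar_def)
      \<comment> \<open>The support of the only monomial of \<open>mvar i\<close> is
        \<open>i\<close>, which meets the set of variables for the first time at step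
        \<open>Suc i\<close>, because \<open>i < d\<close>.\<close>
      then have "mvar i \<in> Q (Suc i)" "mvar i \<notin> Q i"
        using i c unfolding Q_def variable_ideal_def by simp_all
      then have "?I +>\<^bsub>?R\<^esub> mvar i \<in> ?P (Suc i)" "?I +>\<^bsub>?R\<^esub> mvar i \<notin> ?P i"
        unfolding im(2)[OF c] .
      with \<open>?P i \<subseteq> ?P (Suc i)\<close> show ?thesis by (metis psubsetI)
    qed
    then show ?thesis by (intro exI[of _ ?P] conjI allI impI im(1))
  qed
  show ?thesis
    unfolding krull_dim_def
  proof (rule antisym)
    show "Sup {ereal (real n) |n. \<exists>P. (\<forall>i\<le>n. primeideal (P i) (?R Quot ?I)) \<and> (\<forall>i<n. P i \<subset> P (Suc i))} \<le> ereal (real d)"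
    proof (rule Sup_least)
      fix z assume "z \<in> {ereal (real n) |n. \<exists>P. (\<forall>i\<le>n. primeideal (P i) (?R Quot ?I)) \<and> (\<forall>i<n. P i \<subset> P (Suc i))}"
      then obtain n P where "z = ereal (real n)" "\<forall>i\<le>n. primeideal (P i) (?R Quot ?I)" "\<forall>i<n. P i \<subset> P (Suc i)"
        by blast
      then show "z \<le> ereal (real d)" using upper[of n P] by simp
    qed
    show "ereal (real d) \<le> Sup {ereal (real n) |n. \<exists>P. (\<forall>i\<le>n. primeideal (P i) (?R Quot ?I)) \<and> (\<forall>i<n. P i \<subset> P (Suc i))}"
      using lower by (intro Sup_upper) blast
  qed
qed

theorem theorem4p8:
  fixes r d :: nat
  assumes "1 \<le> r" and "r \<le> d"
  shows "\<exists>G :: nat pair_pre_digraph. pair_graph G \<and>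
    regularity (pverts G) (edge_ideal G :: (nat, 'k::field) mpoly set) = int r \<and>
    krull_dim (poly_ring (pverts G) Quot (edge_ideal G :: (nat, 'k) mpoly set)) = ereal (real d)"
proof (intro exI conjI)
  let ?G = "matching_graph d r"
  show "pair_graph ?G" by (rule pair_graph_matching_graph[OF assms])
  show "regularity (pverts ?G) (edge_ideal ?G :: (nat, 'k) mpoly set) = int r"
    unfolding edge_ideal_matching_graph[OF assms] matching_graph_simps
    using assms by (intro regularity_matching_ideal) auto
  show "krull_dim (poly_ring (pverts ?G) Quot (edge_ideal ?G :: (nat, 'k) mpoly set)) = ereal (real d)"
    unfolding edge_ideal_matching_graph[OF assms] unfolding matching_graph_simps
    by (rule krull_dim_matching_ideal[OF assms])
qed

end
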